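(* Let $X$ be a smooth projective toric variety over a field $\mathbb{K}$ with total coordinate ring $S$. Let $M$ be a finitely generated $\operatorname{Pic}(X)$-graded $S$-module with $\widetilde M\neq 0$. Suppose the degrees of all minimal generators of $M$ are contained in $\operatorname{Eff} X$. Then $\operatorname{reg} M \subseteq \operatorname{Eff} X$.
   Context: $X$ is a smooth projective toric variety over a field $\mathbb{K}$, determined by a fan $\Sigma$. Its total coordinate (Cox) ring $S$ is the polynomial ring over $\mathbb{K}$ with one variable $x_\rho$ for each ray $\rho$ of $\Sigma$, graded by $\operatorname{Pic} X$ with $\deg x_\rho$ the class of the torus-invariant prime divisor $D_\rho$. $\operatorname{Eff}X$ is the submonoid of $\operatorname{Pic}X$ generated by the degrees of the variables of $S$. The irrelevant ideal is $B=\langle \prod_{\rho\not\subset\sigma}x_\rho : \sigma\in\Sigma\rangle\subset S$. For a graded $S$-module $M$, $\widetilde M$ is the associated quasi-coherent sheaf on $X$ (Cox's construction), and $H^i_B(M)$ is local cohomology with support in $B$. $\operatorname{Nef}X\subset\operatorname{Pic}X$ is the monoid of classes of numerically effective divisors, and $\mathbf C=(\mathbf c_1,\dots,\mathbf c_r)$ are its minimal monoid generators. For $\lambda\in\mathbb{Z}^r$ write $\lambda\cdot\mathbf C=\lambda_1\mathbf c_1+\dots+\lambda_r\mathbf c_r$ and $|\lambda|=\lambda_1+\dots+\lambda_r$. $\mathbb{N}$ includes $0$. Multigraded regularity: for $\mathbf d\in\operatorname{Pic}X$, a graded $S$-module $M$ is $\mathbf d$-regular if (1) $H^i_B(M)_{\mathbf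 b}=0$ for all $i>0$ and all $\mathbf b\in\bigcup_{\lambda\in\mathbb{N}^r,\,|\lambda|=i-1}(\mathbf d-\lambda\cdot\mathbf C+\operatorname{Nef}X)$; and (2) $H^0_B(M)_{\mathbf b}=0$ for all $\mathbf b\in\bigcup_j(\mathbf d+\mathbf c_j+\operatorname{Nef}X)$. $\operatorname{reg}M\subseteq\operatorname{Pic}X$ is the set of $\mathbf d$ such that $M$ is $\mathbf d$-regular. *)

theory Defs
  imports
    "HOL-Analysis.Analysis"
    "HOL-Algebra.Module"
    "HOL-Algebra.Free_Abelian_Groups"
begin

section \<open>Fans and smooth projective toric varieties\<close>

text \<open>
  A toric variety is given by a fan in a lattice \<open>N\<close>.  The lattice is a subgroup of a Euclidean
  space, generated over the integers by linearly independent vectors.  It need not have full rank: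
  \<open>N \<otimes> \<real>\<close> is \<open>span N\<close>, so that every rank, including \<open>0\<close>, occurs.
\<close>

record 'v toric =
  lat :: "'v set"
  cones :: "'v set set"

definition lattice_basis :: "'v::euclidean_space set \<Rightarrow> 'v set \<Rightarrow> bool" where
  "lattice_basis N A \<longleftrightarrow>
     independent A \<and> N = range (\<lambda>c :: 'v \<Rightarrow> int. \<Sum>a\<in>A. of_int (c a) *\<^sub>R a)"

definition is_fan :: "'v::euclidean_space toric \<Rightarrow> bool" where
  "is_fan X \<longleftrightarrow>
     (\<exists>A. lattice_basis (lat X) A) \<and>
     finite (cones X) \<and> cones X \<noteq> {} \<and>
     (\<forall>\<sigma>\<in>cones X.
        (\<exists>A. finite A \<and> A \<subseteq> lat X \<and> \<sigma> = convex_cone hull A) \<and>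
        \<sigma> \<inter> uminus ` \<sigma> = {0} \<and>
        (\<forall>\<tau>. \<tau> face_of \<sigma> \<and> \<tau> \<noteq> {} \<longrightarrow> \<tau> \<in> cones X)) \<and>
     (\<forall>\<sigma>\<in>cones X. \<forall>\<tau>\<in>cones X. (\<sigma> \<inter> \<tau>) face_of \<sigma> \<and> (\<sigma> \<inter> \<tau>) face_of \<tau>)"

definition smooth_fan :: "'v::euclidean_space toric \<Rightarrow> bool" where
  "smooth_fan X \<longleftrightarrow>
     (\<forall>\<sigma>\<in>cones X. \<exists>A A'. lattice_basis (lat X) A \<and> A' \<subseteq> A \<and> \<sigma> = convex_cone hull A')"

text \<open>The dual lattice is realised inside \<open>span N\<close> by means of the inner product.\<close>

definition dual_lattice :: "'v::euclidean_space toric \<Rightarrow> 'v set" where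
  "dual_lattice X = {m \<in> span (lat X). \<forall>v\<in>lat X. m \<bullet> v \<in> \<int>}"

text \<open>
  The (inner) normal fan of a polytope \<open>P\<close>.  The variety of a fan is projective iff the fan is the
  normal fan of a lattice polytope.  This contains completeness, and the polytope is automatically
  full-dimensional in \<open>span N\<close> because the cones of a fan are strongly convex.
\<close>

definition normal_fan :: "'v::euclidean_space set \<Rightarrow> 'v set \<Rightarrow> 'v set set" where
  "normal_fan N P =
     {{v \<in> span N. \<forall>p\<in>F. \<forall>q\<in>P. p \<bullet> v \<le> q \<bullet> v} | F. F face_of P \<and> F \<noteq> {}}"

definition projective_fan :: "'v::euclidean_space toric \<Rightarrow> bool" where
  "projective_fan X \<longleftrightarrow>
     (\<exists>V. finite V \<and> V \<noteq> {} \<and> V \<subseteq> dual_lattice X \<and>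
          cones X = normal_fan (lat X) (convex hull V))"

definition smooth_projective_toric_variety :: "'v::euclidean_space toric \<Rightarrow> bool" where
  "smooth_projective_toric_variety X \<longleftrightarrow> is_fan X \<and> smooth_fan X \<and> projective_fan X"

definition rays :: "'v::euclidean_space toric \<Rightarrow> 'v set set" where
  "rays X = {\<rho> \<in> cones X. dim \<rho> = 1}"

text \<open>The first nonzero lattice point on a ray.\<close>

definition ray_gen :: "'v::euclidean_space toric \<Rightarrow> 'v set \<Rightarrow> 'v" where
  "ray_gen X \<rho> = (THE u. \<rho> \<inter> lat X = range (\<lambda>k::nat. of_nat k *\<^sub>R u))"


section \<open>Divisor classes\<close>

type_synonym 'v divisor = "'v set \<Rightarrow>\<^sub>0 int"
type_synonym 'v pic = "'v divisor set"

definition principal_divisor :: "'v::euclidean_space toric \<Rightarrow> 'v \<Rightarrow> 'v divisor" where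
  "principal_divisor X m = (\<Sum>\<rho>\<in>rays X. Poly_Mapping.single \<rho> \<lfloor>m \<bullet> ray_gen X \<rho>\<rfloor>)"

text \<open>
  The Picard group: torus-invariant divisors modulo divisors of characters (on a smooth variety
  every Weil divisor is Cartier).  The group is written multiplicatively, as usual in HOL-Algebra.
\<close>

definition Pic :: "'v::euclidean_space toric \<Rightarrow> 'v pic monoid" where
  "Pic X = free_Abelian_group (rays X) Mod (principal_divisor X ` dual_lattice X)"

definition div_class :: "'v::euclidean_space toric \<Rightarrow> 'v divisor \<Rightarrow> 'v pic" where
  "div_class X D = (principal_divisor X ` dual_lattice X) #>\<^bsub>free_Abelian_group (rays X)\<^esub> D"

inductive_set monoid_span :: "('a, 'b) monoid_scheme \<Rightarrow> 'a set \<Rightarrow> 'a set"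
  for G :: "('a, 'b) monoid_scheme" (structure) and A :: "'a set" where
    one: "\<one> \<in> monoid_span G A"
  | incl: "a \<in> A \<Longrightarrow> a \<in> monoid_span G A"
  | mult: "a \<in> monoid_span G A \<Longrightarrow> b \<in> monoid_span G A \<Longrightarrow> a \<otimes> b \<in> monoid_span G A"

definition minimal_monoid_generators :: "('a, 'b) monoid_scheme \<Rightarrow> 'a set \<Rightarrow> 'a set \<Rightarrow> bool" where
  "minimal_monoid_generators G A C \<longleftrightarrow>
     finite C \<and> monoid_span G C = A \<and> (\<forall>C'. C' \<subset> C \<longrightarrow> monoid_span G C' \<noteq> A)"

definition Eff :: "'v::euclidean_space toric \<Rightarrow> 'v pic set" where
  "Eff X = monoid_span (Pic X) ((\<lambda>\<rho>. div_class X (Poly_Mapping.single \<rho> 1)) ` rays X)"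

text \<open>
  The complete irreducible torus-invariant curves on \<open>X\<close> are the orbit closures \<open>V(\<tau>)\<close> of the
  cones \<open>\<tau>\<close> of codimension one.  The intersection numbers \<open>\<beta> \<rho> = D\<^sub>\<rho> \<cdot> V(\<tau>)\<close> on a smooth complete
  toric variety are determined as follows.  If \<open>\<rho>\<close> is not in \<open>\<tau>\<close>, then \<open>D\<^sub>\<rho>\<close> and \<open>V(\<tau>)\<close> meet
  transversally in one point or not at all, according as \<open>\<rho>\<close> and \<open>\<tau>\<close> lie in a common cone
  or not; the remaining numbers follow from the fact that principal divisors have degree zero on
  \<open>V(\<tau>)\<close>, which is the wall relation \<open>\<Sum>\<^sub>\<rho> (D\<^sub>\<rho> \<cdot> V(\<tau>)) u\<^sub>\<rho> = 0\<close>.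
\<close>

definition walls :: "'v::euclidean_space toric \<Rightarrow> 'v set set" where
  "walls X = {\<tau> \<in> cones X. dim \<tau> + 1 = dim (lat X)}"

definition intersection_numbers ::
    "'v::euclidean_space toric \<Rightarrow> 'v set \<Rightarrow> ('v set \<Rightarrow> int) \<Rightarrow> bool" where
  "intersection_numbers X \<tau> \<beta> \<longleftrightarrow>
     (\<forall>\<rho>\<in>rays X. \<not> \<rho> \<subseteq> \<tau> \<longrightarrow>
        \<beta> \<rho> = (if \<exists>\<sigma>\<in>cones X. \<rho> \<subseteq> \<sigma> \<and> \<tau> \<subseteq> \<sigma> then 1 else 0)) \<and>
     (\<Sum>\<rho>\<in>rays X. of_int (\<beta> \<rho>) *\<^sub>R ray_gen X \<rho>) = 0"

text \<open>
  Numerically effective divisors.  On a complete toric variety every effective curve is numerically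
  equivalent to an effective combination of torus-invariant ones, so it is enough to
  intersect with the curves \<open>V(\<tau>)\<close>.
\<close>

definition nef_divisor :: "'v::euclidean_space toric \<Rightarrow> 'v divisor \<Rightarrow> bool" where
  "nef_divisor X D \<longleftrightarrow>
     (\<forall>\<tau>\<in>walls X. \<forall>\<beta>. intersection_numbers X \<tau> \<beta> \<longrightarrow>
        (\<Sum>\<rho>\<in>rays X. Poly_Mapping.lookup D \<rho> * \<beta> \<rho>) \<ge> 0)"

definition Nef :: "'v::euclidean_space toric \<Rightarrow> 'v pic set" where
  "Nef X = div_class X ` {D \<in> carrier (free_Abelian_group (rays X)). nef_divisor X D}"


section \<open>The total coordinate ring and graded modules\<close>

type_synonym 'v exponent = "'v set \<Rightarrow>\<^sub>0 nat"
type_synonym ('v, 'k) cox = "'v exponent \<Rightarrow>\<^sub>0 'k"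

definition cox_ring :: "'v::euclidean_space toric \<Rightarrow> ('v, 'k::field) cox ring" where
  "cox_ring X = \<lparr>carrier = {f. \<forall>t\<in>Poly_Mapping.keys f. Poly_Mapping.keys t \<subseteq> rays X},
                 monoid.mult = (*), one = 1, ring.zero = 0, ring.add = (+)\<rparr>"

abbreviation xmon :: "'v exponent \<Rightarrow> ('v, 'k::field) cox" where
  "xmon t \<equiv> Poly_Mapping.single t 1"

definition mdeg :: "'v::euclidean_space toric \<Rightarrow> 'v exponent \<Rightarrow> 'v pic" where
  "mdeg X t = div_class X (Poly_Mapping.map int t)"

definition cox_part :: "'v::euclidean_space toric \<Rightarrow> 'v pic \<Rightarrow> ('v, 'k::field) cox set" where
  "cox_part X a = {f \<in> carrier (cox_ring X). \<forall>t\<in>Poly_Mapping.keys f. mdeg X t = a}"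

text \<open>\<open>gr b\<close> is the homogeneous part of degree \<open>b\<close> of \<open>M\<close>.\<close>

definition graded_module ::
    "'v::euclidean_space toric \<Rightarrow> (('v, 'k::field) cox, 'm) module \<Rightarrow> ('v pic \<Rightarrow> 'm set) \<Rightarrow> bool" where
  "graded_module X M gr \<longleftrightarrow>
     Module.module (cox_ring X) M \<and>
     (\<forall>b\<in>carrier (Pic X). subgroup (gr b) (add_monoid M)) \<and>
     (\<forall>m\<in>carrier M. \<exists>!c. c \<in> (\<Pi>\<^sub>E b\<in>carrier (Pic X). gr b) \<and>
        finite {b \<in> carrier (Pic X). c b \<noteq> \<zero>\<^bsub>M\<^esub>} \<and>
        m = finsum M c {b \<in> carrier (Pic X). c b \<noteq> \<zero>\<^bsub>M\<^esub>}) \<and>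
     (\<forall>a\<in>carrier (Pic X). \<forall>b\<in>carrier (Pic X). \<forall>f\<in>cox_part X a. \<forall>m\<in>gr b.
        f \<odot>\<^bsub>M\<^esub> m \<in> gr (a \<otimes>\<^bsub>Pic X\<^esub> b))"

definition generates :: "('s, 'a) ring_scheme \<Rightarrow> ('s, 'm) module \<Rightarrow> 'm set \<Rightarrow> bool" where
  "generates S M G \<longleftrightarrow> G \<subseteq> carrier M \<and> (\<lambda>H. submodule H S M) hull G = carrier M"

definition finitely_generated :: "('s, 'a) ring_scheme \<Rightarrow> ('s, 'm) module \<Rightarrow> bool" where
  "finitely_generated S M \<longleftrightarrow> (\<exists>G. finite G \<and> generates S M G)"

definition minimal_homogeneous_generators ::
    "'v::euclidean_space toric \<Rightarrow> (('v, 'k::field) cox, 'm) module \<Rightarrow> ('v pic \<Rightarrow> 'm set)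
      \<Rightarrow> 'm set \<Rightarrow> bool" where
  "minimal_homogeneous_generators X M gr G \<longleftrightarrow>
     G \<subseteq> (\<Union>b\<in>carrier (Pic X). gr b) \<and> generates (cox_ring X) M G \<and>
     (\<forall>G'. G' \<subset> G \<longrightarrow> \<not> generates (cox_ring X) M G')"

definition minimal_generator_degrees ::
    "'v::euclidean_space toric \<Rightarrow> (('v, 'k::field) cox, 'm) module \<Rightarrow> ('v pic \<Rightarrow> 'm set)
      \<Rightarrow> 'v pic set" where
  "minimal_generator_degrees X M gr =
     {b \<in> carrier (Pic X). \<exists>G. minimal_homogeneous_generators X M gr G \<and> G \<inter> gr b \<noteq> {}}"


section \<open>Localisation and the associated sheaf\<close>

text \<open>
  The localisation of \<open>M\<close> at the powers of \<open>f\<close>, as an abelian group written multiplicatively;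
  \<open>fraction M f m k\<close> is the fraction \<open>m / f ^ k\<close>.
\<close>

definition loc_rel :: "('s::comm_ring_1, 'm) module \<Rightarrow> 's \<Rightarrow> (('m \<times> nat) \<times> ('m \<times> nat)) set" where
  "loc_rel M f = {((m, k), (n, l)). m \<in> carrier M \<and> n \<in> carrier M \<and>
     (\<exists>j. f ^ (j + l) \<odot>\<^bsub>M\<^esub> m = f ^ (j + k) \<odot>\<^bsub>M\<^esub> n)}"

definition fraction :: "('s::comm_ring_1, 'm) module \<Rightarrow> 's \<Rightarrow> 'm \<Rightarrow> nat \<Rightarrow> ('m \<times> nat) set" where
  "fraction M f m k = loc_rel M f `` {(m, k)}"

definition localization :: "('s::comm_ring_1, 'm) module \<Rightarrow> 's \<Rightarrow> ('m \<times> nat) set monoid" where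
  "localization M f =
     \<lparr>carrier = (carrier M \<times> UNIV) // loc_rel M f,
      monoid.mult = (\<lambda>x y. \<Union>(m, k)\<in>x. \<Union>(n, l)\<in>y.
         fraction M f (f ^ l \<odot>\<^bsub>M\<^esub> m \<oplus>\<^bsub>M\<^esub> f ^ k \<odot>\<^bsub>M\<^esub> n) (k + l)),
      one = fraction M f \<zero>\<^bsub>M\<^esub> 0\<rparr>"

text \<open>The homogeneous part of degree \<open>b\<close> of the localisation of \<open>M\<close> at the monomial \<open>x\<^sup>t\<close>.\<close>

definition localization_part ::
    "'v::euclidean_space toric \<Rightarrow> (('v, 'k::field) cox, 'm) module \<Rightarrow> ('v pic \<Rightarrow> 'm set)
      \<Rightarrow> 'v exponent \<Rightarrow> 'v pic \<Rightarrow> ('m \<times> nat) set monoid" where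
  "localization_part X M gr t b =
     (localization M (xmon t))
       \<lparr>carrier := {fraction M (xmon t) m k | m k. m \<in> gr (b \<otimes>\<^bsub>Pic X\<^esub> mdeg X t [^]\<^bsub>Pic X\<^esub> k)}\<rparr>"

text \<open>The exponent of the generator \<open>\<Prod> x\<^sub>\<rho>\<close> (over the rays not in \<open>\<sigma>\<close>) of the irrelevant ideal.\<close>

definition xhat :: "'v::euclidean_space toric \<Rightarrow> 'v set \<Rightarrow> 'v exponent" where
  "xhat X \<sigma> = (\<Sum>\<rho> | \<rho> \<in> rays X \<and> \<not> \<rho> \<subseteq> \<sigma>. Poly_Mapping.single \<rho> 1)"

text \<open>
  The sheaf associated with \<open>M\<close> is glued from the modules of its sections over the affine charts
  \<open>U\<^sub>\<sigma>\<close>, which are the degree-zero parts of the localisations of \<open>M\<close> at the generators of the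
  irrelevant ideal.  Since the charts cover \<open>X\<close>, it is nonzero iff one of these modules is.
\<close>

definition sheaf_sections ::
    "'v::euclidean_space toric \<Rightarrow> (('v, 'k::field) cox, 'm) module \<Rightarrow> ('v pic \<Rightarrow> 'm set)
      \<Rightarrow> 'v set \<Rightarrow> ('m \<times> nat) set monoid" where
  "sheaf_sections X M gr \<sigma> = localization_part X M gr (xhat X \<sigma>) \<one>\<^bsub>Pic X\<^esub>"

definition sheaf_nonzero ::
    "'v::euclidean_space toric \<Rightarrow> (('v, 'k::field) cox, 'm) module \<Rightarrow> ('v pic \<Rightarrow> 'm set) \<Rightarrow> bool" where
  "sheaf_nonzero X M gr \<longleftrightarrow> (\<exists>\<sigma>\<in>cones X. \<not> trivial_group (sheaf_sections X M gr \<sigma>))"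


section \<open>Local cohomology\<close>

text \<open>
  Local cohomology with support in the ideal generated by monomials \<open>x\<^sup>t\<close>, for \<open>t\<close> in a list \<open>ts\<close>,
  is the cohomology of the (extended, ordered) Cech complex
  \<open>0 \<rightarrow> M \<rightarrow> \<Oplus>\<^sub>i M[1/f\<^sub>i] \<rightarrow> \<Oplus>\<^sub>i\<^sub><\<^sub>j M[1/(f\<^sub>i f\<^sub>j)] \<rightarrow> \<dots>\<close>
  of these generators.  The differentials preserve degrees, so the complex is formed separately in
  each degree \<open>b\<close>.  The summands of the \<open>p\<close>-th term are indexed by increasing lists of length \<open>p\<close>.
\<close>

definition cech_index :: "nat \<Rightarrow> nat \<Rightarrow> nat list set" where
  "cech_index n p = {js. length js = p \<and> sorted_wrt (<) js \<and> set js \<subseteq> {..<n}}"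

definition omit :: "nat \<Rightarrow> 'a list \<Rightarrow> 'a list" where
  "omit k js = take k js @ drop (Suc k) js"

definition cech_exponent :: "'v exponent list \<Rightarrow> nat list \<Rightarrow> 'v exponent" where
  "cech_exponent ts js = sum_list (map (\<lambda>j. ts ! j) js)"

definition cech_cochains ::
    "'v::euclidean_space toric \<Rightarrow> (('v, 'k::field) cox, 'm) module \<Rightarrow> ('v pic \<Rightarrow> 'm set)
      \<Rightarrow> 'v exponent list \<Rightarrow> nat \<Rightarrow> 'v pic \<Rightarrow> (nat list \<Rightarrow> ('m \<times> nat) set) monoid" where
  "cech_cochains X M gr ts p b =
     product_group (cech_index (length ts) p)
       (\<lambda>js. localization_part X M gr (cech_exponent ts js) b)"

text \<open>The natural map from the localisation at \<open>f\<close> to the localisation at \<open>h = f * g\<close>.\<close>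

definition loc_map ::
    "('s::comm_ring_1, 'm) module \<Rightarrow> 's \<Rightarrow> 's \<Rightarrow> ('m \<times> nat) set \<Rightarrow> ('m \<times> nat) set" where
  "loc_map M h g x = (\<Union>(m, k)\<in>x. fraction M h (g ^ k \<odot>\<^bsub>M\<^esub> m) k)"

text \<open>The usual alternating sum; the exponent \<open>(- 1) ^ k\<close> is a sign, the groups being
  multiplicative.\<close>

definition cech_diff ::
    "(('v, 'k::field) cox, 'm) module \<Rightarrow> 'v exponent list \<Rightarrow> nat
      \<Rightarrow> (nat list \<Rightarrow> ('m \<times> nat) set) \<Rightarrow> (nat list \<Rightarrow> ('m \<times> nat) set)" where
  "cech_diff M ts p \<alpha> =
     (\<lambda>js\<in>cech_index (length ts) (Suc p).
        finprod (localization M (xmon (cech_exponent ts js)))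
          (\<lambda>k. loc_map M (xmon (cech_exponent ts js)) (xmon (ts ! (js ! k))) (\<alpha> (omit k js))
                 [^]\<^bsub>localization M (xmon (cech_exponent ts js))\<^esub> ((- 1) ^ k :: int))
          {..p})"

definition cech_cocycles ::
    "'v::euclidean_space toric \<Rightarrow> (('v, 'k::field) cox, 'm) module \<Rightarrow> ('v pic \<Rightarrow> 'm set)
      \<Rightarrow> 'v exponent list \<Rightarrow> nat \<Rightarrow> 'v pic \<Rightarrow> (nat list \<Rightarrow> ('m \<times> nat) set) set" where
  "cech_cocycles X M gr ts p b =
     kernel (cech_cochains X M gr ts p b) (cech_cochains X M gr ts (Suc p) b) (cech_diff M ts p)"

fun cech_coboundaries ::
    "'v::euclidean_space toric \<Rightarrow> (('v, 'k::field) cox, 'm) module \<Rightarrow> ('v pic \<Rightarrow> 'm set)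
      \<Rightarrow> 'v exponent list \<Rightarrow> nat \<Rightarrow> 'v pic \<Rightarrow> (nat list \<Rightarrow> ('m \<times> nat) set) set" where
  "cech_coboundaries X M gr ts 0 b = {\<one>\<^bsub>cech_cochains X M gr ts 0 b\<^esub>}"
| "cech_coboundaries X M gr ts (Suc p) b =
     cech_diff M ts p ` carrier (cech_cochains X M gr ts p b)"

definition local_cohomology ::
    "'v::euclidean_space toric \<Rightarrow> (('v, 'k::field) cox, 'm) module \<Rightarrow> ('v pic \<Rightarrow> 'm set)
      \<Rightarrow> 'v exponent list \<Rightarrow> nat \<Rightarrow> 'v pic \<Rightarrow> (nat list \<Rightarrow> ('m \<times> nat) set) set monoid" where
  "local_cohomology X M gr ts p b =
     (cech_cochains X M gr ts p b)\<lparr>carrier := cech_cocycles X M gr ts p b\<rparr>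
       Mod cech_coboundaries X M gr ts p b"

text \<open>
  The list of generators of the irrelevant ideal \<open>B\<close>, one for each cone.  The
  enumeration of the cones is arbitrary; it only serves to fix the signs in the Cech complex.
\<close>

definition irrelevant_generators :: "'v::euclidean_space toric \<Rightarrow> 'v exponent list" where
  "irrelevant_generators X =
     map (xhat X) (SOME \<sigma>s. distinct \<sigma>s \<and> set \<sigma>s = cones X)"

text \<open>\<open>H_B X M gr i b\<close> is the homogeneous part of degree \<open>b\<close> of the \<open>i\<close>-th local cohomology
  module of \<open>M\<close> with support in \<open>B\<close>.\<close>

definition H_B ::
    "'v::euclidean_space toric \<Rightarrow> (('v, 'k::field) cox, 'm) module \<Rightarrow> ('v pic \<Rightarrow> 'm set)
      \<Rightarrow> nat \<Rightarrow> 'v pic \<Rightarrow> (nat list \<Rightarrow> ('m \<times> nat) set) set monoid" where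
  "H_B X M gr i b = local_cohomology X M gr (irrelevant_generators X) i b"


section \<open>Multigraded regularity\<close>

text \<open>
  \<open>C\<close> is the set of minimal generators of the nef monoid; a vector \<open>\<lambda>\<close> of natural numbers is a
  function \<open>l\<close> on \<open>C\<close>, and \<open>\<lambda> \<cdot> C\<close> is the element \<open>comb X C l\<close>.
\<close>

definition comb :: "'v::euclidean_space toric \<Rightarrow> 'v pic set \<Rightarrow> ('v pic \<Rightarrow> nat) \<Rightarrow> 'v pic" where
  "comb X C l = finprod (Pic X) (\<lambda>c. c [^]\<^bsub>Pic X\<^esub> l c) C"

definition regular ::
    "'v::euclidean_space toric \<Rightarrow> 'v pic set \<Rightarrow> (('v, 'k::field) cox, 'm) module
      \<Rightarrow> ('v pic \<Rightarrow> 'm set) \<Rightarrow> 'v pic \<Rightarrow> bool" where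
  "regular X C M gr d \<longleftrightarrow>
     (\<forall>i>0. \<forall>l. sum l C = i - 1 \<longrightarrow> (\<forall>a\<in>Nef X.
        trivial_group (H_B X M gr i (d \<otimes>\<^bsub>Pic X\<^esub> inv\<^bsub>Pic X\<^esub> (comb X C l) \<otimes>\<^bsub>Pic X\<^esub> a)))) \<and>
     (\<forall>c\<in>C. \<forall>a\<in>Nef X. trivial_group (H_B X M gr 0 (d \<otimes>\<^bsub>Pic X\<^esub> c \<otimes>\<^bsub>Pic X\<^esub> a)))"

definition reg ::
    "'v::euclidean_space toric \<Rightarrow> 'v pic set \<Rightarrow> (('v, 'k::field) cox, 'm) module
      \<Rightarrow> ('v pic \<Rightarrow> 'm set) \<Rightarrow> 'v pic set" where
  "reg X C M gr = {d \<in> carrier (Pic X). regular X C M gr d}"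

end

theory Submission
  imports Defs
begin

text \<open>
  Suppose that \<open>M\<close> is \<open>d\<close>-regular but \<open>d \<notin> Eff X\<close>.  Then \<open>M\<^sub>d = 0\<close>, because \<open>M\<close> is generated in
  degrees of \<open>Eff X\<close>.  As \<open>H\<^sup>1\<^sub>B(M)\<^sub>d = 0\<close>, the twisted sheaf of degree \<open>d\<close> has no global sections.
  A nef class \<open>c\<close> is generated by monomial global sections; in the Koszul complex of these, the
  vanishing of the local cohomology in the degrees \<open>d + n - i c\<close> carries the absence of sections
  from degree \<open>d + n\<close> to degree \<open>d + n + c\<close>.  So there are no sections in any degree of
  \<open>d + Nef X\<close>.  But if the sheaf is nonzero, then on some maximal chart there is a homogeneous
  element of \<open>M\<close> that is not torsion, and its product with a suitable monomial has degree
  \<open>d + n\<close> for a multiple \<open>n\<close> of an ample class.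

  That nef classes, which are given by intersection numbers, are generated by global sections is
  proved by following the simplex algorithm along the vertices of the polytope.
\<close>

text \<open>The extended Cech complex starts with M itself, so the global sections in degree b are
  the Cech cocycles of degree 1, and H^1_B is their quotient by the image of M_b. The degrees fit
  exactly: to reach e = d + n + c, the chase uses H^(p+1)_B in degree e - (p+1) c = d + n - p c,
  which regularity covers because p copies of c have |\<lambda>| = p = i - 1. On each intersection
  of charts some section is invertible, and its inverse gives a homotopy t with \<Sum> s_i t_i = 1.
  Two obstacles shape the chase. The homotopy exists only in positive Cech degree, since nothing is
  inverted on M; and it depends on the chart, so it need not commute with the Cech differential.
  Lifts must therefore be corrected, one Cech degree at a time, starting from the top of the
  complex. In the final step the monomial x^t involves only variables that are invertible on the
  maximal chart, so x^t divides a power of the generator of B for that chart. If a power of this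
  generator kills x^t m, then a larger power kills m.\<close>

abbreviation "lookup \<equiv> Poly_Mapping.lookup"
abbreviation "keys \<equiv> Poly_Mapping.keys"
abbreviation "single \<equiv> Poly_Mapping.single"

section \<open>Koszul complexes\<close>

text \<open>
  The Koszul complex on commuting endomorphisms \<open>s 0, \<dots>, s (n - 1)\<close> as an iterated mapping cone.
  An element is a family indexed by the subsets of \<open>{..<n}\<close>; a subset is encoded by its
  indicator list, which starts with the index \<open>n - 1\<close>.  The operator \<open>kos G s t\<close> is the sum of the
  Koszul differential of \<open>s\<close> (the case \<open>t = 0\<close>) and the homotopy given by \<open>t\<close> (the case
  \<open>s = 0\<close>); its square is multiplication by \<open>\<Sum>\<^sub>i s\<^sub>i t\<^sub>i\<close>.
\<close>

fun kos :: "('a, 'b) monoid_scheme \<Rightarrow> (nat \<Rightarrow> 'a \<Rightarrow> 'a) \<Rightarrow> (nat \<Rightarrow> 'a \<Rightarrow> 'a) \<Rightarrow> nat \<Rightarrow>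
    (bool list \<Rightarrow> 'a) \<Rightarrow> bool list \<Rightarrow> 'a" where
  "kos G s t (Suc n) u (False # A) = kos G s t n (\<lambda>B. u (False # B)) A \<otimes>\<^bsub>G\<^esub> s n (u (True # A))"
| "kos G s t (Suc n) u (True # A) =
     inv\<^bsub>G\<^esub> (kos G s t n (\<lambda>B. u (True # B)) A) \<otimes>\<^bsub>G\<^esub> t n (u (False # A))"
| "kos G s t _ u _ = \<one>\<^bsub>G\<^esub>"

fun kos_sum :: "('a, 'b) monoid_scheme \<Rightarrow> (nat \<Rightarrow> 'a \<Rightarrow> 'a) \<Rightarrow> (nat \<Rightarrow> 'a \<Rightarrow> 'a) \<Rightarrow> nat \<Rightarrow> 'a \<Rightarrow> 'a" where
  "kos_sum G s t 0 x = \<one>\<^bsub>G\<^esub>"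
| "kos_sum G s t (Suc n) x = kos_sum G s t n x \<otimes>\<^bsub>G\<^esub> s n (t n x)"

abbreviation weight :: "bool list \<Rightarrow> nat" where
  "weight A \<equiv> count_list A True"

abbreviation zero_op :: "('a, 'b) monoid_scheme \<Rightarrow> nat \<Rightarrow> 'a \<Rightarrow> 'a" where
  "zero_op G \<equiv> \<lambda>_ _. \<one>\<^bsub>G\<^esub>"

context comm_group
begin

lemma hom_simps:
  assumes "f \<in> hom G G"
  shows "x \<in> carrier G \<Longrightarrow> f x \<in> carrier G" "f \<one> = \<one>"
    "x \<in> carrier G \<Longrightarrow> y \<in> carrier G \<Longrightarrow> f (x \<otimes> y) = f x \<otimes> f y"
    "x \<in> carrier G \<Longrightarrow> f (inv x) = inv (f x)"
  using hom_in_carrier[OF assms] hom_one[OF assms] hom_mult[OF assms] group_hom.hom_inv[of G G f] assms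
  by (auto simp: group_hom_def group_hom_axioms_def is_group)

lemma zero_op_hom: "zero_op G i \<in> hom G G"
  by (auto simp: hom_def)

lemma kos_closed:
  assumes "\<And>i. s i \<in> hom G G" "\<And>i. t i \<in> hom G G" "\<And>A. u A \<in> carrier G"
  shows "kos G s t n u A \<in> carrier G"
  using assms(3)
proof (induction n arbitrary: u A)
  case 0
  then show ?case by (cases A) auto
next
  case (Suc n)
  show ?case
  proof (cases A)
    case (Cons a B)
    then show ?thesis
      using Suc.IH[of "\<lambda>B. u (a # B)" B] Suc.prems hom_simps[OF assms(1)] hom_simps[OF assms(2)]
      by (cases a) auto
  qed simp
qed

text \<open>The recursion uses only group operations and the operators, so a homomorphism that
  intertwines the operators passes through it. It is applied to inversion, to \<open>s n\<close> and
  \<open>t n\<close> themselves, and to the Cech differential.\<close>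

lemma kos_natural:
  assumes "group G'" "f \<in> hom G G'" "\<And>i. s i \<in> hom G G" "\<And>i. t i \<in> hom G G" "\<And>A. u A \<in> carrier G"
    and "\<And>i x. x \<in> carrier G \<Longrightarrow> f (s i x) = s' i (f x)" "\<And>i x. x \<in> carrier G \<Longrightarrow> f (t i x) = t' i (f x)"
  shows "kos G' s' t' n (\<lambda>B. f (u B)) A = f (kos G s t n u A)"
  using assms(5)
proof (induction n arbitrary: u A)
  case 0
  then show ?case using assms hom_one[of f G G'] by (cases A) (auto simp: is_group)
next
  case (Suc n)
  interpret f: group_hom G G' f
    using assms by (simp add: group_hom_def group_hom_axioms_def is_group)
  show ?case
  proof (cases A)
    case (Cons a B)
    then show ?thesis
      using Suc.IH[of "\<lambda>B. u (a # B)" B] Suc.prems assms(3,4,6,7) hom_simps[OF assms(3)] hom_simps[OF assms(4)]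
      by (cases a) (auto simp: kos_closed)
  qed simp
qed

lemma kos_mult:
  assumes "\<And>i. s i \<in> hom G G" "\<And>i. t i \<in> hom G G" "\<And>A. u A \<in> carrier G" "\<And>A. v A \<in> carrier G"
  shows "kos G s t n (\<lambda>B. u B \<otimes> v B) A = kos G s t n u A \<otimes> kos G s t n v A"
  using assms(3,4)
proof (induction n arbitrary: u v A)
  case (Suc n)
  show ?case
  proof (cases A)
    case (Cons a B)
    then show ?thesis
      using Suc.IH[of "\<lambda>B. u (a # B)" "\<lambda>B. v (a # B)" B] Suc.prems assms(1,2)
        hom_simps[OF assms(1)] hom_simps[OF assms(2)]
      by (cases a) (auto simp: kos_closed m_ac inv_mult)
  qed simp
qed simp

lemma kos_inv:
  assumes "\<And>i. s i \<in> hom G G" "\<And>i. t i \<in> hom G G" "\<And>A. u A \<in> carrier G"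
  shows "kos G s t n (\<lambda>B. inv (u B)) A = inv (kos G s t n u A)"
  by (rule kos_natural)
     (use assms hom_simps(4)[OF assms(1)] hom_simps(4)[OF assms(2)] in \<open>auto simp: hom_def inv_mult\<close>)

text \<open>The operators \<open>s\<close> enter only at an entry \<open>False\<close> and the
  operators \<open>t\<close> only at an entry \<open>True\<close>, so the Koszul differential and
  the homotopy simply add up.\<close>

lemma kos_split:
  assumes "\<And>i. s i \<in> hom G G" "\<And>i. t i \<in> hom G G" "\<And>A. u A \<in> carrier G"
  shows "kos G s t n u A = kos G s (zero_op G) n u A \<otimes> kos G (zero_op G) t n u A"
  using assms(3)
proof (induction n arbitrary: u A)
  case (Suc n)
  show ?case
  proof (cases A)
    case (Cons a B)
    then show ?thesis
      using Suc.IH[of "\<lambda>B. u (a # B)" B] Suc.prems assms(1,2) hom_simps(1)[OF assms(1)] hom_simps(1)[OF assms(2)]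
      by (cases a) (auto simp: kos_closed zero_op_hom m_ac inv_mult)
  qed simp
qed simp

lemma kos_sum_closed:
  "\<lbrakk>\<And>i. s i \<in> hom G G; \<And>i. t i \<in> hom G G; x \<in> carrier G\<rbrakk> \<Longrightarrow> kos_sum G s t n x \<in> carrier G"
  by (induction n) (auto intro!: m_closed intro: hom_in_carrier)

lemma kos_sum_one: "(\<And>i. s i (t i x) = \<one>) \<Longrightarrow> kos_sum G s t n x = \<one>"
  by (induction n) auto

lemma mult_inv_cancel:
  assumes "x \<in> carrier G" "y \<in> carrier G" "z \<in> carrier G"
  shows "x \<otimes> z \<otimes> (inv z \<otimes> y) = x \<otimes> y"
proof -
  have "z \<otimes> (inv z \<otimes> y) = y"
    using assms m_assoc[of z "inv z" y] by simp
  then show ?thesis using assms by (simp add: m_assoc)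
qed

text \<open>This is the square of a mapping cone: the inverse in the \<open>True\<close> branch
  makes the two mixed terms cancel, and each index contributes s_n t_n. On a list shorter than
  \<open>n\<close> the operator \<open>kos\<close> has the default value \<one>, while
  \<open>kos_sum\<close> need not; the last premise excludes this clash.\<close>

lemma kos_kos:
  assumes s: "\<And>i. s i \<in> hom G G" and t: "\<And>i. t i \<in> hom G G" and u: "\<And>A. u A \<in> carrier G"
    and ss: "\<And>i j x. x \<in> carrier G \<Longrightarrow> s i (s j x) = s j (s i x)"
    and st: "\<And>i j x. x \<in> carrier G \<Longrightarrow> s i (t j x) = t j (s i x)"
    and tt: "\<And>i j x. x \<in> carrier G \<Longrightarrow> t i (t j x) = t j (t i x)"
    and A: "length A = n \<or> (\<forall>i x. s i (t i x) = \<one>)"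
  shows "kos G s t n (kos G s t n u) A = kos_sum G s t n (u A)"
  using u A
proof (induction n arbitrary: u A)
  case (Suc n)
  have k: "kos G s t n w A \<in> carrier G" if "\<And>A. w A \<in> carrier G" for w A
    using s t that by (rule kos_closed)
  note hs = hom_simps[OF s] and ht = hom_simps[OF t]
  have ks: "kos G s t n (\<lambda>A. s n (w A)) B = s n (kos G s t n w B)"
    and kt: "kos G s t n (\<lambda>A. t n (w A)) B = t n (kos G s t n w B)"
    if "\<And>A. w A \<in> carrier G" for w B
    using s t that ss st tt by (auto intro!: kos_natural simp: is_group)
  have uc: "u A \<in> carrier G" for A using Suc.prems by simp
  have cs: "kos_sum G s t n (u A) \<in> carrier G" for A
    by (intro kos_sum_closed s t uc)
  show ?case
  proof (cases A)
    case Nil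
    then show ?thesis using Suc.prems(2) kos_sum_one[of s t "u A" "Suc n"] by simp
  next
    case (Cons a B)
    have IH: "kos G s t n (kos G s t n (\<lambda>B. u (b # B))) B = kos_sum G s t n (u (b # B))" for b
      using Suc.IH[of "\<lambda>B. u (b # B)" B] uc Suc.prems(2) Cons by auto
    let ?F = "\<lambda>B. u (False # B)" and ?T = "\<lambda>B. u (True # B)"
    show ?thesis
    proof (cases a)
      case False
      have "kos G s t (Suc n) (kos G s t (Suc n) u) A =
          kos_sum G s t n (u A) \<otimes> s n (kos G s t n ?T B) \<otimes> (inv (s n (kos G s t n ?T B)) \<otimes> s n (t n (u A)))"
        using Cons False by (simp add: kos_mult s t k uc hs ht ks IH)
      then show ?thesis
        using cs k uc hs ht by (simp add: mult_inv_cancel)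
    next
      case True
      have "kos G s t (Suc n) (kos G s t (Suc n) u) A =
          kos_sum G s t n (u A) \<otimes> inv (t n (kos G s t n ?F B)) \<otimes>
          (inv (inv (t n (kos G s t n ?F B))) \<otimes> s n (t n (u A)))"
        using Cons True by (simp add: kos_mult kos_inv s t k uc hs ht kt IH st inv_mult cs)
      then show ?thesis
        using cs k uc hs ht mult_inv_cancel[of _ _ "inv (t n (kos G s t n ?F B))"] by simp
    qed
  qed
qed simp

text \<open>\<open>k\<close> counts the entries \<open>True\<close> that the recursion has already
  stripped. An entry \<open>True\<close> stands for one factor of degree c, so \<open>s\<close>
  lowers weight and index together and \<open>t\<close> raises both.\<close>

lemma kos_graded:
  assumes D: "\<And>q. subgroup (D q) G" and s: "\<And>i q x. x \<in> D (Suc q) \<Longrightarrow> s i x \<in> D q"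
    and t: "\<And>i q x. x \<in> D q \<Longrightarrow> t i x \<in> D (Suc q)"
    and u: "\<And>A. u A \<in> D (weight A + k)"
  shows "kos G s t n u A \<in> D (weight A + k)"
  using u
proof (induction n arbitrary: u A k)
  case 0
  then show ?case using D by (cases A) (auto intro: subgroup.one_closed)
next
  case (Suc n)
  show ?case
  proof (cases A)
    case Nil
    then show ?thesis using D by (auto intro: subgroup.one_closed)
  next
    case (Cons a B)
    have "kos G s t n (\<lambda>B. u (a # B)) B \<in> D (weight A + k)"
      using Suc.IH[of "\<lambda>B. u (a # B)" "if a then Suc k else k"] Suc.prems[of "a # _"] Cons by auto
    moreover have "s n (u (True # B)) \<in> D (weight B + k)" "t n (u (False # B)) \<in> D (Suc (weight B + k))"
      using Suc.prems[of "True # B"] Suc.prems[of "False # B"] s t by simp_all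
    ultimately show ?thesis
      using Cons D by (cases a) (auto intro: subgroup.m_closed subgroup.m_inv_closed)
  qed
qed

text \<open>\<open>P\<close> and \<open>Q\<close> restrict the weights before and after applying
  \<open>kos\<close>. The disjunctions allow either family of operators to be trivial, so the same
  lemma covers the differential, which lowers the weight, and the homotopy, which raises it.\<close>

lemma kos_support:
  assumes s: "\<And>i. s i \<in> hom G G" and t: "\<And>i. t i \<in> hom G G"
    and u: "\<And>A. \<not> (length A = n \<and> P (weight A + k)) \<Longrightarrow> u A = \<one>"
    and "(\<forall>i x. s i x = \<one>) \<or> (\<forall>w. P (Suc w) \<longrightarrow> Q w)"
    and "(\<forall>i x. t i x = \<one>) \<or> (\<forall>w. P w \<longrightarrow> Q (Suc w))"
    and "\<not> (length A = n \<and> Q (weight A + k))"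
  shows "kos G s t n u A = \<one>"
  using u assms(6)
proof (induction n arbitrary: u A k)
  case 0
  then show ?case by (cases A) auto
next
  case (Suc n)
  show ?case
  proof (cases A)
    case (Cons a B)
    have "kos G s t n (\<lambda>B. u (a # B)) B = \<one>"
      using Suc.IH[of "if a then Suc k else k" "\<lambda>B. u (a # B)" B] Suc.prems(1)[of "a # _"] Suc.prems(2) Cons
      by (cases a) auto
    moreover have "s n (u (True # B)) = \<one>" if "\<not> a"
      using assms(4)
    proof
      assume "\<forall>w. P (Suc w) \<longrightarrow> Q w"
      then have "u (True # B) = \<one>"
        by (intro Suc.prems(1)) (use Suc.prems(2) Cons that in auto)
      then show ?thesis using hom_simps(2)[OF s] by simp
    qed simp
    moreover have "t n (u (False # B)) = \<one>" if a
      using assms(5)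
    proof
      assume "\<forall>w. P w \<longrightarrow> Q (Suc w)"
      then have "u (False # B) = \<one>"
        by (intro Suc.prems(1)) (use Suc.prems(2) Cons that in auto)
      then show ?thesis using hom_simps(2)[OF t] by simp
    qed simp
    ultimately show ?thesis
      using Cons by (cases a) auto
  qed simp
qed

end

text \<open>
  \<open>D p q\<close> is the part of degree \<open>e - q c\<close> of the group \<open>G p\<close> of Cech cochains, \<open>s\<close> is multiplication
  by sections of degree \<open>c\<close>, and the relation \<open>\<Sum>\<^sub>i s\<^sub>i t\<^sub>i = 1\<close> makes the Koszul complex on \<open>s\<close> exact.
\<close>

locale koszul_cech =
  fixes G :: "nat \<Rightarrow> ('a, 'b) monoid_scheme" and D :: "nat \<Rightarrow> nat \<Rightarrow> 'a set"
    and d :: "nat \<Rightarrow> 'a \<Rightarrow> 'a" and s t :: "nat \<Rightarrow> nat \<Rightarrow> 'a \<Rightarrow> 'a" and N m :: nat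
  assumes comm_group: "comm_group (G p)"
    and D: "subgroup (D p q) (G p)"
    and d_hom: "d p \<in> hom (G p) (G (Suc p))"
    and d_D: "x \<in> D p q \<Longrightarrow> d p x \<in> D (Suc p) q"
    and d_d: "x \<in> carrier (G p) \<Longrightarrow> d (Suc p) (d p x) = \<one>\<^bsub>G (Suc (Suc p))\<^esub>"
    and s_hom: "p > 0 \<Longrightarrow> s p i \<in> hom (G p) (G p)"
    and s_D: "p > 0 \<Longrightarrow> x \<in> D p (Suc q) \<Longrightarrow> s p i x \<in> D p q"
    and s_s: "p > 0 \<Longrightarrow> x \<in> carrier (G p) \<Longrightarrow> s p i (s p j x) = s p j (s p i x)"
    and d_s: "p > 0 \<Longrightarrow> x \<in> carrier (G p) \<Longrightarrow> d p (s p i x) = s (Suc p) i (d p x)"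
    and t_hom: "p > 0 \<Longrightarrow> t p i \<in> hom (G p) (G p)"
    and t_D: "p > 0 \<Longrightarrow> x \<in> D p q \<Longrightarrow> t p i x \<in> D p (Suc q)"
    and t_t: "p > 0 \<Longrightarrow> x \<in> carrier (G p) \<Longrightarrow> t p i (t p j x) = t p j (t p i x)"
    and s_t: "p > 0 \<Longrightarrow> x \<in> carrier (G p) \<Longrightarrow> s p i (t p j x) = t p j (s p i x)"
    and sum: "p > 0 \<Longrightarrow> x \<in> carrier (G p) \<Longrightarrow> kos_sum (G p) (s p) (t p) N x = x"
    and top: "p > m \<Longrightarrow> carrier (G p) = {\<one>\<^bsub>G p\<^esub>}"
    and exact: "p > 0 \<Longrightarrow> x \<in> D (Suc p) (Suc p) \<Longrightarrow> d (Suc p) x = \<one>\<^bsub>G (Suc (Suc p))\<^esub>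
      \<Longrightarrow> \<exists>w\<in>D p (Suc p). d p w = x"
    and inject: "x \<in> D 1 1 \<Longrightarrow> d 1 x = \<one>\<^bsub>G (Suc 1)\<^esub> \<Longrightarrow> x = \<one>\<^bsub>G 1\<^esub>"
begin

abbreviation koszul :: "nat \<Rightarrow> (bool list \<Rightarrow> 'a) \<Rightarrow> bool list \<Rightarrow> 'a" where
  "koszul p \<equiv> kos (G p) (s p) (zero_op (G p)) N"

text \<open>
  A diagram chase in the double complex: a Koszul cycle that is also a Cech cocycle is a Koszul
  boundary of a Cech cocycle.  The lift given by the homotopy \<open>t\<close> need not be a cocycle; its Cech differential is
  corrected by the statement one Cech degree higher and by the vanishing of local cohomology.
\<close>

lemma lift_cocycle:
  assumes "\<And>A. u A \<in> D (Suc r) (weight A)"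
    and "\<And>A. \<not> (length A = N \<and> weight A = r) \<Longrightarrow> u A = \<one>\<^bsub>G (Suc r)\<^esub>"
    and "\<And>A. koszul (Suc r) u A = \<one>\<^bsub>G (Suc r)\<^esub>"
    and "\<And>A. d (Suc r) (u A) = \<one>\<^bsub>G (Suc (Suc r))\<^esub>"
  shows "\<exists>v. (\<forall>A. v A \<in> D (Suc r) (weight A)) \<and>
    (\<forall>A. \<not> (length A = N \<and> weight A = Suc r) \<longrightarrow> v A = \<one>\<^bsub>G (Suc r)\<^esub>) \<and>
    (\<forall>A. koszul (Suc r) v A = u A) \<and>
    (\<forall>A. d (Suc r) (v A) = \<one>\<^bsub>G (Suc (Suc r))\<^esub>)"
  using assms
proof (induction "m - r" arbitrary: r u)
  \<comment> \<open>Here \<open>Suc r\<close> exceeds \<open>m\<close>, the top Cech degree, so all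
    cochains are trivial: the induction descends from the top.\<close>
  case 0
  define p where "p = Suc r"
  interpret comm_group "G p" by (rule comm_group)
  have "u A = \<one>\<^bsub>G p\<^esub>" for A
    using 0 top[of p] subgroup.subset[OF D[of p "weight A"]] unfolding p_def by fastforce
  then show ?case
    using 0 by (intro exI[of _ "\<lambda>A. \<one>\<^bsub>G p\<^esub>"]) (auto simp: p_def subgroup.one_closed[OF D])
next
  case (Suc k)
  define p where "p = Suc r"
  have p: "p > 0" by (simp add: p_def)
  interpret Gp: comm_group "G p" by (rule comm_group)
  interpret Gq: comm_group "G (Suc p)" by (rule comm_group)
  interpret d: group_hom "G p" "G (Suc p)" "d p"
    using d_hom by (simp add: group_hom_def group_hom_axioms_def Gp.is_group Gq.is_group)
  note u = Suc.prems[folded p_def]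
  have DG: "x \<in> D p q \<Longrightarrow> x \<in> carrier (G p)" for x p q
    using subgroup.subset[OF D[of p q]] by auto
  have uc: "u A \<in> carrier (G p)" for A using u(1) DG by blast
  note hom = s_hom[OF p] t_hom[OF p] Gp.zero_op_hom
  \<comment> \<open>Write s and t for the two parts of \<open>kos\<close>. From s u = 0, t t = 0 and
    (s + t)(s + t) = 1 it follows that s (t u) = u, so t u is a Koszul lift of
    \<open>u\<close>.\<close>
  define v0 where "v0 = kos (G p) (zero_op (G p)) (t p) N u"
  have v0_D: "v0 A \<in> D p (weight A)" for A
    unfolding v0_def using Gp.kos_graded[of "D p" "zero_op (G p)" "t p" u 0] D t_D[OF p] u(1)
    by (simp add: subgroup.one_closed)
  have v0_supp: "v0 A = \<one>\<^bsub>G p\<^esub>" if "\<not> (length A = N \<and> weight A = Suc r)" for A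
    unfolding v0_def
    by (rule Gp.kos_support[where P = "\<lambda>w. w = r" and Q = "\<lambda>w. w = Suc r" and k = 0])
       (use hom u(2) that in auto)
  have v0c: "v0 A \<in> carrier (G p)" for A using v0_D DG by blast
  have kv0: "koszul p v0 A = u A" for A
  proof (cases "length A = N")
    case True
    have "kos (G p) (s p) (t p) N u = v0"
    proof
      show "kos (G p) (s p) (t p) N u B = v0 B" for B
        using Gp.kos_split[OF hom(1,2) uc, where n = N and A = B] u(3) v0c by (simp add: v0_def)
    qed
    moreover have "kos (G p) (s p) (t p) N (kos (G p) (s p) (t p) N u) A = kos_sum (G p) (s p) (t p) N (u A)"
      by (rule Gp.kos_kos[OF hom(1,2) uc s_s[OF p] s_t[OF p] t_t[OF p]]) (use True in auto)
    ultimately have "kos (G p) (s p) (t p) N v0 A = u A"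
      using sum[OF p uc] by simp
    moreover have "kos (G p) (zero_op (G p)) (t p) N v0 A = \<one>\<^bsub>G p\<^esub>"
      unfolding v0_def
      using Gp.kos_kos[OF hom(3,2) uc _ _ t_t[OF p], where n = N and A = A] Gp.kos_sum_one Gp.hom_simps(2)[OF hom(2)] by simp
    moreover have "koszul p v0 A \<in> carrier (G p)"
      by (intro Gp.kos_closed hom v0c)
    ultimately show ?thesis
      using Gp.kos_split[OF hom(1,2) v0c, where n = N and A = A] by simp
  next
    case False
    then have "koszul p v0 A = \<one>\<^bsub>G p\<^esub>"
      by (intro Gp.kos_support[where P = "\<lambda>w. w = Suc r" and Q = "\<lambda>w. w = r" and k = 0])
         (use hom v0_supp in auto)
    then show ?thesis using u(2) False by simp
  qed
  \<comment> \<open>The failure of \<open>v0\<close> to consist of cocycles. Since \<open>d\<close>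
    commutes with \<open>s\<close>, its Koszul differential is d u = 0; together with d d = 0 this
    makes the induction hypothesis applicable one Cech degree higher.\<close>
  define w1 where "w1 A = d p (v0 A)" for A
  have "koszul (Suc p) (\<lambda>A. d p (v0 A)) A = d p (koszul p v0 A)" for A
    by (rule Gp.kos_natural[OF Gq.is_group d_hom hom(1,3) v0c d_s[OF p] d.hom_one])
  then have w1_kos: "koszul (Suc p) w1 A = \<one>\<^bsub>G (Suc p)\<^esub>" for A
    using kv0 u(4) by (simp add: w1_def[abs_def])
  obtain v1 where v1: "\<And>A. v1 A \<in> D (Suc p) (weight A)"
      "\<And>A. \<not> (length A = N \<and> weight A = Suc p) \<Longrightarrow> v1 A = \<one>\<^bsub>G (Suc p)\<^esub>"
      "\<And>A. koszul (Suc p) v1 A = w1 A"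
      "\<And>A. d (Suc p) (v1 A) = \<one>\<^bsub>G (Suc (Suc p))\<^esub>"
  proof -
    have 1: "k = m - p" using Suc.hyps(2) by (simp add: p_def)
    have 2: "w1 A \<in> D (Suc p) (weight A)" for A unfolding w1_def by (intro d_D v0_D)
    have 3: "w1 A = \<one>\<^bsub>G (Suc p)\<^esub>" if "\<not> (length A = N \<and> weight A = p)" for A
    proof -
      have "v0 A = \<one>\<^bsub>G p\<^esub>" using that by (intro v0_supp) (simp add: p_def)
      then show ?thesis by (simp add: w1_def)
    qed
    have 4: "d (Suc p) (w1 A) = \<one>\<^bsub>G (Suc (Suc p))\<^esub>" for A
      unfolding w1_def by (intro d_d v0c)
    show thesis
      using Suc.hyps(1)[OF 1 2 3 w1_kos 4] that by auto
  qed
  \<comment> \<open>\<open>v1\<close> lives at weight p + 1 in Cech degree p + 1, exactly where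
    \<open>exact\<close> turns a cocycle into a coboundary.\<close>
  have "\<exists>w. w \<in> D p (weight A) \<and> d p w = v1 A \<and>
    (\<not> (length A = N \<and> weight A = Suc p) \<longrightarrow> w = \<one>\<^bsub>G p\<^esub>)" for A
  proof (cases "length A = N \<and> weight A = Suc p")
    case True
    then show ?thesis using exact[OF p, of "v1 A"] v1(1)[of A] v1(4)[of A] by auto
  next
    case False
    then show ?thesis using v1(2)[OF False] by (auto intro!: exI[of _ "\<one>\<^bsub>G p\<^esub>"] subgroup.one_closed[OF D])
  qed
  then obtain w where w: "\<And>A. w A \<in> D p (weight A)" "\<And>A. d p (w A) = v1 A"
    "\<And>A. \<not> (length A = N \<and> weight A = Suc p) \<Longrightarrow> w A = \<one>\<^bsub>G p\<^esub>" by metis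
  have wc: "w A \<in> carrier (G p)" for A using w(1) DG by blast
  let ?k = "koszul p w"
  have kc: "?k A \<in> carrier (G p)" for A by (intro Gp.kos_closed hom wc)
  \<comment> \<open>The correction s w has the weight of \<open>v0\<close>, does not affect the
    Koszul differential because s s = 0, and d (s w) = s v1 = w1 cancels d v0.\<close>
  define v where "v A = v0 A \<otimes>\<^bsub>G p\<^esub> inv\<^bsub>G p\<^esub> ?k A" for A
  have "koszul (Suc p) (\<lambda>A. d p (w A)) A = d p (?k A)" for A
    by (rule Gp.kos_natural[OF Gq.is_group d_hom hom(1,3) wc d_s[OF p] d.hom_one])
  then have dk: "d p (?k A) = w1 A" for A
    using w(2) v1(3) by simp
  have "v A \<in> D p (weight A)" for A
    unfolding v_def using Gp.kos_graded[of "D p" "s p" "zero_op (G p)" w 0 N A] D s_D[OF p] w(1) v0_D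
    by (auto intro!: subgroup.m_closed[OF D] subgroup.m_inv_closed[OF D] subgroup.one_closed[OF D])
  moreover have "v A = \<one>\<^bsub>G p\<^esub>" if "\<not> (length A = N \<and> weight A = Suc r)" for A
  proof -
    have "?k A = \<one>\<^bsub>G p\<^esub>"
      by (rule Gp.kos_support[where P = "\<lambda>w. w = Suc p" and Q = "\<lambda>w. w = p" and k = 0])
         (use hom w(3) that p_def in auto)
    then show ?thesis
      unfolding v_def using v0_supp[OF that] by simp
  qed
  moreover have "koszul p v A = u A" for A
  proof -
    have "koszul p v A = u A \<otimes>\<^bsub>G p\<^esub> inv\<^bsub>G p\<^esub> koszul p ?k A"
      unfolding v_def using kc v0c kv0 by (simp add: Gp.kos_mult Gp.kos_inv hom)
    moreover have "koszul p ?k A = \<one>\<^bsub>G p\<^esub>"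
      using Gp.kos_kos[OF hom(1,3) wc s_s[OF p], where n = N and A = A] Gp.kos_sum_one Gp.hom_simps(2)[OF hom(1)] by simp
    ultimately show ?thesis using uc by simp
  qed
  moreover have "d p (v A) = \<one>\<^bsub>G (Suc p)\<^esub>" for A
    unfolding v_def using v0c kc dk by (simp add: w1_def[symmetric]) (simp add: w1_def v0c)
  ultimately show ?case
    unfolding p_def by blast
qed

text \<open>At weight 0 every element is a Koszul cycle. Placed at the list with entries
  \<open>False\<close> only, x therefore lifts to cocycles of weight 1: it is a combination of
  sections times cocycles of degree e - c, and these vanish by \<open>inject\<close>.\<close>

lemma cocycle_trivial:
  assumes x: "x \<in> D 1 0" "d 1 x = \<one>\<^bsub>G (Suc 1)\<^esub>"
  shows "x = \<one>\<^bsub>G 1\<^esub>"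
proof -
  interpret comm_group "G 1" by (rule comm_group)
  define u where "u A = (if length A = N \<and> weight A = 0 then x else \<one>\<^bsub>G 1\<^esub>)" for A
  have d1: "d 1 \<one>\<^bsub>G 1\<^esub> = \<one>\<^bsub>G (Suc 1)\<^esub>"
    using hom_one[OF d_hom[of 1]] comm_group.axioms(2)[OF comm_group[of "Suc 1"]] is_group by simp
  have kos1: "koszul 1 w A = \<one>\<^bsub>G 1\<^esub>"
    if "\<And>A. \<not> (length A = N \<and> weight A = 0) \<Longrightarrow> w A = \<one>\<^bsub>G 1\<^esub>" for w A
    by (rule kos_support[where P = "\<lambda>w. w = 0" and Q = "\<lambda>_. False" and k = 0])
       (use s_hom[of 1] zero_op_hom that in auto)
  have k: "koszul 1 u A = \<one>\<^bsub>G 1\<^esub>" for A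
    by (rule kos1) (auto simp: u_def)
  obtain v where v: "\<And>A. v A \<in> D 1 (weight A)"
      "\<And>A. \<not> (length A = N \<and> weight A = 1) \<Longrightarrow> v A = \<one>\<^bsub>G 1\<^esub>"
      "\<And>A. koszul 1 v A = u A" "\<And>A. d 1 (v A) = \<one>\<^bsub>G (Suc 1)\<^esub>"
  proof -
    have 1: "u A \<in> D (Suc 0) (weight A)" for A
      using x by (auto simp: u_def subgroup.one_closed[OF D])
    have 2: "u A = \<one>\<^bsub>G (Suc 0)\<^esub>" if "\<not> (length A = N \<and> weight A = 0)" for A
      using that by (auto simp: u_def)
    have 3: "d (Suc 0) (u A) = \<one>\<^bsub>G (Suc (Suc 0))\<^esub>" for A
      using x d1 by (auto simp: u_def)
    show thesis
      using lift_cocycle[OF 1 2 k[unfolded One_nat_def] 3] that unfolding One_nat_def by blast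
  qed
  have "v A = \<one>\<^bsub>G 1\<^esub>" for A
    using inject[of "v A"] v(1)[of A] v(2)[of A] v(4)[of A] by (cases "weight A = 1") auto
  then have "u A = \<one>\<^bsub>G 1\<^esub>" for A
    using v(3)[of A] kos1[of v A] by simp
  from this[of "replicate N False"] show ?thesis
    by (simp add: u_def count_list_0_iff)
qed

end

section \<open>Localisation\<close>

text \<open>
  For \<open>h = f g\<close> this is the map \<open>m / f\<^sup>k \<mapsto> (g\<^sup>k a m) / h\<^sup>k\<^sup>+\<^sup>N\<close>, which covers both the maps between
  localisations and the multiplication by a fraction.
\<close>

definition loc_op ::
    "('s::comm_ring_1, 'm) module \<Rightarrow> 's \<Rightarrow> 's \<Rightarrow> 's \<Rightarrow> nat \<Rightarrow> ('m \<times> nat) set \<Rightarrow> ('m \<times> nat) set" where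
  "loc_op M h g a N x = (\<Union>(m, k)\<in>x. fraction M h ((g ^ k * a) \<odot>\<^bsub>M\<^esub> m) (k + N))"

lemma loc_map_eq_loc_op: "loc_map M h g = loc_op M h g 1 0"
  by (simp add: fun_eq_iff loc_map_def loc_op_def)

text \<open>The localisation is written with the operations of the type class, whereas the module
  axioms speak of the ring record; the equations identify the two.\<close>

locale type_module = module R M
  for R :: "'s::comm_ring_1 ring" and M :: "('s, 'm) module" (structure) +
  assumes mult_R: "monoid.mult R = (*)" and add_R: "ring.add R = (+)"
    and one_R: "one R = 1" and zero_R: "ring.zero R = 0"
begin

lemma ring_simps:
  "1 \<in> carrier R" "0 \<in> carrier R"
  "\<lbrakk>a \<in> carrier R; b \<in> carrier R\<rbrakk> \<Longrightarrow> a * b \<in> carrier R"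
  "\<lbrakk>a \<in> carrier R; b \<in> carrier R\<rbrakk> \<Longrightarrow> a + b \<in> carrier R"
  using R.one_closed R.zero_closed R.m_closed[of a b] R.a_closed[of a b]
  by (auto simp: mult_R add_R one_R zero_R)

lemma power_closed: "a \<in> carrier R \<Longrightarrow> a ^ n \<in> carrier R"
  by (induction n) (auto simp: ring_simps)

lemma smult_smult:
  "\<lbrakk>a \<in> carrier R; b \<in> carrier R; m \<in> carrier M\<rbrakk> \<Longrightarrow> a \<odot> (b \<odot> m) = (a * b) \<odot> m"
  using smult_assoc1[of a b m] by (simp add: mult_R)

lemma smult_1: "m \<in> carrier M \<Longrightarrow> 1 \<odot> m = m"
  using smult_one[of m] by (simp add: one_R)

lemma smult_0: "m \<in> carrier M \<Longrightarrow> 0 \<odot> m = \<zero>"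
  using smult_l_null[of m] by (simp add: zero_R)

lemmas act = ring_simps power_closed smult_smult smult_1 smult_0 smult_r_distr

lemma smult_eqD:
  assumes "a \<odot> m = b \<odot> n" "a \<in> carrier R" "b \<in> carrier R" "c \<in> carrier R"
    "m \<in> carrier M" "n \<in> carrier M"
  shows "(c * a) \<odot> m = (c * b) \<odot> n"
  using assms by (simp flip: smult_smult)

lemma loc_rel_iff:
  "((m, k), (n, l)) \<in> loc_rel M f \<longleftrightarrow> m \<in> carrier M \<and> n \<in> carrier M \<and>
     (\<exists>j. f ^ (j + l) \<odot> m = f ^ (j + k) \<odot> n)"
  by (simp add: loc_rel_def)

lemma equiv_loc_rel:
  assumes f: "f \<in> carrier R"
  shows "equiv (carrier M \<times> UNIV) (loc_rel M f)"
proof (rule equivI)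
  show "loc_rel M f \<subseteq> (carrier M \<times> UNIV) \<times> (carrier M \<times> UNIV)"
    by (auto simp: loc_rel_def)
  show "refl_on (carrier M \<times> UNIV) (loc_rel M f)"
    by (auto simp: refl_on_def loc_rel_def)
  show "sym (loc_rel M f)"
    by (auto simp: sym_def loc_rel_def) metis
  show "trans (loc_rel M f)"
  proof (rule transI, clarify)
    fix m k n l r q
    assume "((m, k), (n, l)) \<in> loc_rel M f" "((n, l), (r, q)) \<in> loc_rel M f"
    then obtain i j where *: "m \<in> carrier M" "n \<in> carrier M" "r \<in> carrier M"
      "f ^ (i + l) \<odot> m = f ^ (i + k) \<odot> n" "f ^ (j + q) \<odot> n = f ^ (j + l) \<odot> r"
      by (auto simp: loc_rel_iff)
    have "f ^ (i + j + l + q) \<odot> m = (f ^ (j + q) * f ^ (i + l)) \<odot> m"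
      by (simp add: algebra_simps flip: power_add)
    also have "\<dots> = (f ^ (j + q) * f ^ (i + k)) \<odot> n"
      using * f by (intro smult_eqD) (auto simp: power_closed)
    also have "\<dots> = (f ^ (i + k) * f ^ (j + q)) \<odot> n"
      by (simp add: mult.commute)
    also have "\<dots> = (f ^ (i + k) * f ^ (j + l)) \<odot> r"
      using * f by (intro smult_eqD) (auto simp: power_closed)
    also have "\<dots> = f ^ (i + j + l + k) \<odot> r"
      by (simp add: algebra_simps flip: power_add)
    finally have "f ^ (i + j + l + q) \<odot> m = f ^ (i + j + l + k) \<odot> r" .
    then show "((m, k), (r, q)) \<in> loc_rel M f"
      using * by (auto simp: loc_rel_iff)
  qed
qed

lemma fraction_eq_iff:
  assumes "f \<in> carrier R" "m \<in> carrier M" "n \<in> carrier M"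
  shows "fraction M f m k = fraction M f n l \<longleftrightarrow> (\<exists>j. f ^ (j + l) \<odot> m = f ^ (j + k) \<odot> n)"
  unfolding fraction_def
  using eq_equiv_class_iff[OF equiv_loc_rel[OF assms(1)], of "(m, k)" "(n, l)"] assms(2,3)
  by (simp add: loc_rel_iff)

lemma in_fractionD:
  assumes "(n, l) \<in> fraction M f m k"
  obtains j where "m \<in> carrier M" "n \<in> carrier M" "f ^ (j + l) \<odot> m = f ^ (j + k) \<odot> n"
  using assms by (auto simp: fraction_def loc_rel_iff)

lemma in_fraction: "m \<in> carrier M \<Longrightarrow> (m, k) \<in> fraction M f m k"
  by (auto simp: fraction_def loc_rel_iff)

lemma fraction_cancel:
  assumes "f \<in> carrier R" "m \<in> carrier M"
  shows "fraction M f (f ^ l \<odot> m) (k + l) = fraction M f m k"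
  using assms
  by (subst fraction_eq_iff) (auto simp: act algebra_simps simp flip: power_add)

lemma carrier_localization:
  "carrier (localization M f) = {fraction M f m k | m k. m \<in> carrier M}"
  by (auto simp: localization_def fraction_def quotient_def)

lemma fraction_closed: "m \<in> carrier M \<Longrightarrow> fraction M f m k \<in> carrier (localization M f)"
  by (auto simp: carrier_localization)

lemma one_localization: "\<one>\<^bsub>localization M f\<^esub> = fraction M f \<zero> 0"
  by (simp add: localization_def)

lemma fraction_eq_one_iff:
  assumes "f \<in> carrier R" "m \<in> carrier M"
  shows "fraction M f m k = \<one>\<^bsub>localization M f\<^esub> \<longleftrightarrow> (\<exists>j. f ^ j \<odot> m = \<zero>)"
  using assms by (simp add: one_localization fraction_eq_iff power_closed)

lemma mult_localization:
  assumes f: "f \<in> carrier R" and m: "m \<in> carrier M" and n: "n \<in> carrier M"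
  shows "fraction M f m k \<otimes>\<^bsub>localization M f\<^esub> fraction M f n l =
    fraction M f (f ^ l \<odot> m \<oplus> f ^ k \<odot> n) (k + l)"
proof -
  have *: "fraction M f (f ^ l' \<odot> m' \<oplus> f ^ k' \<odot> n') (k' + l') = fraction M f (f ^ l \<odot> m \<oplus> f ^ k \<odot> n) (k + l)"
    if m': "(m', k') \<in> fraction M f m k" and n': "(n', l') \<in> fraction M f n l" for m' k' n' l'
  proof -
    obtain j where j: "m' \<in> carrier M" "f ^ (j + k') \<odot> m = f ^ (j + k) \<odot> m'"
      using m' by (rule in_fractionD)
    obtain i where i: "n' \<in> carrier M" "f ^ (i + l') \<odot> n = f ^ (i + l) \<odot> n'"
      using n' by (rule in_fractionD)
    \<comment> \<open>Scaled by these powers, the two relations become the two summands of the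
      cross-multiplied equation of fractions.\<close>
    have "(f ^ (i + l + l') * f ^ (j + k')) \<odot> m = (f ^ (i + l + l') * f ^ (j + k)) \<odot> m'"
      "(f ^ (j + k + k') * f ^ (i + l')) \<odot> n = (f ^ (j + k + k') * f ^ (i + l)) \<odot> n'"
      using i j m n f by (auto intro!: smult_eqD simp: power_closed)
    then have "f ^ (i + j + (k' + l')) \<odot> (f ^ l \<odot> m \<oplus> f ^ k \<odot> n) =
        f ^ (i + j + (k + l)) \<odot> (f ^ l' \<odot> m' \<oplus> f ^ k' \<odot> n')"
      using i j m n f by (simp add: act ac_simps flip: power_add)
    then show ?thesis
      using i j m n f by (subst eq_commute, subst fraction_eq_iff) (auto simp: act)
  qed
  let ?F = "fraction M f (f ^ l \<odot> m \<oplus> f ^ k \<odot> n) (k + l)"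
  have "fraction M f m k \<otimes>\<^bsub>localization M f\<^esub> fraction M f n l =
    {z. \<exists>m' k' n' l'. (m', k') \<in> fraction M f m k \<and> (n', l') \<in> fraction M f n l \<and>
      z \<in> fraction M f (f ^ l' \<odot> m' \<oplus> f ^ k' \<odot> n') (k' + l')}"
    unfolding localization_def by (auto simp: Bex_def split: prod.splits)
  also have "\<dots> = ?F"
    using in_fraction[OF m, of k f] in_fraction[OF n, of l f] * by blast
  finally show ?thesis .
qed

lemma comm_group_localization:
  assumes f: "f \<in> carrier R"
  shows "comm_group (localization M f)"
proof (rule comm_groupI)
  note L = carrier_localization mult_localization[OF f] one_localization
  show "x \<otimes>\<^bsub>localization M f\<^esub> y \<in> carrier (localization M f)"
    if "x \<in> carrier (localization M f)" "y \<in> carrier (localization M f)" for x y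
    using that f by (auto simp: L) (metis a_closed power_closed smult_closed)
  show "\<one>\<^bsub>localization M f\<^esub> \<in> carrier (localization M f)"
    by (auto simp: L)
  show "x \<otimes>\<^bsub>localization M f\<^esub> y \<otimes>\<^bsub>localization M f\<^esub> z =
      x \<otimes>\<^bsub>localization M f\<^esub> (y \<otimes>\<^bsub>localization M f\<^esub> z)"
    if "x \<in> carrier (localization M f)" "y \<in> carrier (localization M f)"
      "z \<in> carrier (localization M f)" for x y z
    using that f by (auto simp: L act a_ac ac_simps simp flip: power_add)
  show "x \<otimes>\<^bsub>localization M f\<^esub> y = y \<otimes>\<^bsub>localization M f\<^esub> x"
    if "x \<in> carrier (localization M f)" "y \<in> carrier (localization M f)" for x y
    using that f by (auto simp: L act a_ac ac_simps)
  show "\<one>\<^bsub>localization M f\<^esub> \<otimes>\<^bsub>localization M f\<^esub> x = x"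
    if "x \<in> carrier (localization M f)" for x
    using that f by (auto simp: L act)
  show "\<exists>y\<in>carrier (localization M f). y \<otimes>\<^bsub>localization M f\<^esub> x = \<one>\<^bsub>localization M f\<^esub>"
    if x: "x \<in> carrier (localization M f)" for x
  proof -
    obtain m k where m: "m \<in> carrier M" "x = fraction M f m k"
      using x by (auto simp: L)
    have "fraction M f (\<ominus> m) k \<otimes>\<^bsub>localization M f\<^esub> x = fraction M f (f ^ k \<odot> (\<ominus> m \<oplus> m)) (k + k)"
      using m f by (simp add: L smult_r_distr power_closed)
    also have "\<dots> = \<one>\<^bsub>localization M f\<^esub>"
      using m f by (simp add: l_neg fraction_eq_one_iff power_closed)
    finally show ?thesis
      using m by (intro bexI[of _ "fraction M f (\<ominus> m) k"]) (auto intro: fraction_closed)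
  qed
qed

lemma inv_fraction:
  assumes f: "f \<in> carrier R" and m: "m \<in> carrier M"
  shows "inv\<^bsub>localization M f\<^esub> (fraction M f m k) = fraction M f (\<ominus> m) k"
proof -
  interpret L: comm_group "localization M f" using f by (rule comm_group_localization)
  have "fraction M f (\<ominus> m) k \<otimes>\<^bsub>localization M f\<^esub> fraction M f m k = fraction M f (f ^ k \<odot> (\<ominus> m \<oplus> m)) (k + k)"
    using m f by (simp add: mult_localization smult_r_distr power_closed)
  also have "\<dots> = \<one>\<^bsub>localization M f\<^esub>"
    using m f by (simp add: l_neg fraction_eq_one_iff power_closed)
  finally show ?thesis
    using m by (intro L.inv_equality) (auto intro: fraction_closed)
qed

lemma loc_op_fraction:
  assumes f: "f \<in> carrier R" "g \<in> carrier R" "a \<in> carrier R" and h: "h = f * g" and m: "m \<in> carrier M"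
  shows "loc_op M h g a N (fraction M f m k) = fraction M h ((g ^ k * a) \<odot> m) (k + N)"
proof -
  have hR: "h \<in> carrier R" using f h by (simp add: ring_simps)
  have "fraction M h ((g ^ l * a) \<odot> n) (l + N) = fraction M h ((g ^ k * a) \<odot> m) (k + N)"
    if n: "(n, l) \<in> fraction M f m k" for n l
  proof -
    obtain j where j: "n \<in> carrier M" "f ^ (j + l) \<odot> m = f ^ (j + k) \<odot> n"
      using n by (rule in_fractionD)
    \<comment> \<open>As h = f g, this is h^(j+l+N) g^k a with f^(j+l) removed. It is symmetric in
      \<open>k\<close> and \<open>l\<close>, so it serves both sides.\<close>
    define c where "c = f ^ N * g ^ (j + l + N + k) * a"
    have "(c * f ^ (j + l)) \<odot> m = (c * f ^ (j + k)) \<odot> n"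
      using j m f by (intro smult_eqD) (auto simp: act c_def)
    moreover have "h ^ (j + (l + N)) * (g ^ k * a) = c * f ^ (j + l)"
      "h ^ (j + (k + N)) * (g ^ l * a) = c * f ^ (j + k)"
      by (simp_all add: c_def h power_mult_distrib power_add ac_simps)
    ultimately show ?thesis
      using j m f hR by (subst eq_commute, subst fraction_eq_iff) (auto simp: act intro!: exI[of _ j])
  qed
  then have "loc_op M h g a N (fraction M f m k) =
    (\<Union>x\<in>fraction M f m k. fraction M h ((g ^ k * a) \<odot> m) (k + N))"
    unfolding loc_op_def by (intro SUP_cong) auto
  then show ?thesis using in_fraction[OF m] by auto
qed

lemma loc_op_hom:
  assumes f: "f \<in> carrier R" "g \<in> carrier R" "a \<in> carrier R" and h: "h = f * g"
  shows "loc_op M h g a N \<in> hom (localization M f) (localization M h)"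
proof (rule homI)
  have hR: "h \<in> carrier R" using f h by (simp add: ring_simps)
  show "loc_op M h g a N x \<in> carrier (localization M h)" if "x \<in> carrier (localization M f)" for x
    using that f hR by (auto simp: carrier_localization loc_op_fraction[OF f h])
      (metis power_closed ring_simps(3) smult_closed)
  fix x y assume "x \<in> carrier (localization M f)" "y \<in> carrier (localization M f)"
  then obtain m k n l where mn: "m \<in> carrier M" "n \<in> carrier M"
    and x: "x = fraction M f m k" and y: "y = fraction M f n l"
    by (auto simp: carrier_localization)
  have "loc_op M h g a N x \<otimes>\<^bsub>localization M h\<^esub> loc_op M h g a N y =
    fraction M h (h ^ N \<odot> ((g ^ (k + l) * a) \<odot> (f ^ l \<odot> m \<oplus> f ^ k \<odot> n))) ((k + l + N) + N)"
    using mn f hR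
    by (simp add: x y loc_op_fraction[OF f h] mult_localization act)
       (simp add: h power_mult_distrib power_add ac_simps)
  also have "\<dots> = fraction M h ((g ^ (k + l) * a) \<odot> (f ^ l \<odot> m \<oplus> f ^ k \<odot> n)) (k + l + N)"
    using mn f hR by (intro fraction_cancel) (auto simp: act)
  also have "\<dots> = loc_op M h g a N (x \<otimes>\<^bsub>localization M f\<^esub> y)"
    using mn f hR by (simp add: x y mult_localization loc_op_fraction[OF f h] power_closed)
  finally show "loc_op M h g a N (x \<otimes>\<^bsub>localization M f\<^esub> y) =
    loc_op M h g a N x \<otimes>\<^bsub>localization M h\<^esub> loc_op M h g a N y" by simp
qed

text \<open>The first map leaves denominators of exponent k + N, so the second multiplies the
  numerator by g'^(k+N); the surplus g'^N joins the multiplier. Functoriality of restriction and the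
  commutation rules for cochains reduce to comparing such multipliers.\<close>

lemma loc_op_loc_op:
  assumes f: "f \<in> carrier R" "g \<in> carrier R" "a \<in> carrier R" and h: "h = f * g"
    and g': "g' \<in> carrier R" "a' \<in> carrier R" "h' = h * g'"
    and x: "x \<in> carrier (localization M f)"
  shows "loc_op M h' g' a' N' (loc_op M h g a N x) = loc_op M h' (g * g') (g' ^ N * a * a') (N + N') x"
proof -
  obtain m k where m: "m \<in> carrier M" and x: "x = fraction M f m k"
    using x by (auto simp: carrier_localization)
  have hR: "h \<in> carrier R" using f h by (simp add: ring_simps)
  have h': "h' = f * (g * g')" using h g' by (simp add: mult.assoc)
  have r: "g * g' \<in> carrier R" "g' ^ N * a * a' \<in> carrier R"
    using f g' by (auto simp: act)
  show ?thesis
    using m f g'(1,2) hR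
    by (simp add: x loc_op_fraction[OF f h] loc_op_fraction[OF hR g']
        loc_op_fraction[OF f(1) r h'] act)
       (simp add: power_mult_distrib power_add ac_simps)
qed

lemma loc_op_id:
  assumes f: "f \<in> carrier R" and x: "x \<in> carrier (localization M f)"
  shows "loc_op M f 1 (f ^ N) N x = x"
proof -
  obtain m k where m: "m \<in> carrier M" and x: "x = fraction M f m k"
    using x by (auto simp: carrier_localization)
  show ?thesis
    using m f loc_op_fraction[of f 1 "f ^ N" f m N k] fraction_cancel[of f m N k] by (simp add: x act)
qed

lemma loc_op_zero:
  assumes f: "f \<in> carrier R" and x: "x \<in> carrier (localization M f)"
  shows "loc_op M f 1 0 N x = \<one>\<^bsub>localization M f\<^esub>"
proof -
  obtain m k where m: "m \<in> carrier M" and x: "x = fraction M f m k"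
    using x by (auto simp: carrier_localization)
  show ?thesis
    using m f loc_op_fraction[of f 1 0 f m N k] by (simp add: x act fraction_eq_one_iff)
qed

end

section \<open>The Cech complex\<close>

lemma omit_Suc_Cons: "omit (Suc k) (x # js) = x # omit k js"
  and omit_0_Cons: "omit 0 (x # js) = js"
  by (simp_all add: omit_def)

text \<open>The alternating sum over the faces of a list, for a function on all lists with values in
  a single group. In this form d d = 0 is a list induction that involves no localisation.\<close>

definition alt_prod :: "('a, 'b) monoid_scheme \<Rightarrow> (nat list \<Rightarrow> 'a) \<Rightarrow> nat list \<Rightarrow> 'a" where
  "alt_prod G a js = finprod G (\<lambda>k. a (omit k js) [^]\<^bsub>G\<^esub> ((- 1) ^ k :: int)) {..<length js}"

context comm_group
begin

lemma alt_prod_closed: "(\<And>I. a I \<in> carrier G) \<Longrightarrow> alt_prod G a js \<in> carrier G"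
  unfolding alt_prod_def by (auto intro!: finprod_closed int_pow_closed)

lemma int_pow_minus_one_Suc:
  "x \<in> carrier G \<Longrightarrow> x [^] ((- 1) ^ Suc k :: int) = inv (x [^] ((- 1) ^ k :: int))"
  by (simp add: int_pow_neg)

lemma finprod_inv:
  assumes "\<And>k. k \<in> A \<Longrightarrow> b k \<in> carrier G"
  shows "finprod G (\<lambda>k. inv (b k)) A = inv (finprod G b A)"
  using assms
proof (induction A rule: infinite_finite_induct)
  case (insert x F)
  then show ?case by (simp add: inv_mult finprod_closed Pi_def)
qed (auto simp: finprod_infinite)

lemma alt_prod_Cons:
  assumes "\<And>I. a I \<in> carrier G"
  shows "alt_prod G a (x # js) = a js \<otimes> inv (alt_prod G (\<lambda>I. a (x # I)) js)"
proof -
  have "alt_prod G a (x # js) =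
      finprod G (\<lambda>k. a (omit k (x # js)) [^] ((- 1) ^ k :: int)) (insert 0 (Suc ` {..<length js}))"
    unfolding alt_prod_def by (simp add: lessThan_Suc_eq_insert_0)
  also have "\<dots> = a js [^] (1::int) \<otimes> finprod G (\<lambda>k. a (omit k (x # js)) [^] ((- 1) ^ k :: int)) (Suc ` {..<length js})"
    using assms by (subst finprod_insert) (auto simp: omit_0_Cons intro!: int_pow_closed)
  also have "finprod G (\<lambda>k. a (omit k (x # js)) [^] ((- 1) ^ k :: int)) (Suc ` {..<length js})
     = finprod G (\<lambda>k. inv (a (x # omit k js) [^] ((- 1) ^ k :: int))) {..<length js}"
    using assms
    by (subst finprod_reindex)
       (auto simp: omit_Suc_Cons int_pow_minus_one_Suc simp del: power_Suc intro!: int_pow_closed)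
  also have "\<dots> = inv (alt_prod G (\<lambda>I. a (x # I)) js)"
    unfolding alt_prod_def using assms by (intro finprod_inv) (auto intro!: int_pow_closed)
  finally show ?thesis using assms by simp
qed

lemma alt_prod_mult_inv:
  assumes "\<And>I. a I \<in> carrier G" "\<And>I. b I \<in> carrier G"
  shows "alt_prod G (\<lambda>I. a I \<otimes> inv (b I)) js = alt_prod G a js \<otimes> inv (alt_prod G b js)"
  using assms
proof (induction js arbitrary: a b)
  case Nil
  then show ?case by (simp add: alt_prod_def)
next
  case (Cons x js)
  then show ?case
    by (simp add: alt_prod_Cons alt_prod_closed inv_mult m_ac)
qed

text \<open>Write d for \<open>alt_prod G\<close>. By \<open>alt_prod_Cons\<close>, (d d a)(x # js)
  is (d a)(js) minus the alternating sum over \<open>js\<close> of a - d (a (x # _)). The last part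
  vanishes by induction, and the other two terms cancel.\<close>

lemma alt_prod_alt_prod:
  assumes "\<And>I. a I \<in> carrier G"
  shows "alt_prod G (alt_prod G a) js = \<one>"
  using assms
proof (induction js arbitrary: a)
  case Nil
  then show ?case by (simp add: alt_prod_def)
next
  case (Cons x js)
  have "alt_prod G (\<lambda>I. alt_prod G a (x # I)) js =
      alt_prod G a js \<otimes> inv (alt_prod G (alt_prod G (\<lambda>I. a (x # I))) js)"
    using Cons.prems by (simp add: alt_prod_Cons alt_prod_mult_inv alt_prod_closed)
  also have "\<dots> = alt_prod G a js"
    using Cons by (simp add: alt_prod_closed)
  finally show ?case
    using Cons.prems by (simp add: alt_prod_Cons alt_prod_closed)
qed

lemma alt_prod_cong:
  assumes "\<And>k. k < length js \<Longrightarrow> a (omit k js) = b (omit k js)" "\<And>I. b I \<in> carrier G"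
  shows "alt_prod G a js = alt_prod G b js"
  unfolding alt_prod_def using assms by (intro finprod_cong') (auto intro!: int_pow_closed)

lemma hom_finprod:
  assumes "comm_group H" "f \<in> hom G H" "\<And>k. k \<in> A \<Longrightarrow> b k \<in> carrier G"
  shows "f (finprod G b A) = finprod H (\<lambda>k. f (b k)) A"
proof -
  interpret H: comm_group H by fact
  have f1: "f \<one> = \<one>\<^bsub>H\<^esub>" using assms(2) hom_one H.is_group is_group by blast
  show ?thesis
    using assms(3)
  proof (induction A rule: infinite_finite_induct)
    case (insert x F)
    have fc: "f y \<in> carrier H" if "y \<in> carrier G" for y
      using assms(2) that by (rule hom_in_carrier)
    have "finprod G b F \<in> carrier G" using insert by (auto intro!: finprod_closed)
    then show ?case
      using insert hom_mult[OF assms(2)] fc by (simp add: Pi_def)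
  qed (auto simp: finprod_infinite f1)
qed

end

lemma comm_group_product_group:
  assumes "\<And>i. i \<in> I \<Longrightarrow> comm_group (G i)"
  shows "comm_group (product_group I G)"
proof -
  have "Group.group (product_group I G)"
    using assms by (simp add: comm_group.axioms(2))
  moreover have "x \<otimes>\<^bsub>product_group I G\<^esub> y = y \<otimes>\<^bsub>product_group I G\<^esub> x"
    if "x \<in> carrier (product_group I G)" "y \<in> carrier (product_group I G)" for x y
    using that assms
    by (auto simp: PiE_iff intro!: restrict_ext comm_monoid.m_comm comm_group.axioms(1))
  ultimately show ?thesis
    by (rule group.group_comm_groupI)
qed

lemma xmon_add: "xmon (s + t) = xmon s * (xmon t :: ('v, 'k::field) cox)"
  by (simp add: mult_single)

lemma xmon_power: "xmon t ^ n = (xmon (((+) t ^^ n) 0) :: ('v, 'k::field) cox)"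
  by (induction n) (simp_all add: mult_single)

context comm_group
begin

lemma mult_left_inv_cancel:
  assumes "c \<in> carrier G" "e \<in> carrier G" "z \<in> carrier G"
  shows "c \<otimes> (e \<otimes> z \<otimes> inv c) = e \<otimes> z"
proof -
  have "c \<otimes> (e \<otimes> z \<otimes> inv c) = (e \<otimes> z) \<otimes> (c \<otimes> inv c)"
    using assms by (subst m_lcomm) auto
  then show ?thesis using assms by simp
qed

lemma alt_prod_in_subgroup:
  assumes "subgroup H G" "\<And>I. a I \<in> H"
  shows "alt_prod G a js \<in> H"
  using assms(2)
proof (induction js arbitrary: a)
  case Nil
  then show ?case using assms(1) by (simp add: alt_prod_def subgroup.one_closed)
next
  case (Cons x js)
  have "a I \<in> carrier G" for I using Cons.prems subgroup.subset[OF assms(1)] by blast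
  then show ?case
    using Cons assms(1) by (simp add: alt_prod_Cons subgroup.m_closed subgroup.m_inv_closed)
qed

lemma alt_prod_mult:
  assumes "\<And>I. a I \<in> carrier G" "\<And>I. b I \<in> carrier G"
  shows "alt_prod G (\<lambda>I. a I \<otimes> b I) js = alt_prod G a js \<otimes> alt_prod G b js"
proof -
  have "alt_prod G (\<lambda>I. \<one>) js = \<one>"
    using alt_prod_mult_inv[of "\<lambda>I. \<one>" "\<lambda>I. \<one>" js] by (simp add: alt_prod_closed)
  then have "alt_prod G (\<lambda>I. inv (b I)) js = inv (alt_prod G b js)"
    using alt_prod_mult_inv[of "\<lambda>I. \<one>" b js] assms by (simp add: alt_prod_closed)
  then show ?thesis
    using alt_prod_mult_inv[of a "\<lambda>I. inv (b I)" js] assms by (simp add: alt_prod_closed)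
qed

lemma hom_alt_prod:
  assumes "comm_group H" "f \<in> hom G H" "\<And>I. a I \<in> carrier G"
  shows "f (alt_prod G a js) = alt_prod H (\<lambda>I. f (a I)) js"
proof -
  interpret f: group_hom G H f
    using assms by (simp add: group_hom_def group_hom_axioms_def is_group comm_group.axioms(2))
  show ?thesis
    unfolding alt_prod_def using assms
    by (subst hom_finprod[OF assms(1,2)]) (auto simp: f.hom_int_pow intro!: int_pow_closed)
qed

end

section \<open>Graded modules over the Cox ring and the graded parts of their localisations\<close>

locale graded_cox =
  fixes X :: "'v::euclidean_space toric" and M :: "(('v, 'k::field) cox, 'm) module" (structure)
    and gr :: "'v pic \<Rightarrow> 'm set"
  assumes graded: "graded_module X M gr" and comm_group_Pic: "comm_group (Pic X)"
    and mdeg_closed: "keys t \<subseteq> rays X \<Longrightarrow> mdeg X t \<in> carrier (Pic X)"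
    and mdeg_add: "\<lbrakk>keys s \<subseteq> rays X; keys t \<subseteq> rays X\<rbrakk>
      \<Longrightarrow> mdeg X (s + t) = mdeg X s \<otimes>\<^bsub>Pic X\<^esub> mdeg X t"

sublocale graded_cox \<subseteq> type_module "cox_ring X" M
  using graded by (auto simp: graded_module_def type_module_def type_module_axioms_def cox_ring_def)

sublocale graded_cox \<subseteq> Pic: comm_group "Pic X"
  by (rule comm_group_Pic)

context graded_cox
begin

abbreviation Pic_carrier ("\<P>") where "\<P> \<equiv> carrier (Pic X)"
abbreviation Pic_mult (infixl "\<cdot>" 70) where "a \<cdot> b \<equiv> a \<otimes>\<^bsub>Pic X\<^esub> b"
abbreviation Pic_one ("\<one>\<^sub>P") where "\<one>\<^sub>P \<equiv> \<one>\<^bsub>Pic X\<^esub>"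
abbreviation Pic_inv ("inv\<^sub>P _" [81] 80) where "inv\<^sub>P a \<equiv> inv\<^bsub>Pic X\<^esub> a"
abbreviation Pic_pow (infixr "\<up>" 75) where "a \<up> (n::nat) \<equiv> a [^]\<^bsub>Pic X\<^esub> n"
abbreviation cox_carrier ("\<S>") where "\<S> \<equiv> (carrier (cox_ring X) :: ('v, 'k) cox set)"

abbreviation on_rays :: "'v exponent \<Rightarrow> bool" where
  "on_rays t \<equiv> keys t \<subseteq> rays X"

lemma on_rays_add: "on_rays s \<Longrightarrow> on_rays t \<Longrightarrow> on_rays (s + t)"
  using Poly_Mapping.keys_add[of s t] by blast

lemma xmon_closed: "on_rays t \<Longrightarrow> xmon t \<in> carrier (cox_ring X)"
  by (simp add: cox_ring_def)

lemma xmon_cox_part: "on_rays t \<Longrightarrow> xmon t \<in> cox_part X (mdeg X t)"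
  by (simp add: cox_part_def xmon_closed)

lemma zero_cox_part: "0 \<in> cox_part X a"
  by (simp add: cox_part_def cox_ring_def)

lemma mdeg_zero: "mdeg X 0 = \<one>\<^sub>P"
proof -
  have "mdeg X 0 = mdeg X 0 \<cdot> mdeg X 0" "mdeg X 0 \<in> \<P>"
    using mdeg_add[of 0 0] mdeg_closed[of 0] by auto
  then show ?thesis by simp
qed

lemma one_cox_part: "1 \<in> cox_part X (\<one>\<^sub>P)"
  by (simp add: cox_part_def cox_ring_def mdeg_zero)

lemma cox_part_closed: "f \<in> cox_part X a \<Longrightarrow> f \<in> \<S>"
  by (simp add: cox_part_def)

lemma cox_part_mult:
  fixes f g :: "('v, 'k) cox"
  assumes "f \<in> cox_part X a" "g \<in> cox_part X b"
  shows "f * g \<in> cox_part X (a \<cdot> b)"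
proof -
  have "mdeg X t = a \<cdot> b" if t: "t \<in> keys (f * g)" for t
  proof -
    obtain r s where "t = r + s" "r \<in> keys f" "s \<in> keys g"
      using t Poly_Mapping.keys_mult[of f g] by auto
    then show ?thesis
      using assms by (auto simp: cox_part_def cox_ring_def mdeg_add)
  qed
  moreover have "f * g \<in> \<S>"
    using assms by (auto simp: ring_simps cox_part_closed)
  ultimately show ?thesis by (simp add: cox_part_def)
qed

lemma cox_part_power:
  fixes f :: "('v, 'k) cox"
  assumes "f \<in> cox_part X a" "a \<in> \<P>"
  shows "f ^ n \<in> cox_part X (a \<up> n)"
proof (induction n)
  case (Suc n)
  then show ?case
    using cox_part_mult[OF Suc assms(1)] by (simp add: mult.commute)
qed (simp add: one_cox_part)

lemma gr_subgroup: "b \<in> \<P> \<Longrightarrow> subgroup (gr b) (add_monoid M)"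
  using graded by (simp add: graded_module_def)

lemma gr_closed: "b \<in> \<P> \<Longrightarrow> m \<in> gr b \<Longrightarrow> m \<in> carrier M"
  using subgroup.subset[OF gr_subgroup, of b] by auto

lemma gr_add: "b \<in> \<P> \<Longrightarrow> m \<in> gr b \<Longrightarrow> n \<in> gr b \<Longrightarrow> m \<oplus> n \<in> gr b"
  using subgroup.m_closed[OF gr_subgroup, of b m n] by simp

lemma gr_zero: "b \<in> \<P> \<Longrightarrow> \<zero> \<in> gr b"
  using subgroup.one_closed[OF gr_subgroup, of b] by simp

lemma gr_uminus: "b \<in> \<P> \<Longrightarrow> m \<in> gr b \<Longrightarrow> \<ominus> m \<in> gr b"
  using subgroup.m_inv_closed[OF gr_subgroup, of b m] by (simp add: a_inv_def)

lemma gr_smult: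
  "\<lbrakk>a \<in> \<P>; b \<in> \<P>; f \<in> cox_part X a; m \<in> gr b\<rbrakk>
    \<Longrightarrow> f \<odot> m \<in> gr (a \<cdot> b)"
  using graded by (simp add: graded_module_def)

definition loc_part :: "'v exponent \<Rightarrow> 'v pic \<Rightarrow> ('m \<times> nat) set set" where
  "loc_part t b = {fraction M (xmon t) m k | m k. m \<in> gr (b \<cdot> mdeg X t \<up> k)}"

lemma carrier_localization_part: "carrier (localization_part X M gr t b) = loc_part t b"
  by (simp add: localization_part_def loc_part_def)

lemma subgroup_loc_part:
  assumes t: "on_rays t" and b: "b \<in> \<P>"
  shows "subgroup (loc_part t b) (localization M (xmon t))"
proof -
  let ?f = "xmon t :: ('v, 'k) cox"
  have f: "?f \<in> \<S>" using t by (rule xmon_closed)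
  interpret L: comm_group "localization M ?f" by (rule comm_group_localization[OF f])
  note T = mdeg_closed[OF t]
  have D: "b \<cdot> mdeg X t \<up> k \<in> \<P>" for k :: nat
    using b T by simp
  have shift: "?f ^ l \<odot> m \<in> gr (b \<cdot> mdeg X t \<up> (k + l))"
    if "m \<in> gr (b \<cdot> mdeg X t \<up> k)" for m and k l :: nat
  proof -
    have "mdeg X t \<up> l \<cdot> (b \<cdot> mdeg X t \<up> k) =
      b \<cdot> mdeg X t \<up> (k + l)"
      using b T by (simp add: Pic.m_ac flip: Pic.nat_pow_mult)
    then show ?thesis
      using gr_smult[OF _ D cox_part_power[OF xmon_cox_part[OF t] T] that, of l] T by simp
  qed
  show ?thesis
  proof (rule L.subgroupI)
    show "loc_part t b \<subseteq> carrier (localization M ?f)"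
      using gr_closed[OF D] by (auto simp: loc_part_def intro!: fraction_closed)
    show "loc_part t b \<noteq> {}"
      using gr_zero[OF D] by (auto simp: loc_part_def)
    show "inv\<^bsub>localization M ?f\<^esub> x \<in> loc_part t b" if "x \<in> loc_part t b" for x
    proof -
      obtain m k where *: "x = fraction M ?f m k" "m \<in> gr (b \<cdot> mdeg X t \<up> k)"
        using \<open>x \<in> loc_part t b\<close> by (auto simp: loc_part_def)
      then have "inv\<^bsub>localization M ?f\<^esub> x = fraction M ?f (\<ominus> m) k"
        using f gr_closed[OF D] by (simp add: inv_fraction)
      then show ?thesis
        using gr_uminus[OF D *(2)] unfolding loc_part_def by blast
    qed
    show "x \<otimes>\<^bsub>localization M ?f\<^esub> y \<in> loc_part t b" if xy: "x \<in> loc_part t b" "y \<in> loc_part t b" for x y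
    proof -
      obtain m k n l where *: "x = fraction M ?f m k" "m \<in> gr (b \<cdot> mdeg X t \<up> k)"
        "y = fraction M ?f n l" "n \<in> gr (b \<cdot> mdeg X t \<up> l)"
        using xy by (auto simp: loc_part_def)
      then have "x \<otimes>\<^bsub>localization M ?f\<^esub> y = fraction M ?f (?f ^ l \<odot> m \<oplus> ?f ^ k \<odot> n) (k + l)"
        using f gr_closed[OF D] by (simp add: mult_localization)
      moreover have "?f ^ l \<odot> m \<oplus> ?f ^ k \<odot> n \<in> gr (b \<cdot> mdeg X t \<up> (k + l))"
        using shift[of m k l] shift[of n l k] * gr_add[OF D] by (simp add: add.commute)
      ultimately show ?thesis unfolding loc_part_def by blast
    qed
  qed
qed

text \<open>The operator multiplies by the fraction a / h^N, where h is the monomial of t + g;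
  \<open>deg\<close> is the resulting change of degree, b' = b + da - N deg h, written without an
  inverse.\<close>

lemma loc_op_loc_part:
  assumes t: "on_rays t" "on_rays g" and a: "a \<in> cox_part X da" "da \<in> \<P>"
    and b: "b \<in> \<P>" "b' \<in> \<P>"
    and deg: "da \<cdot> b = b' \<cdot> mdeg X (t + g) \<up> N"
    and x: "x \<in> loc_part t b"
  shows "loc_op M (xmon (t + g)) (xmon g) a N x \<in> loc_part (t + g) b'"
proof -
  obtain m k where m: "x = fraction M (xmon t) m k" "m \<in> gr (b \<cdot> mdeg X t \<up> k)"
    using x by (auto simp: loc_part_def)
  note T = mdeg_closed[OF t(1)] mdeg_closed[OF t(2)]
  have D: "b \<cdot> mdeg X t \<up> k \<in> \<P>"
    using b T by simp
  have "loc_op M (xmon (t + g)) (xmon g) a N x = fraction M (xmon (t + g)) ((xmon g ^ k * a) \<odot> m) (k + N)"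
    unfolding m(1)
    using loc_op_fraction[OF xmon_closed[OF t(1)] xmon_closed[OF t(2)] cox_part_closed[OF a(1)] xmon_add]
      gr_closed[OF D m(2)] by simp
  moreover have "(xmon g ^ k * a) \<odot> m \<in> gr (b' \<cdot> mdeg X (t + g) \<up> (k + N))"
  proof -
    have "(xmon g ^ k * a) \<odot> m \<in>
        gr ((mdeg X g \<up> k \<cdot> da) \<cdot> (b \<cdot> mdeg X t \<up> k))"
      using T a by (intro gr_smult D m(2) cox_part_mult cox_part_power xmon_cox_part t) auto
    also have "(mdeg X g \<up> k \<cdot> da) \<cdot> (b \<cdot> mdeg X t \<up> k) =
        (da \<cdot> b) \<cdot> (mdeg X t \<cdot> mdeg X g) \<up> k"
      using a b T by (simp add: Pic.nat_pow_distrib Pic.m_ac)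
    also have "\<dots> = b' \<cdot> mdeg X (t + g) \<up> (k + N)"
      unfolding deg using a b T t by (simp add: mdeg_add Pic.m_ac flip: Pic.nat_pow_mult)
    finally show ?thesis .
  qed
  ultimately show ?thesis unfolding loc_part_def by blast
qed

end

lemma length_omit: "k < length js \<Longrightarrow> length (omit k js) = length js - 1"
  by (simp add: omit_def)

lemma omit_cech_index:
  assumes "js \<in> cech_index n (Suc p)" "k \<le> p"
  shows "omit k js \<in> cech_index n p"
proof -
  have js: "length js = Suc p" "sorted_wrt (<) js" "set js \<subseteq> {..<n}"
    using assms by (auto simp: cech_index_def)
  have "sorted_wrt (<) (take k js @ drop k js)"
    using js by simp
  then have "sorted_wrt (<) (take k js @ drop (Suc k) js)"
    using js assms(2)
    by (subst (asm) Cons_nth_drop_Suc[symmetric]) (auto simp: sorted_wrt_append)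
  moreover have "set (take k js @ drop (Suc k) js) \<subseteq> set js"
    using set_take_subset[of k js] set_drop_subset[of "Suc k" js] by auto
  ultimately show ?thesis
    using js assms(2) by (auto simp: cech_index_def omit_def)
qed

lemma cech_exponent_omit:
  assumes "k < length js"
  shows "cech_exponent ts js = cech_exponent ts (omit k js) + ts ! (js ! k)"
proof -
  have "cech_exponent ts js = cech_exponent ts (take k js @ js ! k # drop (Suc k) js)"
    using assms by (simp add: id_take_nth_drop[symmetric])
  then show ?thesis
    by (simp add: cech_exponent_def omit_def ac_simps)
qed

lemma cech_index_empty:
  assumes "p > n"
  shows "cech_index n p = {}"
proof -
  have False if "js \<in> cech_index n p" for js
  proof -
    have "distinct js" "set js \<subseteq> {..<n}" "length js = p"
      using that by (auto simp: cech_index_def strict_sorted_iff)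
    then have "p \<le> n"
      using card_mono[of "{..<n}" "set js"] by (simp add: distinct_card)
    then show False using assms by simp
  qed
  then show ?thesis by blast
qed

section \<open>The Cech complex of a list of monomials\<close>

locale cech = graded_cox X M gr
  for X :: "'v::euclidean_space toric" and M :: "(('v, 'k::field) cox, 'm) module" (structure)
    and gr :: "'v pic \<Rightarrow> 'm set" +
  fixes ts :: "'v exponent list"
  assumes ts: "t \<in> set ts \<Longrightarrow> keys t \<subseteq> rays X"
begin

abbreviation index :: "nat \<Rightarrow> nat list set" where
  "index \<equiv> cech_index (length ts)"

abbreviation expo :: "nat list \<Rightarrow> 'v exponent" where
  "expo \<equiv> cech_exponent ts"

abbreviation L :: "nat list \<Rightarrow> ('m \<times> nat) set monoid" where
  "L js \<equiv> localization M (xmon (expo js))"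

abbreviation cech_differential ("\<delta>") where "\<delta> \<equiv> cech_diff M ts"

text \<open>Cochains of all degrees at once, including inhomogeneous ones: the Koszul operators
  change the degree, so they need one ambient group, in which the graded parts are
  subgroups.\<close>

definition cochains :: "nat \<Rightarrow> (nat list \<Rightarrow> ('m \<times> nat) set) monoid" where
  "cochains p = product_group (index p) L"

definition cochains_of :: "'v pic \<Rightarrow> nat \<Rightarrow> (nat list \<Rightarrow> ('m \<times> nat) set) set" where
  "cochains_of b p = (\<Pi>\<^sub>E js\<in>index p. loc_part (expo js) b)"

lemma on_rays_expo: "js \<in> index p \<Longrightarrow> on_rays (expo js)"
proof -
  have "on_rays (sum_list (map (\<lambda>j. ts ! j) js))" if "set js \<subseteq> {..<length ts}"
    using that
  proof (induction js)
    case (Cons j js)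
    then show ?case using on_rays_add[of "ts ! j"] ts by auto
  qed simp
  then show "js \<in> index p \<Longrightarrow> on_rays (expo js)"
    by (auto simp: cech_index_def cech_exponent_def)
qed

lemma xmon_expo: "js \<in> index p \<Longrightarrow> xmon (expo js) \<in> \<S>"
  using on_rays_expo xmon_closed by blast

lemma comm_group_L: "js \<in> index p \<Longrightarrow> comm_group (L js)"
  using xmon_expo by (rule comm_group_localization)

lemma comm_group_cochains: "comm_group (cochains p)"
  unfolding cochains_def using comm_group_L by (intro comm_group_product_group)

lemma cochains_simps:
  "carrier (cochains p) = (\<Pi>\<^sub>E js\<in>index p. carrier (L js))"
  "\<one>\<^bsub>cochains p\<^esub> = (\<lambda>js\<in>index p. \<one>\<^bsub>L js\<^esub>)"
  "x \<otimes>\<^bsub>cochains p\<^esub> y = (\<lambda>js\<in>index p. x js \<otimes>\<^bsub>L js\<^esub> y js)"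
  by (simp_all add: cochains_def)

lemma cech_cochains_simps:
  "carrier (cech_cochains X M gr ts p b) = cochains_of b p"
  "\<one>\<^bsub>cech_cochains X M gr ts p b\<^esub> = \<one>\<^bsub>cochains p\<^esub>"
  "x \<otimes>\<^bsub>cech_cochains X M gr ts p b\<^esub> y = x \<otimes>\<^bsub>cochains p\<^esub> y"
  by (auto simp: cech_cochains_def cochains_of_def cochains_simps carrier_localization_part
      localization_part_def simp del: carrier_product_group)
     (auto simp: carrier_localization_part[unfolded localization_part_def])

lemma subgroup_cochains_of:
  assumes "b \<in> \<P>"
  shows "subgroup (cochains_of b p) (cochains p)"
  unfolding cochains_of_def cochains_def
  using assms subgroup_loc_part comm_group_L on_rays_expo
  by (subst PiE_subgroup_product_group) (auto simp: comm_group.axioms(2))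

text \<open>
  The image of \<open>\<alpha> I\<close> in \<open>L js\<close>.  The value \<open>1\<close> at the lists \<open>I\<close> that are not faces of \<open>js\<close> makes the
  function total, as the alternating products require.
\<close>

definition res :: "nat \<Rightarrow> nat list \<Rightarrow> (nat list \<Rightarrow> ('m \<times> nat) set) \<Rightarrow> nat list \<Rightarrow> ('m \<times> nat) set" where
  "res p js \<alpha> I = (if I \<in> index p \<and> expo js = expo I + (expo js - expo I)
     then loc_op M (xmon (expo js)) (xmon (expo js - expo I)) 1 0 (\<alpha> I) else \<one>\<^bsub>L js\<^esub>)"

lemma on_rays_diff: "on_rays t \<Longrightarrow> on_rays (t - s)"
  using Poly_Mapping.keys_diff[of t s] by (auto simp: in_keys_iff lookup_minus)

text \<open>Subtraction of exponents is truncated, so the last premise says that the monomial of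
  \<open>I\<close> divides that of \<open>js\<close>.\<close>

lemma res_hom:
  assumes "js \<in> index q" "I \<in> index p" "expo js = expo I + (expo js - expo I)"
  shows "loc_op M (xmon (expo js)) (xmon (expo js - expo I)) 1 0 \<in> hom (L I) (L js)"
proof (rule loc_op_hom)
  have "(xmon (expo js) :: ('v, 'k) cox) = xmon (expo I + (expo js - expo I))"
    using assms(3) by simp
  then show "(xmon (expo js) :: ('v, 'k) cox) = xmon (expo I) * xmon (expo js - expo I)"
    by (simp only: xmon_add)
qed (use assms(1,2) in \<open>auto intro!: xmon_expo xmon_closed on_rays_diff on_rays_expo simp: ring_simps\<close>)

lemma res_closed:
  assumes "\<alpha> \<in> carrier (cochains p)" "js \<in> index q"
  shows "res p js \<alpha> I \<in> carrier (L js)"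
proof -
  interpret L: comm_group "L js" using assms(2) by (rule comm_group_L)
  show ?thesis
    using assms res_hom[OF assms(2)] hom_in_carrier[of _ "L I" "L js"]
    by (auto simp: res_def cochains_simps PiE_iff)
qed

lemma res_mult:
  assumes "\<alpha> \<in> carrier (cochains p)" "\<beta> \<in> carrier (cochains p)" "js \<in> index q"
  shows "res p js (\<alpha> \<otimes>\<^bsub>cochains p\<^esub> \<beta>) I = res p js \<alpha> I \<otimes>\<^bsub>L js\<^esub> res p js \<beta> I"
proof -
  interpret L: comm_group "L js" using assms(3) by (rule comm_group_L)
  show ?thesis
    using assms hom_mult[OF res_hom[OF assms(3)]] by (auto simp: res_def cochains_simps PiE_iff)
qed

text \<open>Restricting all faces first turns the differential into an alternating product inside
  the single group \<open>L js\<close>, where the results on \<open>alt_prod\<close> apply.\<close>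

lemma cech_diff_eq:
  assumes "\<alpha> \<in> carrier (cochains p)" "js \<in> index (Suc p)"
  shows "\<delta> p \<alpha> js = alt_prod (L js) (res p js \<alpha>) js"
proof -
  interpret L: comm_group "L js" using assms(2) by (rule comm_group_L)
  have len: "length js = Suc p" using assms(2) by (simp add: cech_index_def)
  have "res p js \<alpha> (omit k js) = loc_map M (xmon (expo js)) (xmon (ts ! (js ! k))) (\<alpha> (omit k js))"
    if "k \<le> p" for k
    using that len omit_cech_index[OF assms(2) that] cech_exponent_omit[of k js ts]
    by (simp add: res_def loc_map_eq_loc_op)
  then have eq: "loc_map M (xmon (expo js)) (xmon (ts ! (js ! k))) (\<alpha> (omit k js)) = res p js \<alpha> (omit k js)"
    if "k \<le> p" for k
    using that by simp
  have "\<delta> p \<alpha> js = finprod (L js) (\<lambda>k. loc_map M (xmon (expo js)) (xmon (ts ! (js ! k)))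
      (\<alpha> (omit k js)) [^]\<^bsub>L js\<^esub> ((- 1) ^ k :: int)) {..p}"
    using assms(2) by (simp add: cech_diff_def)
  also have "\<dots> = finprod (L js) (\<lambda>k. res p js \<alpha> (omit k js) [^]\<^bsub>L js\<^esub> ((- 1) ^ k :: int)) {..p}"
    using res_closed[OF assms] by (intro L.finprod_cong') (auto simp: eq intro!: L.int_pow_closed)
  finally show ?thesis
    by (simp add: alt_prod_def len lessThan_Suc_atMost)
qed

lemma cech_diff_hom: "\<delta> p \<in> hom (cochains p) (cochains (Suc p))"
proof (rule homI)
  interpret G: comm_group "cochains p" by (rule comm_group_cochains)
  have ext: "\<delta> p \<alpha> js = undefined" if "js \<notin> index (Suc p)" for \<alpha> js
    using that by (simp add: cech_diff_def)
  show "\<delta> p \<alpha> \<in> carrier (cochains (Suc p))" if "\<alpha> \<in> carrier (cochains p)" for \<alpha>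
    unfolding cochains_simps(1)
  proof (rule PiE_I)
    show "\<delta> p \<alpha> js \<in> carrier (L js)" if "js \<in> index (Suc p)" for js
      using \<open>\<alpha> \<in> carrier (cochains p)\<close> that res_closed comm_group.alt_prod_closed[OF comm_group_L]
      by (simp add: cech_diff_eq)
  qed (rule ext)
  show "\<delta> p (\<alpha> \<otimes>\<^bsub>cochains p\<^esub> \<beta>) =
      \<delta> p \<alpha> \<otimes>\<^bsub>cochains (Suc p)\<^esub> \<delta> p \<beta>"
    if ab: "\<alpha> \<in> carrier (cochains p)" "\<beta> \<in> carrier (cochains p)" for \<alpha> \<beta>
  proof
    fix js
    show "\<delta> p (\<alpha> \<otimes>\<^bsub>cochains p\<^esub> \<beta>) js =
      (\<delta> p \<alpha> \<otimes>\<^bsub>cochains (Suc p)\<^esub> \<delta> p \<beta>) js"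
    proof (cases "js \<in> index (Suc p)")
      case True
      interpret L: comm_group "L js" using True by (rule comm_group_L)
      have "res p js (\<alpha> \<otimes>\<^bsub>cochains p\<^esub> \<beta>) = (\<lambda>I. res p js \<alpha> I \<otimes>\<^bsub>L js\<^esub> res p js \<beta> I)"
        using res_mult[OF ab True] by auto
      then show ?thesis
        using True ab res_closed
        by (simp add: cech_diff_eq L.alt_prod_mult cochains_simps(3)[of "Suc p"])
    qed (simp add: ext cochains_simps(3)[of "Suc p"])
  qed
qed

text \<open>Restriction maps are homomorphisms and compose, so a face of the inner differential
  becomes an alternating product of restrictions directly to \<open>js\<close>. Both differentials
  then take place in \<open>L js\<close>, and \<open>alt_prod_alt_prod\<close> applies.\<close>

lemma cech_diff_cech_diff:
  assumes a: "\<alpha> \<in> carrier (cochains p)"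
  shows "\<delta> (Suc p) (\<delta> p \<alpha>) = \<one>\<^bsub>cochains (Suc (Suc p))\<^esub>"
proof
  fix js
  have da: "\<delta> p \<alpha> \<in> carrier (cochains (Suc p))"
    using hom_in_carrier[OF cech_diff_hom a] .
  show "\<delta> (Suc p) (\<delta> p \<alpha>) js = \<one>\<^bsub>cochains (Suc (Suc p))\<^esub> js"
  proof (cases "js \<in> index (Suc (Suc p))")
    case js: True
    interpret L: comm_group "L js" using js by (rule comm_group_L)
    have len: "length js = Suc (Suc p)" using js by (simp add: cech_index_def)
    have 1: "res (Suc p) js (\<delta> p \<alpha>) (omit k js) = alt_prod (L js) (res p js \<alpha>) (omit k js)"
      if k: "k < length js" for k
    proof -
      let ?K = "omit k js"
      have K: "?K \<in> index (Suc p)" using omit_cech_index[OF js, of k] k len by simp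
      have EK: "expo js = expo ?K + (expo js - expo ?K)"
        using cech_exponent_omit[OF k, of ts] by simp
      interpret K: comm_group "L ?K" using K by (rule comm_group_L)
      let ?f = "loc_op M (xmon (expo js)) (xmon (expo js - expo ?K)) 1 0"
      have "res (Suc p) js (\<delta> p \<alpha>) ?K = ?f (alt_prod (L ?K) (res p ?K \<alpha>) ?K)"
        using K EK a by (simp add: res_def[of "Suc p"] cech_diff_eq)
      also have "\<dots> = alt_prod (L js) (\<lambda>I. ?f (res p ?K \<alpha> I)) ?K"
        using res_hom[OF js K EK] res_closed[OF a K] L.comm_group_axioms
        by (intro K.hom_alt_prod) auto
      also have "\<dots> = alt_prod (L js) (res p js \<alpha>) ?K"
      proof (rule L.alt_prod_cong)
        fix l assume l: "l < length ?K"
        let ?I = "omit l ?K"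
        have lp: "l \<le> p" using l k len by (simp add: length_omit)
        have I: "?I \<in> index p" using omit_cech_index[OF K lp] .
        have EI: "expo ?K = expo ?I + (expo ?K - expo ?I)"
          using cech_exponent_omit[OF l, of ts] by simp
        have EJ: "expo js = expo ?I + (expo js - expo ?I)"
          "(expo ?K - expo ?I) + (expo js - expo ?K) = expo js - expo ?I"
          using cech_exponent_omit[OF l, of ts] cech_exponent_omit[OF k, of ts] by (simp_all add: add.assoc)
        have aI: "\<alpha> ?I \<in> carrier (L ?I)" using a I by (auto simp: cochains_simps)
        have xs: "(xmon (expo js) :: ('v, 'k) cox) = xmon (expo ?K) * xmon (expo js - expo ?K)"
            "(xmon (expo ?K) :: ('v, 'k) cox) = xmon (expo ?I) * xmon (expo ?K - expo ?I)"
            "(xmon (expo ?K - expo ?I) * xmon (expo js - expo ?K) :: ('v, 'k) cox) = xmon (expo js - expo ?I)"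
          using EK EI EJ(2) by (simp_all only: xmon_add[symmetric])
        have "?f (res p ?K \<alpha> ?I) = loc_op M (xmon (expo js)) (xmon (expo js - expo ?I)) 1 0 (\<alpha> ?I)"
          using loc_op_loc_op[OF xmon_expo[OF I] _ _ xs(2) _ _ xs(1) aI, of 1 1 0 0] I EI xs(3)
          by (simp add: res_def ring_simps xmon_closed on_rays_diff on_rays_expo[OF js] on_rays_expo[OF K])
        then show "?f (res p ?K \<alpha> ?I) = res p js \<alpha> ?I"
          using I EJ by (simp add: res_def)
      qed (use res_closed[OF a js] in auto)
      finally show ?thesis .
    qed
    have "\<delta> (Suc p) (\<delta> p \<alpha>) js =
        alt_prod (L js) (res (Suc p) js (\<delta> p \<alpha>)) js"
      using da js by (rule cech_diff_eq)
    also have "\<dots> = alt_prod (L js) (alt_prod (L js) (res p js \<alpha>)) js"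
      using 1 res_closed[OF a js] by (intro L.alt_prod_cong L.alt_prod_closed) auto
    also have "\<dots> = \<one>\<^bsub>L js\<^esub>"
      using res_closed[OF a js] by (rule L.alt_prod_alt_prod)
    finally show ?thesis using js by (simp add: cochains_simps)
  qed (simp add: cech_diff_def cochains_simps)
qed

lemma cech_diff_graded:
  assumes a: "\<alpha> \<in> cochains_of b p" and b: "b \<in> \<P>"
  shows "\<delta> p \<alpha> \<in> cochains_of b (Suc p)"
  unfolding cochains_of_def
proof (rule PiE_I)
  fix js assume js: "js \<in> index (Suc p)"
  interpret L: comm_group "L js" using js by (rule comm_group_L)
  have sub: "subgroup (loc_part (expo js) b) (L js)"
    using subgroup_loc_part[OF on_rays_expo[OF js] b] .
  have ac: "\<alpha> \<in> carrier (cochains p)"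
    using a subgroup.subset[OF subgroup_cochains_of[OF b]] by blast
  have "res p js \<alpha> I \<in> loc_part (expo js) b" for I
  proof (cases "I \<in> index p \<and> expo js = expo I + (expo js - expo I)")
    case True
    have "mdeg X (expo js) \<in> \<P>"
      using mdeg_closed on_rays_expo[OF js] by blast
    then have "loc_op M (xmon (expo I + (expo js - expo I))) (xmon (expo js - expo I)) 1 0 (\<alpha> I)
        \<in> loc_part (expo I + (expo js - expo I)) b"
      using True a b js on_rays_expo one_cox_part
      by (intro loc_op_loc_part[where b = b and da = "\<one>\<^sub>P"])
         (auto simp: cochains_of_def on_rays_diff)
    then show ?thesis
      using True by (simp add: res_def)
  next
    case False
    then show ?thesis using sub by (auto simp: res_def subgroup.one_closed)
  qed
  then show "\<delta> p \<alpha> js \<in> loc_part (expo js) b"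
    using ac js sub by (simp add: cech_diff_eq L.alt_prod_in_subgroup)
qed (simp add: cech_diff_def)

text \<open>Multiplication by a fraction with numerator \<open>a js\<close> and denominator the
  \<open>N js\<close>-th power of the monomial inverted at \<open>js\<close>. Multiplication by a
  section has a constant numerator and denominator 1; the inverse of a section depends on the chart,
  which is why \<open>a\<close> and \<open>N\<close> do.\<close>

definition cop :: "nat \<Rightarrow> (nat list \<Rightarrow> ('v, 'k) cox) \<Rightarrow> (nat list \<Rightarrow> nat) \<Rightarrow>
    (nat list \<Rightarrow> ('m \<times> nat) set) \<Rightarrow> (nat list \<Rightarrow> ('m \<times> nat) set)" where
  "cop p a N \<alpha> = (\<lambda>js\<in>index p. loc_op M (xmon (expo js)) 1 (a js) (N js) (\<alpha> js))"

lemma loc_op_endo: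
  assumes "js \<in> index p" "c \<in> \<S>"
  shows "loc_op M (xmon (expo js)) 1 c n \<in> hom (L js) (L js)"
  using assms by (intro loc_op_hom) (auto simp: xmon_expo ring_simps)

lemma cop_hom:
  assumes "\<And>js. js \<in> index p \<Longrightarrow> a js \<in> \<S>"
  shows "cop p a N \<in> hom (cochains p) (cochains p)"
proof (rule homI)
  note h = loc_op_endo[OF _ assms]
  show "cop p a N \<alpha> \<in> carrier (cochains p)" if "\<alpha> \<in> carrier (cochains p)" for \<alpha>
    using that hom_in_carrier[OF h] by (auto simp: cochains_simps cop_def PiE_iff)
  show "cop p a N (\<alpha> \<otimes>\<^bsub>cochains p\<^esub> \<beta>) = cop p a N \<alpha> \<otimes>\<^bsub>cochains p\<^esub> cop p a N \<beta>"
    if "\<alpha> \<in> carrier (cochains p)" "\<beta> \<in> carrier (cochains p)" for \<alpha> \<beta>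
    using that hom_mult[OF h] by (auto simp: cochains_simps cop_def PiE_iff intro!: restrict_ext)
qed

lemma cop_cop:
  assumes "\<And>js. js \<in> index p \<Longrightarrow> a js \<in> \<S>"
    "\<And>js. js \<in> index p \<Longrightarrow> c js \<in> \<S>" "\<alpha> \<in> carrier (cochains p)"
  shows "cop p a N (cop p c K \<alpha>) = cop p (\<lambda>js. a js * c js) (\<lambda>js. N js + K js) \<alpha>"
proof -
  have "loc_op M (xmon (expo js)) 1 (a js) (N js) (loc_op M (xmon (expo js)) 1 (c js) (K js) (\<alpha> js)) =
    loc_op M (xmon (expo js)) 1 (a js * c js) (N js + K js) (\<alpha> js)" if js: "js \<in> index p" for js
    using loc_op_loc_op[of "xmon (expo js)" 1 "c js" "xmon (expo js)" 1 "a js" "xmon (expo js)" "\<alpha> js" "N js" "K js"]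
      assms(1,2)[OF js] xmon_expo[OF js] assms(3) js
    by (auto simp: ring_simps cochains_simps ac_simps)
  then show ?thesis
    by (auto simp: cop_def intro!: restrict_ext)
qed

lemma cop_graded:
  assumes b: "b \<in> \<P>" "b' \<in> \<P>" and \<alpha>: "\<alpha> \<in> cochains_of b p"
    and a: "\<And>js. js \<in> index p \<Longrightarrow> \<exists>d\<in>\<P>. a js \<in> cox_part X d \<and>
      d \<cdot> b = b' \<cdot> mdeg X (expo js) \<up> N js"
  shows "cop p a N \<alpha> \<in> cochains_of b' p"
  unfolding cochains_of_def
proof (rule PiE_I)
  fix js assume js: "js \<in> index p"
  obtain d where d: "d \<in> \<P>" "a js \<in> cox_part X d"
      "d \<cdot> b = b' \<cdot> mdeg X (expo js) \<up> N js"
    using a[OF js] by blast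
  have "loc_op M (xmon (expo js + 0)) (xmon 0) (a js) (N js) (\<alpha> js) \<in> loc_part (expo js + 0) b'"
    using \<alpha> js d b on_rays_expo[OF js]
    by (intro loc_op_loc_part[where b = b and da = d]) (auto simp: cochains_of_def)
  then show "cop p a N \<alpha> js \<in> loc_part (expo js) b'"
    using js by (simp add: cop_def)
qed (simp add: cop_def)

text \<open>The multiplier is the same global element on every chart, so it commutes with
  restriction. The chart-dependent inverses in the homotopy have no such rule.\<close>

lemma cech_diff_cop:
  assumes c: "c \<in> \<S>" and \<alpha>: "\<alpha> \<in> carrier (cochains p)"
  shows "\<delta> p (cop p (\<lambda>_. c) (\<lambda>_. 0) \<alpha>) = cop (Suc p) (\<lambda>_. c) (\<lambda>_. 0) (\<delta> p \<alpha>)"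
proof
  fix js
  have co: "cop p (\<lambda>_. c) (\<lambda>_. 0) \<alpha> \<in> carrier (cochains p)"
    using c by (intro hom_in_carrier[OF cop_hom \<alpha>])
  show "\<delta> p (cop p (\<lambda>_. c) (\<lambda>_. 0) \<alpha>) js = cop (Suc p) (\<lambda>_. c) (\<lambda>_. 0) (\<delta> p \<alpha>) js"
  proof (cases "js \<in> index (Suc p)")
    case js: True
    interpret L: comm_group "L js" using js by (rule comm_group_L)
    have eq: "res p js (cop p (\<lambda>_. c) (\<lambda>_. 0) \<alpha>) I = loc_op M (xmon (expo js)) 1 c 0 (res p js \<alpha> I)" for I
    proof (cases "I \<in> index p \<and> expo js = expo I + (expo js - expo I)")
      case True
      then have I: "I \<in> index p" and EI: "expo js = expo I + (expo js - expo I)" by auto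
      have x: "(xmon (expo js) :: ('v, 'k) cox) = xmon (expo I) * xmon (expo js - expo I)"
        using EI by (simp only: xmon_add[symmetric])
      have r: "xmon (expo js - expo I) \<in> \<S>"
        using xmon_closed[OF on_rays_diff[OF on_rays_expo[OF js]]] .
      have aI: "\<alpha> I \<in> carrier (L I)" using \<alpha> I by (auto simp: cochains_simps)
      show ?thesis
        using loc_op_loc_op[OF xmon_expo[OF I] _ c _ r _ x aI, of 1 1 0 0]
          loc_op_loc_op[OF xmon_expo[OF I] r _ x _ c _ aI, of 1 1 "xmon (expo js)" 0 0] True
        by (simp add: res_def cop_def ring_simps)
    next
      case False
      then show ?thesis
        using hom_one[OF loc_op_endo[OF js c] L.is_group L.is_group] by (auto simp: res_def)
    qed
    have "\<delta> p (cop p (\<lambda>_. c) (\<lambda>_. 0) \<alpha>) js =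
        alt_prod (L js) (\<lambda>I. loc_op M (xmon (expo js)) 1 c 0 (res p js \<alpha> I)) js"
      unfolding cech_diff_eq[OF co js] by (intro arg_cong[where f = "\<lambda>a. alt_prod (L js) a js"] ext eq)
    also have "\<dots> = loc_op M (xmon (expo js)) 1 c 0 (alt_prod (L js) (res p js \<alpha>) js)"
      using L.hom_alt_prod[OF L.comm_group_axioms loc_op_endo[OF js c]] res_closed[OF \<alpha> js] by simp
    finally show ?thesis
      using \<alpha> js by (simp add: cop_def cech_diff_eq)
  qed (simp add: cech_diff_def cop_def)
qed

text \<open>The total degree of \<open>s\<close> bounds each of its exponents, and each variable of
  \<open>s\<close> occurs in \<open>t\<close>, so x^s divides the power of x^t with that exponent.
  After inverting x^t, the monomial x^s thus has the inverse x^r / (x^t)^n.\<close>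

lemma monomial_inverse:
  fixes s t :: "'v exponent"
  assumes "keys s \<subseteq> keys t"
  obtains r n where "keys r \<subseteq> keys t" "s + r = ((+) t ^^ n) 0"
proof -
  define n where "n = (\<Sum>x\<in>keys s. lookup s x)"
  define T where "T = ((+) t ^^ n) 0"
  have "lookup (((+) t ^^ k) 0) x = k * lookup t x" for x k
    by (induction k) (simp_all add: lookup_add)
  then have T: "lookup T x = n * lookup t x" for x
    by (simp add: T_def)
  have le: "lookup s x \<le> lookup T x" for x
  proof (cases "x \<in> keys s")
    case True
    then have "lookup t x \<ge> 1"
      using assms by (metis One_nat_def Suc_leI gr0I in_keys_iff subsetD)
    moreover have "lookup s x \<le> n"
      unfolding n_def using True by (intro member_le_sum) auto
    ultimately show ?thesis
      unfolding T by (metis One_nat_def Suc_le_eq mult.right_neutral mult_le_mono)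
  qed (simp add: in_keys_iff)
  have "s + (T - s) = T"
    using le by (intro poly_mapping_eqI) (simp add: lookup_add lookup_minus)
  moreover have "keys (T - s) \<subseteq> keys t"
    by (auto simp: in_keys_iff lookup_minus T) (metis gr0I le0 mult_0_right)
  ultimately show ?thesis using that T_def by blast
qed

text \<open>One step from degree e - c to degree e for a class c generated by the monomial sections
  \<open>\<tau> i\<close>: \<open>free\<close> says that on each chart some section is invertible.
  \<open>exact\<close> is the consequence of H^(p+1)_B vanishing in degree e - (p+1) c.\<close>

lemma koszul_step:
  fixes \<tau> :: "nat \<Rightarrow> 'v exponent" and K :: nat
  assumes e: "e \<in> \<P>" and c: "c \<in> \<P>"
    and \<tau>: "\<And>i. on_rays (\<tau> i)" "\<And>i. mdeg X (\<tau> i) = c"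
    and free: "\<And>t. t \<in> set ts \<Longrightarrow> \<exists>i<K. keys (\<tau> i) \<subseteq> keys t"
    and exact: "\<And>p x. p > 0 \<Longrightarrow> x \<in> cochains_of (e \<cdot> inv\<^sub>P c \<up> Suc p) (Suc p) \<Longrightarrow>
      \<delta> (Suc p) x = \<one>\<^bsub>cochains (Suc (Suc p))\<^esub> \<Longrightarrow>
      \<exists>w\<in>cochains_of (e \<cdot> inv\<^sub>P c \<up> Suc p) p. \<delta> p w = x"
    and inject: "\<And>x. x \<in> cochains_of (e \<cdot> inv\<^sub>P c) 1 \<Longrightarrow>
      \<delta> 1 x = \<one>\<^bsub>cochains 2\<^esub> \<Longrightarrow> x = \<one>\<^bsub>cochains 1\<^esub>"
    and x: "x \<in> cochains_of e 1" "\<delta> 1 x = \<one>\<^bsub>cochains 2\<^esub>"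
  shows "x = \<one>\<^bsub>cochains 1\<^esub>"
proof -
  let ?x = "\<lambda>js. xmon (expo js) :: ('v, 'k) cox"
  \<comment> \<open>In positive Cech degree \<open>js\<close> contains some chart, and a section
    invertible there is invertible on the whole intersection. The empty list inverts nothing, hence
    the restriction to p > 0.\<close>
  have "\<exists>i r n. (\<exists>p>0. js \<in> index p) \<longrightarrow> i < K \<and> on_rays r \<and> \<tau> i + r = ((+) (expo js) ^^ n) 0" for js
  proof (cases "\<exists>p>0. js \<in> index p")
    case True
    then obtain p where js: "js \<in> index p" "p > 0" by blast
    obtain j J where J: "js = j # J" "j < length ts"
      using js by (cases js) (auto simp: cech_index_def)
    obtain i where i: "i < K" "keys (\<tau> i) \<subseteq> keys (ts ! j)"
      using free[of "ts ! j"] J(2) by auto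
    have "keys (ts ! j) \<subseteq> keys (expo js)"
      by (auto simp: J cech_exponent_def in_keys_iff lookup_add)
    then obtain r n where "keys r \<subseteq> keys (expo js)" "\<tau> i + r = ((+) (expo js) ^^ n) 0"
      using i(2) monomial_inverse[of "\<tau> i" "expo js"] by blast
    then show ?thesis using i on_rays_expo[OF js(1)] by blast
  qed blast
  then obtain i0 r0 n0 where *: "\<And>js. (\<exists>p>0. js \<in> index p) \<Longrightarrow>
      i0 js < K \<and> on_rays (r0 js) \<and> \<tau> (i0 js) + r0 js = ((+) (expo js) ^^ n0 js) 0"
    by metis
  have i0: "i0 js < K" and r0: "on_rays (r0 js)" and n0: "\<tau> (i0 js) + r0 js = ((+) (expo js) ^^ n0 js) 0"
    if "js \<in> index p" "p > 0" for js p
    using that *[of js] by auto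
  \<comment> \<open>A partition of unity with a single nonzero term on each intersection: the
    section with index \<open>i0 js\<close> is paired with its inverse, every other section with
    0.\<close>
  define a where "a i js = (if i = i0 js then xmon (r0 js) else 0 :: ('v, 'k) cox)" for i js
  define s where "s p i = cop p (\<lambda>_. xmon (\<tau> i)) (\<lambda>_. 0)" for p i
  define t where "t p i = cop p (a i) n0" for p i
  have aR: "a i js \<in> \<S>" if "js \<in> index p" "p > 0" for i js p
    using r0[OF that] by (simp add: a_def xmon_closed ring_simps)
  have \<tau>R: "(xmon (\<tau> i) :: ('v, 'k) cox) \<in> \<S>" for i
    using \<tau> by (simp add: xmon_closed)
  have inv: "xmon (\<tau> (i0 js)) * xmon (r0 js) = ?x js ^ n0 js" if "js \<in> index p" "p > 0" for js p
    using n0[OF that] by (simp add: xmon_power flip: xmon_add)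
  define D where "D p q = cochains_of (e \<cdot> inv\<^sub>P c \<up> q) p" for p q :: nat
  have E: "e \<cdot> inv\<^sub>P c \<up> q \<in> \<P>" for q :: nat
    using e c by simp
  have DG: "y \<in> carrier (cochains p)" if "y \<in> D p q" for y p q
    using that subgroup.subset[OF subgroup_cochains_of[OF E]] unfolding D_def by blast
  interpret kc: koszul_cech cochains D "\<delta>" s t K "length ts"
  proof (rule koszul_cech.intro)
    show "comm_group (cochains p)" for p by (rule comm_group_cochains)
    show "subgroup (D p q) (cochains p)" for p q
      unfolding D_def by (rule subgroup_cochains_of[OF E])
    show "\<delta> p \<in> hom (cochains p) (cochains (Suc p))" for p by (rule cech_diff_hom)
    show "\<delta> p y \<in> D (Suc p) q" if "y \<in> D p q" for y p q
      using that cech_diff_graded[OF _ E] unfolding D_def by blast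
    show "\<delta> (Suc p) (\<delta> p y) = \<one>\<^bsub>cochains (Suc (Suc p))\<^esub>"
      if "y \<in> carrier (cochains p)" for y p
      using that by (rule cech_diff_cech_diff)
    show "s p i \<in> hom (cochains p) (cochains p)" for p i
      unfolding s_def using \<tau>R by (intro cop_hom)
    show "s p i y \<in> D p q" if "p > 0" "y \<in> D p (Suc q)" for p i y q
      unfolding s_def D_def
    proof (rule cop_graded[OF E E])
      show "y \<in> cochains_of (e \<cdot> inv\<^sub>P c \<up> Suc q) p"
        using that by (simp add: D_def)
      have *: "c \<cdot> (e \<cdot> inv\<^sub>P c \<up> Suc q) = e \<cdot> inv\<^sub>P c \<up> q"
        using e c Pic.mult_left_inv_cancel[of c e "inv\<^sub>P c \<up> q"] by (simp add: Pic.m_assoc)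
      show "\<exists>d\<in>\<P>. xmon (\<tau> i) \<in> cox_part X d \<and>
          d \<cdot> (e \<cdot> inv\<^sub>P c \<up> Suc q) =
          e \<cdot> inv\<^sub>P c \<up> q \<cdot> mdeg X (expo js) \<up> (0::nat)" for js
        using c e xmon_cox_part[OF \<tau>(1), of i] \<tau>(2) * by (intro bexI[of _ c]) (auto simp del: nat_pow_Suc)
    qed
    show "s p i (s p j y) = s p j (s p i y)" if "y \<in> carrier (cochains p)" for p i j y
      unfolding s_def using that \<tau>R by (simp add: cop_cop mult.commute)
    show "\<delta> p (s p i y) = s (Suc p) i (\<delta> p y)"
      if "y \<in> carrier (cochains p)" for p i y
      unfolding s_def using that \<tau>R by (intro cech_diff_cop)
    show "t p i \<in> hom (cochains p) (cochains p)" if "p > 0" for p i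
      unfolding t_def using aR that by (intro cop_hom) auto
    show "t p i y \<in> D p (Suc q)" if "p > 0" "y \<in> D p q" for p i y q
      unfolding t_def D_def
    proof (rule cop_graded[OF E E])
      show "y \<in> cochains_of (e \<cdot> inv\<^sub>P c \<up> q) p"
        using that by (simp add: D_def)
      fix js assume js: "js \<in> index p"
      let ?d = "mdeg X (r0 js)"
      have dc: "?d \<in> \<P>" using mdeg_closed r0[OF js \<open>p > 0\<close>] by blast
      have md: "mdeg X (expo js) \<in> \<P>" using mdeg_closed on_rays_expo[OF js] by blast
      have pow: "on_rays (((+) (expo js) ^^ n) 0) \<and> mdeg X (((+) (expo js) ^^ n) 0) = mdeg X (expo js) \<up> n" for n
      proof (induction n)
        case 0
        show ?case by (simp add: mdeg_zero)
      next
        case (Suc n)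
        then show ?case
          using on_rays_add[of "expo js" "((+) (expo js) ^^ n) 0"] mdeg_add[of "expo js" "((+) (expo js) ^^ n) 0"]
            on_rays_expo[OF js] md
          by (simp add: Pic.m_comm)
      qed
      have cd: "c \<cdot> ?d = mdeg X (expo js) \<up> n0 js"
        using mdeg_add[OF \<tau>(1)[of "i0 js"] r0[OF js \<open>p > 0\<close>]] \<tau>(2) n0[OF js \<open>p > 0\<close>] pow by simp
      have "e \<cdot> inv\<^sub>P c \<up> Suc q \<cdot> (c \<cdot> ?d) =
          c \<cdot> (e \<cdot> (?d \<cdot> inv\<^sub>P c \<up> q) \<cdot> inv\<^sub>P c)"
        using e c dc by (simp add: Pic.m_ac)
      also have "\<dots> = e \<cdot> (?d \<cdot> inv\<^sub>P c \<up> q)"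
        using e c dc by (intro Pic.mult_left_inv_cancel) auto
      finally have *: "?d \<cdot> (e \<cdot> inv\<^sub>P c \<up> q) =
          e \<cdot> inv\<^sub>P c \<up> Suc q \<cdot> mdeg X (expo js) \<up> n0 js"
        using e c dc unfolding cd by (simp add: Pic.m_ac)
      have "a i js \<in> cox_part X ?d"
        using r0[OF js \<open>p > 0\<close>] by (simp add: a_def zero_cox_part xmon_cox_part)
      then show "\<exists>d\<in>\<P>. a i js \<in> cox_part X d \<and>
          d \<cdot> (e \<cdot> inv\<^sub>P c \<up> q) =
          e \<cdot> inv\<^sub>P c \<up> Suc q \<cdot> mdeg X (expo js) \<up> n0 js"
        using dc * by blast
    qed
    show "t p i (t p j y) = t p j (t p i y)" if "p > 0" "y \<in> carrier (cochains p)" for p i j y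
      unfolding t_def using that aR[OF _ that(1)] by (simp add: cop_cop mult.commute add.commute)
    show "s p i (t p j y) = t p j (s p i y)" if "p > 0" "y \<in> carrier (cochains p)" for p i j y
      unfolding s_def t_def using that \<tau>R aR[OF _ that(1)] by (simp add: cop_cop mult.commute add.commute)
    show "kos_sum (cochains p) (s p) (t p) K y = y" if p: "p > 0" and y: "y \<in> carrier (cochains p)" for p y
    proof
      fix js
      show "kos_sum (cochains p) (s p) (t p) K y js = y js"
      proof (cases "js \<in> index p")
        case js: True
        interpret L: comm_group "L js" using js by (rule comm_group_L)
        have yj: "y js \<in> carrier (L js)" using y js by (auto simp: cochains_simps)
        have st: "s p i (t p i y) js = (if i = i0 js then y js else \<one>\<^bsub>L js\<^esub>)" for i
        proof -
          have "s p i (t p i y) = cop p (\<lambda>js. xmon (\<tau> i) * a i js) (\<lambda>js. 0 + n0 js) y"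
            unfolding s_def t_def using \<tau>R aR[OF _ p] y by (intro cop_cop) auto
          then show ?thesis
            using js inv[OF js p] loc_op_id[OF xmon_expo[OF js] yj] loc_op_zero[OF xmon_expo[OF js] yj]
            by (simp add: cop_def a_def)
        qed
        have "kos_sum (cochains p) (s p) (t p) n y js = (if i0 js < n then y js else \<one>\<^bsub>L js\<^esub>)" for n
          by (induction n) (use js st yj in \<open>auto simp: cochains_simps\<close>)
        then show ?thesis using i0[OF js p] by simp
      next
        case False
        have "kos_sum (cochains p) (s p) (t p) n y js = undefined" for n
          using False by (cases n) (auto simp: cochains_simps)
        then show ?thesis using False y by (auto simp: cochains_simps PiE_def extensional_def)
      qed
    qed
    show "carrier (cochains p) = {\<one>\<^bsub>cochains p\<^esub>}" if "p > length ts" for p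
      using cech_index_empty[OF that] by (simp add: cochains_simps restrict_def)
    show "\<exists>w\<in>D p (Suc p). \<delta> p w = y"
      if "p > 0" "y \<in> D (Suc p) (Suc p)" "\<delta> (Suc p) y = \<one>\<^bsub>cochains (Suc (Suc p))\<^esub>" for p y
      using exact that unfolding D_def by blast
    show "y = \<one>\<^bsub>cochains 1\<^esub>" if "y \<in> D 1 1" "\<delta> 1 y = \<one>\<^bsub>cochains (Suc 1)\<^esub>" for y
      using inject[of y] that c by (simp add: D_def numeral_2_eq_2)
  qed
  show ?thesis
    using kc.cocycle_trivial[of x] x e by (simp add: D_def numeral_2_eq_2)
qed

end

section \<open>Vanishing of local cohomology in terms of cocycles and torsion\<close>

context cech
begin

lemma one_in_coboundaries:
  assumes b: "b \<in> \<P>"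
  shows "\<one>\<^bsub>cochains p\<^esub> \<in> cech_coboundaries X M gr ts p b"
proof (cases p)
  case 0
  then show ?thesis by (simp add: cech_cochains_simps)
next
  case (Suc r)
  have "\<delta> r \<one>\<^bsub>cochains r\<^esub> = \<one>\<^bsub>cochains (Suc r)\<^esub>"
    using hom_one[OF cech_diff_hom] comm_group.axioms(2)[OF comm_group_cochains] by blast
  moreover have "\<one>\<^bsub>cochains r\<^esub> \<in> cochains_of b r"
    using subgroup.one_closed[OF subgroup_cochains_of[OF b]] .
  ultimately show ?thesis
    unfolding Suc cech_coboundaries.simps cech_cochains_simps by (metis imageI)
qed

text \<open>If the quotient is trivial, the coset of z is the set of coboundaries itself; z lies in
  its own coset because the coboundaries contain \<one>.\<close>

lemma vanishing_imp_exact: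
  assumes b: "b \<in> \<P>"
    and triv: "trivial_group (local_cohomology X M gr ts p b)"
    and z: "z \<in> cochains_of b p" "\<delta> p z = \<one>\<^bsub>cochains (Suc p)\<^esub>"
  shows "z \<in> cech_coboundaries X M gr ts p b"
proof -
  let ?B = "cech_coboundaries X M gr ts p b"
  let ?C = "cech_cochains X M gr ts p b"
  interpret G: comm_group "cochains p" by (rule comm_group_cochains)
  have zZ: "z \<in> cech_cocycles X M gr ts p b"
    using z by (simp add: cech_cocycles_def kernel_def cech_cochains_simps)
  have "?B #>\<^bsub>?C\<lparr>carrier := cech_cocycles X M gr ts p b\<rparr>\<^esub> z \<in> carrier (local_cohomology X M gr ts p b)"
    using zZ by (auto simp: local_cohomology_def FactGroup_def RCOSETS_def)
  then have eq: "?B #>\<^bsub>?C\<lparr>carrier := cech_cocycles X M gr ts p b\<rparr>\<^esub> z = ?B"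
    using triv by (simp add: trivial_group_def local_cohomology_def)
  have "\<one>\<^bsub>cochains p\<^esub> \<otimes>\<^bsub>cochains p\<^esub> z \<in> ?B #>\<^bsub>?C\<lparr>carrier := cech_cocycles X M gr ts p b\<rparr>\<^esub> z"
    using one_in_coboundaries[OF b, of p] by (auto simp: r_coset_def cech_cochains_simps)
  moreover have "z \<in> carrier (cochains p)"
    using z(1) subgroup.subset[OF subgroup_cochains_of[OF b]] by blast
  ultimately show ?thesis using eq by simp
qed

lemma vanishing_imp_lift:
  assumes "b \<in> \<P>" "trivial_group (local_cohomology X M gr ts (Suc p) b)"
    "z \<in> cochains_of b (Suc p)" "\<delta> (Suc p) z = \<one>\<^bsub>cochains (Suc (Suc p))\<^esub>"
  shows "\<exists>w\<in>cochains_of b p. \<delta> p w = z"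
  using vanishing_imp_exact[OF assms] by (auto simp: cech_cochains_simps)

lemma index_0: "index 0 = {[]}"
  by (auto simp: cech_index_def)

lemma expo_Nil: "expo [] = 0"
  by (simp add: cech_exponent_def)

text \<open>The empty list localises at the monomial 1, so the 0-cochains of degree b are M_b. H^1_B
  is the quotient of the cocycles by the image of this group, which is trivial here.\<close>

lemma cocycle_trivial_of_zero:
  assumes b: "b \<in> \<P>" and triv: "trivial_group (local_cohomology X M gr ts 1 b)"
    and zero: "gr b \<subseteq> {\<zero>}"
    and z: "z \<in> cochains_of b 1" "\<delta> 1 z = \<one>\<^bsub>cochains 2\<^esub>"
  shows "z = \<one>\<^bsub>cochains 1\<^esub>"
proof -
  obtain w where w: "w \<in> cochains_of b 0" "\<delta> 0 w = z"
    using vanishing_imp_lift[of b 0 z] b triv z by (auto simp: numeral_2_eq_2)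
  have "w = \<one>\<^bsub>cochains 0\<^esub>"
  proof
    fix js
    show "w js = \<one>\<^bsub>cochains 0\<^esub> js"
    proof (cases "js = []")
      case True
      have "w [] \<in> loc_part 0 b"
        using w(1) index_0 expo_Nil by (auto simp: cochains_of_def PiE_iff)
      then obtain m k where m: "w [] = fraction M (xmon 0) m k" "m \<in> gr (b \<cdot> mdeg X 0 \<up> (k::nat))"
        by (auto simp: loc_part_def)
      then have "m = \<zero>" using zero b by (auto simp: mdeg_zero)
      then have "w [] = \<one>\<^bsub>L []\<^esub>"
        using m(1) by (simp add: expo_Nil fraction_eq_one_iff ring_simps power_closed)
      then show ?thesis using True by (simp add: cochains_simps index_0)
    next
      case False
      then show ?thesis using w(1) by (auto simp: cochains_of_def cochains_simps index_0 PiE_def extensional_def)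
    qed
  qed
  then show ?thesis
    using w(2) hom_one[OF cech_diff_hom[of 0]] comm_group.axioms(2)[OF comm_group_cochains] by simp
qed

text \<open>The fractions m / 1 form the coboundary of m, a cocycle of degree 1, hence trivial. Its
  component at t says that a power of x^t kills m.\<close>

lemma torsion_of_cocycle_trivial:
  assumes b: "b \<in> \<P>"
    and triv: "\<And>z. z \<in> cochains_of b 1 \<Longrightarrow> \<delta> 1 z = \<one>\<^bsub>cochains 2\<^esub> \<Longrightarrow> z = \<one>\<^bsub>cochains 1\<^esub>"
    and m: "m \<in> gr b" and t: "t \<in> set ts"
  shows "\<exists>j. xmon t ^ j \<odot> m = \<zero>"
proof -
  have mM: "m \<in> carrier M" using gr_closed[OF b m] .
  define w where "w = (\<lambda>js\<in>index 0. fraction M (xmon 0) m 0)"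
  have "fraction M (xmon 0) m 0 \<in> loc_part 0 b"
    unfolding loc_part_def using m b by (auto intro!: exI[of _ m] exI[of _ "0::nat"])
  then have w: "w \<in> cochains_of b 0"
    by (auto simp: w_def cochains_of_def index_0 expo_Nil)
  then have wc: "w \<in> carrier (cochains 0)"
    using subgroup.subset[OF subgroup_cochains_of[OF b]] by blast
  have dw: "\<delta> 0 w = \<one>\<^bsub>cochains 1\<^esub>"
    using triv[of "\<delta> 0 w"] cech_diff_graded[OF w b] cech_diff_cech_diff[OF wc]
    by (simp add: numeral_2_eq_2)
  obtain i where i: "i < length ts" "ts ! i = t" using t by (auto simp: in_set_conv_nth)
  have I: "[i] \<in> index (Suc 0)" using i by (simp add: cech_index_def)
  have E: "expo [i] = t" using i by (simp add: cech_exponent_def)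
  have tR: "(xmon t :: ('v, 'k) cox) \<in> \<S>" using ts[OF t] by (simp add: xmon_closed)
  interpret L: comm_group "L [i]" using I by (rule comm_group_L)
  have r: "res 0 [i] w [] = fraction M (xmon t) m 0"
    using loc_op_fraction[of 1 "xmon t" 1 "xmon t" m 0 0] tR mM
    by (simp add: res_def index_0 expo_Nil E w_def ring_simps smult_1)
  have rc: "res 0 [i] w [] \<in> carrier (L [i])" using res_closed[OF wc I] .
  have "\<delta> 0 w [i] = res 0 [i] w [] \<otimes>\<^bsub>L [i]\<^esub> inv\<^bsub>L [i]\<^esub> \<one>\<^bsub>L [i]\<^esub>"
    using res_closed[OF wc I] I
    by (simp add: cech_diff_eq[OF wc I] L.alt_prod_Cons alt_prod_def[of _ _ "[]"])
  then have "fraction M (xmon t) m 0 = \<one>\<^bsub>L [i]\<^esub>"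
    using dw rc r I by (simp add: cochains_simps)
  then show ?thesis using tR mM E by (simp add: fraction_eq_one_iff)
qed

end

section \<open>Degrees of a graded module\<close>

lemma monoid_span_closed:
  assumes "monoid G" "A \<subseteq> carrier G" "x \<in> monoid_span G A"
  shows "x \<in> carrier G"
  using assms(3)
proof induction
  case one
  then show ?case using assms(1) by (rule monoid.one_closed)
next
  case (incl a)
  then show ?case using assms(2) by blast
next
  case (mult a b)
  then show ?case using assms(1) by (simp add: monoid.m_closed)
qed

context graded_cox
begin

lemma mdeg_Eff:
  assumes "on_rays t"
  shows "mdeg X t \<in> Eff X"
proof -
  have Eff_mult: "a \<cdot> b \<in> Eff X" if "a \<in> Eff X" "b \<in> Eff X" for a b
    using that unfolding Eff_def by (rule monoid_span.mult)
  have Eff_one: "\<one>\<^sub>P \<in> Eff X" unfolding Eff_def by (rule monoid_span.one)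
  have single: "mdeg X (single \<rho> n) \<in> Eff X" if "\<rho> \<in> rays X" for \<rho> and n :: nat
  proof (induction n)
    case 0
    then show ?case by (simp add: mdeg_zero Eff_one)
  next
    case (Suc n)
    have "Poly_Mapping.map int (single \<rho> 1) = single \<rho> 1"
      by (intro poly_mapping_eqI) (simp add: Poly_Mapping.map.rep_eq lookup_single when_def)
    then have "mdeg X (single \<rho> 1) \<in> Eff X"
      using that unfolding Eff_def mdeg_def by (auto intro!: monoid_span.incl)
    moreover have "single \<rho> (Suc n) = single \<rho> 1 + single \<rho> n"
      by (simp add: single_add[symmetric])
    moreover have on: "on_rays (single \<rho> k)" for k :: nat
      using that by (auto split: if_splits)
    ultimately show ?case
      using Suc mdeg_add[OF on[of 1] on[of n]] Eff_mult by metis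
  qed
  have "on_rays (\<Sum>\<rho>\<in>S. single \<rho> (f \<rho>)) \<and> mdeg X (\<Sum>\<rho>\<in>S. single \<rho> (f \<rho>)) \<in> Eff X"
    if "finite S" "S \<subseteq> rays X" for S and f :: "'v set \<Rightarrow> nat"
    using that
  proof (induction S rule: finite_induct)
    case empty
    then show ?case by (simp add: mdeg_zero Eff_one)
  next
    case (insert \<rho> S)
    have "on_rays (single \<rho> (f \<rho>))"
      using insert.prems keys_single[of \<rho> "f \<rho>"] by (auto split: if_splits)
    then show ?case
      using insert single[of \<rho> "f \<rho>"] on_rays_add mdeg_add Eff_mult by simp
  qed
  from this[of "keys t" "lookup t"]
  have S: "mdeg X (\<Sum>\<rho>\<in>keys t. single \<rho> (lookup t \<rho>)) \<in> Eff X"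
    using assms by simp
  have t: "t = (\<Sum>\<rho>\<in>keys t. single \<rho> (lookup t \<rho>))"
    by (rule poly_mapping_eqI) (auto simp: lookup_sum lookup_single when_def in_keys_iff)
  show ?thesis using S unfolding t[symmetric] .
qed

lemma Eff_closed: "b \<in> Eff X \<Longrightarrow> b \<in> \<P>"
proof -
  have "(\<lambda>\<rho>. div_class X (single \<rho> 1)) ` rays X \<subseteq> \<P>"
  proof safe
    fix \<rho> assume "\<rho> \<in> rays X"
    moreover have "Poly_Mapping.map int (single \<rho> 1) = single \<rho> 1"
      by (intro poly_mapping_eqI) (simp add: Poly_Mapping.map.rep_eq lookup_single when_def)
    ultimately show "div_class X (single \<rho> 1) \<in> \<P>"
      using mdeg_closed[of "single \<rho> 1"] by (simp add: mdeg_def)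
  qed
  then show "b \<in> Eff X \<Longrightarrow> b \<in> \<P>"
    unfolding Eff_def by (rule monoid_span_closed[OF Pic.monoid_axioms])
qed

definition decomposition :: "'m \<Rightarrow> ('v pic \<Rightarrow> 'm) \<Rightarrow> bool" where
  "decomposition m c \<longleftrightarrow> c \<in> (\<Pi>\<^sub>E b\<in>\<P>. gr b) \<and>
     finite {b \<in> \<P>. c b \<noteq> \<zero>} \<and> m = finsum M c {b \<in> \<P>. c b \<noteq> \<zero>}"

lemma decomposition_ex1: "m \<in> carrier M \<Longrightarrow> \<exists>!c. decomposition m c"
  using graded by (simp add: graded_module_def decomposition_def)

lemma decomposition_closed:
  "decomposition m c \<Longrightarrow> b \<in> \<P> \<Longrightarrow> c b \<in> carrier M"
  using gr_closed by (auto simp: decomposition_def)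

lemma decomposition_superset:
  assumes "decomposition m c" "finite B" "{b \<in> \<P>. c b \<noteq> \<zero>} \<subseteq> B" "B \<subseteq> \<P>"
  shows "m = finsum M c B"
proof -
  have "finsum M c {b \<in> \<P>. c b \<noteq> \<zero>} = finsum M c B"
    using assms decomposition_closed[OF assms(1)]
    by (intro add.finprod_mono_neutral_cong_left) auto
  then show ?thesis using assms(1) by (simp add: decomposition_def)
qed

lemma decomposition_homogeneous:
  assumes b: "b \<in> \<P>" and m: "m \<in> gr b"
  shows "decomposition m (\<lambda>b'\<in>\<P>. if b' = b then m else \<zero>)" (is "decomposition m ?c")
proof -
  have sub: "{b' \<in> \<P>. ?c b' \<noteq> \<zero>} \<subseteq> {b}" by auto
  have "finsum M ?c {b' \<in> \<P>. ?c b' \<noteq> \<zero>} = finsum M ?c {b}"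
    using b m gr_closed[OF b m] by (intro add.finprod_mono_neutral_cong_left) auto
  also have "\<dots> = m" using b gr_closed[OF b m] by simp
  finally show ?thesis
    unfolding decomposition_def using finite_subset[OF sub] m gr_zero by auto
qed

lemma decomposition_add:
  assumes "decomposition m c" "decomposition n c'"
  shows "decomposition (m \<oplus> n) (\<lambda>b\<in>\<P>. c b \<oplus> c' b)" (is "decomposition _ ?d")
proof -
  let ?B = "{b \<in> \<P>. c b \<noteq> \<zero>} \<union> {b \<in> \<P>. c' b \<noteq> \<zero>}"
  have fin: "finite ?B" using assms by (simp add: decomposition_def)
  note cl = decomposition_closed[OF assms(1)] decomposition_closed[OF assms(2)]
  have sub: "{b \<in> \<P>. ?d b \<noteq> \<zero>} \<subseteq> ?B" by auto
  have "finsum M ?d {b \<in> \<P>. ?d b \<noteq> \<zero>} = finsum M (\<lambda>b. c b \<oplus> c' b) ?B"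
    using fin sub cl by (intro add.finprod_mono_neutral_cong_left) auto
  also have "\<dots> = finsum M c ?B \<oplus> finsum M c' ?B"
    using cl by (intro finsum_addf) auto
  also have "\<dots> = m \<oplus> n"
    using decomposition_superset[OF assms(1) fin] decomposition_superset[OF assms(2) fin] by auto
  finally show ?thesis
    using assms finite_subset[OF sub fin] gr_add by (auto simp: decomposition_def PiE_iff)
qed

lemma submodule_finsum:
  assumes "submodule H (cox_ring X) M" "finite A" "\<And>a. a \<in> A \<Longrightarrow> f a \<in> H"
  shows "finsum M f A \<in> H"
  using assms(2,3)
proof (induction A rule: finite_induct)
  case empty
  have "subgroup H (add_monoid M)" using assms(1) by (simp add: submodule_def)
  then show ?case using subgroup.one_closed by force
next
  case (insert x F)
  then show ?case
    using submoduleE(1,5)[OF assms(1)] by (subst finsum_insert) auto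
qed

text \<open>The homogeneous components of finitely many generators generate as well, and a
  generating subset of least cardinality of this finite set is minimal.\<close>

lemma minimal_generators_exist:
  assumes "finitely_generated (cox_ring X) M"
  obtains G where "minimal_homogeneous_generators X M gr G"
proof -
  obtain G0 where G0: "finite G0" "generates (cox_ring X) M G0"
    using assms by (auto simp: finitely_generated_def)
  have G0M: "G0 \<subseteq> carrier M" using G0(2) by (simp add: generates_def)
  have "\<forall>g\<in>G0. \<exists>c. decomposition g c" using decomposition_ex1 G0M by blast
  then obtain c where c: "\<And>g. g \<in> G0 \<Longrightarrow> decomposition g (c g)" by metis
  define G1 where "G1 = (\<Union>g\<in>G0. c g ` {b \<in> \<P>. c g b \<noteq> \<zero>})"
  have fin1: "finite G1" unfolding G1_def using G0(1) c by (auto simp: decomposition_def)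
  have hom1: "G1 \<subseteq> (\<Union>b\<in>\<P>. gr b)"
    unfolding G1_def using c by (auto simp: decomposition_def PiE_iff)
  have "generates (cox_ring X) M G1"
    unfolding generates_def
  proof (intro conjI subset_antisym)
    show G1M: "G1 \<subseteq> carrier M" using hom1 gr_closed by auto
    show "(\<lambda>H. submodule H (cox_ring X) M) hull G1 \<subseteq> carrier M"
      using G1M carrier_is_submodule
      by (rule hull_minimal[where S = "\<lambda>H. submodule H (cox_ring X) M" and t = "carrier M"])
    show "carrier M \<subseteq> (\<lambda>H. submodule H (cox_ring X) M) hull G1"
      unfolding hull_def
    proof (rule Inter_greatest, clarify)
      fix H x assume H: "submodule H (cox_ring X) M" "G1 \<subseteq> H" and x: "x \<in> carrier M"
      have "G0 \<subseteq> H"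
      proof
        fix g assume g: "g \<in> G0"
        have "finsum M (c g) {b \<in> \<P>. c g b \<noteq> \<zero>} \<in> H"
          using H g c[OF g] by (intro submodule_finsum) (auto simp: decomposition_def G1_def)
        then show "g \<in> H" using c[OF g] by (simp add: decomposition_def)
      qed
      then have "(\<lambda>H. submodule H (cox_ring X) M) hull G0 \<subseteq> H"
        using H(1) by (rule hull_minimal[where S = "\<lambda>H. submodule H (cox_ring X) M" and t = H])
      then show "x \<in> H" using x G0(2) by (auto simp: generates_def)
    qed
  qed
  then obtain G where G: "G \<subseteq> G1" "generates (cox_ring X) M G"
    and least: "\<And>G'. G' \<subseteq> G1 \<Longrightarrow> generates (cox_ring X) M G' \<Longrightarrow> card G \<le> card G'"
    using ex_has_least_nat[of "\<lambda>G. G \<subseteq> G1 \<and> generates (cox_ring X) M G" G1 card] by blast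
  have "\<not> generates (cox_ring X) M G'" if "G' \<subset> G" for G'
  proof
    assume "generates (cox_ring X) M G'"
    then have "card G \<le> card G'" using least that G(1) by blast
    moreover have "finite G" using G(1) fin1 finite_subset by blast
    ultimately show False using psubset_card_mono[OF _ that] by simp
  qed
  then show ?thesis
    using that[of G] G hom1 by (auto simp: minimal_homogeneous_generators_def)
qed

text \<open>The components of degree in \<open>Eff X\<close> form a submodule, as \<open>Eff X\<close> contains the degrees of all monomials.\<close>

lemma graded_part_zero:
  assumes fg: "finitely_generated (cox_ring X) M" and deg: "minimal_generator_degrees X M gr \<subseteq> Eff X"
    and d: "d \<in> \<P>" "d \<notin> Eff X"
  shows "gr d \<subseteq> {\<zero>}"
proof -
  \<comment> \<open>The sum of the parts with degree in \<open>Eff X\<close>, encoded as the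
    additive monoid they generate; its closure under negation and scalars follows by
    induction.\<close>
  define N where "N = monoid_span (add_monoid M) (\<Union>b\<in>Eff X. gr b)"
  have grM: "(\<Union>b\<in>Eff X. gr b) \<subseteq> carrier M" using gr_closed Eff_closed by blast
  have NM: "x \<in> carrier M" if "x \<in> N" for x
    using monoid_span_closed[of "add_monoid M" "\<Union>b\<in>Eff X. gr b" x] grM that add.monoid_axioms by (simp add: N_def)
  have N0: "\<zero> \<in> N" using monoid_span.one[of "add_monoid M"] by (simp add: N_def)
  have Nadd: "x \<oplus> y \<in> N" if "x \<in> N" "y \<in> N" for x y
    using monoid_span.mult[of x "add_monoid M" _ y] that by (simp add: N_def)
  have Nincl: "x \<in> N" if "x \<in> gr b" "b \<in> Eff X" for x b
    unfolding N_def using that by (intro monoid_span.incl) auto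
  have Ninduct [consumes 1, case_names zero incl add]: "P x" if "x \<in> N" "P \<zero>" "\<And>x b. b \<in> Eff X \<Longrightarrow> x \<in> gr b \<Longrightarrow> P x"
    "\<And>x y. x \<in> N \<Longrightarrow> P x \<Longrightarrow> y \<in> N \<Longrightarrow> P y \<Longrightarrow> P (x \<oplus> y)" for P x
    using that(1) unfolding N_def
    by (induction rule: monoid_span.induct) (use that(2-) in \<open>auto simp: N_def\<close>)
  have Nneg: "\<ominus> x \<in> N" if "x \<in> N" for x
    using that
  proof (induction rule: Ninduct)
    case zero
    then show ?case using N0 add.inv_one by (simp add: a_inv_def)
  next
    case (incl x b)
    then show ?case using Nincl gr_uminus Eff_closed by blast
  next
    case (add x y)
    then show ?case using NM Nadd by (simp add: minus_add)
  qed
  have Nmon: "single t k \<odot> x \<in> N" if "x \<in> N" and t: "on_rays t" for x t k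
    using that(1)
  proof (induction rule: Ninduct)
    have mon: "single t k \<in> cox_part X (mdeg X t)"
      using t keys_single[of t k] by (auto simp: cox_part_def cox_ring_def split: if_splits)
    note monR = cox_part_closed[OF mon]
    {
      case zero
      then show ?case using monR N0 by simp
    next
      case (incl x b)
      have "single t k \<odot> x \<in> gr (mdeg X t \<cdot> b)"
        using incl mon t by (intro gr_smult mdeg_closed Eff_closed) auto
      moreover have "mdeg X t \<cdot> b \<in> Eff X"
        using mdeg_Eff[OF t] incl(1) unfolding Eff_def by (rule monoid_span.mult)
      ultimately show ?case by (rule Nincl)
    next
      case (add x y)
      then show ?case using NM Nadd monR by (simp add: smult_r_distr)
    }
  qed
  have Nsmult: "f \<odot> x \<in> N" if f: "f \<in> \<S>" and x: "x \<in> N" for f x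
  proof -
    have "(\<Sum>t\<in>S. single t (lookup f t)) \<in> \<S> \<and>
        (\<Sum>t\<in>S. single t (lookup f t)) \<odot> x \<in> N"
      if "finite S" "S \<subseteq> keys f" for S
      using that
    proof (induction S rule: finite_induct)
      case empty
      then show ?case using NM[OF x] N0 by (simp add: smult_0 ring_simps)
    next
      case (insert t S)
      have t: "on_rays t" using f insert.prems by (auto simp: cox_ring_def)
      then have c: "single t (lookup f t) \<in> \<S>"
        using keys_single[of t "lookup f t"] by (auto simp: cox_ring_def split: if_splits)
      have IH: "(\<Sum>t\<in>S. single t (lookup f t)) \<in> \<S>"
        "(\<Sum>t\<in>S. single t (lookup f t)) \<odot> x \<in> N"
        using insert by auto
      have "(single t (lookup f t) +
          (\<Sum>t\<in>S. single t (lookup f t))) \<odot> x \<in> N"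
        using smult_l_distr[OF c IH(1) NM[OF x]] Nmon[OF x t] IH(2) Nadd by (simp add: add_R)
      then show ?case using insert.hyps ring_simps(4)[OF c IH(1)] by simp
    qed
    from this[of "keys f"]
    have S: "(\<Sum>t\<in>keys f. single t (lookup f t)) \<odot> x \<in> N"
      by simp
    have f': "f = (\<Sum>t\<in>keys f. single t (lookup f t))"
      by (rule poly_mapping_eqI) (auto simp: lookup_sum lookup_single when_def in_keys_iff)
    show ?thesis using S unfolding f'[symmetric] .
  qed
  have sub: "submodule N (cox_ring X) M"
    using NM N0 Nneg Nadd Nsmult by (intro submoduleI) auto
  obtain G where G: "minimal_homogeneous_generators X M gr G"
    using minimal_generators_exist[OF fg] .
  have "G \<subseteq> N"
  proof
    fix g assume g: "g \<in> G"
    then obtain b where b: "b \<in> \<P>" "g \<in> gr b"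
      using G by (auto simp: minimal_homogeneous_generators_def)
    then have "b \<in> Eff X" using deg G g by (auto simp: minimal_generator_degrees_def)
    then show "g \<in> N" using b(2) by (intro Nincl)
  qed
  then have MN: "carrier M \<subseteq> N"
    using hull_minimal[of G N "\<lambda>H. submodule H (cox_ring X) M"] sub G
    by (auto simp: minimal_homogeneous_generators_def generates_def)
  \<comment> \<open>By now N is all of M. Its elements decompose without components outside
    \<open>Eff X\<close>, so uniqueness forces an element of degree d, which is its own component in
    degree d, to be zero.\<close>
  have decomp: "\<exists>c. decomposition x c \<and> (\<forall>b\<in>\<P>. b \<notin> Eff X \<longrightarrow> c b = \<zero>)" if "x \<in> N" for x
    using that
  proof (induction rule: Ninduct)
    case zero
    have "decomposition \<zero> (\<lambda>b'\<in>\<P>. if b' = \<one>\<^sub>P then \<zero> else \<zero>)"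
      using gr_zero by (intro decomposition_homogeneous) auto
    moreover have "\<forall>b\<in>\<P>. (\<lambda>b'\<in>\<P>. if b' = \<one>\<^sub>P then \<zero> else \<zero>) b = \<zero>"
      by simp
    ultimately show ?case by blast
  next
    case (incl x b)
    then have "decomposition x (\<lambda>b'\<in>\<P>. if b' = b then x else \<zero>)"
      using Eff_closed by (intro decomposition_homogeneous) auto
    moreover have "\<forall>a\<in>\<P>. a \<notin> Eff X \<longrightarrow> (\<lambda>b'\<in>\<P>. if b' = b then x else \<zero>) a = \<zero>"
      using incl by auto
    ultimately show ?case by blast
  next
    case (add x y)
    then obtain c c' where c: "decomposition x c" "decomposition y c'"
      "\<forall>b\<in>\<P>. b \<notin> Eff X \<longrightarrow> c b = \<zero>" "\<forall>b\<in>\<P>. b \<notin> Eff X \<longrightarrow> c' b = \<zero>" by blast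
    have "\<forall>a\<in>\<P>. a \<notin> Eff X \<longrightarrow> (\<lambda>b\<in>\<P>. c b \<oplus> c' b) a = \<zero>"
      using c(3,4) by simp
    then show ?case
      using decomposition_add[OF c(1,2)] by blast
  qed
  show ?thesis
  proof
    fix m assume m: "m \<in> gr d"
    then have mM: "m \<in> carrier M" using gr_closed d(1) by blast
    obtain c where c: "decomposition m c" "c d = \<zero>"
      using decomp[of m] MN mM d by blast
    have "c = (\<lambda>b'\<in>\<P>. if b' = d then m else \<zero>)"
      using decomposition_ex1[OF mM] c(1) decomposition_homogeneous[OF d(1) m] by blast
    then show "m \<in> {\<zero>}" using c(2) d(1) by simp
  qed
qed

end

section \<open>Cones of a smooth projective fan\<close>

lemma span_convex_cone_hull: "span (convex_cone hull S) = span S"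
proof
  have "convex_cone hull S \<subseteq> span S"
    by (intro hull_minimal span_superset convex_cone_span)
  then show "span (convex_cone hull S) \<subseteq> span S"
    by (simp add: span_minimal)
  show "span S \<subseteq> span (convex_cone hull S)"
    by (intro span_mono hull_subset)
qed

lemma convex_cone_hull_sum:
  assumes "finite A" "\<And>a. a \<in> A \<Longrightarrow> c a \<ge> 0"
  shows "(\<Sum>a\<in>A. c a *\<^sub>R a) \<in> convex_cone hull A"
proof -
  have "(\<Sum>a\<in>B. c a *\<^sub>R a) \<in> convex_cone hull A" if "finite B" "B \<subseteq> A" for B
    using that
  proof (induction B rule: finite_induct)
    case (insert x B)
    then show ?case
      using assms(2)[of x]
      by simp (rule convex_cone_hull_add, rule convex_cone_hull_mul, auto intro: hull_inc)
  qed (simp add: convex_cone_hull_contains_0)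
  then show ?thesis using assms(1) by blast
qed

abbreviation ray :: "'v::euclidean_space \<Rightarrow> 'v set" where
  "ray a \<equiv> convex_cone hull {a}"

text \<open>\<open>e a\<close> is the coordinate functional of \<open>a\<close>, represented by the inner product.\<close>

definition dual_basis :: "'v::euclidean_space set \<Rightarrow> ('v \<Rightarrow> 'v) \<Rightarrow> bool" where
  "dual_basis A e \<longleftrightarrow> finite A \<and>
     (\<forall>a\<in>A. e a \<in> span A \<and> (\<forall>b\<in>A. e a \<bullet> b = (if a = b then 1 else 0)))"

text \<open>A linear functional with prescribed values on A is the inner product with some vector.
  Projecting this vector orthogonally to the span of A keeps the values and puts it where
  \<open>dual_lattice\<close> expects characters.\<close>

lemma dual_basis_exists:
  fixes A :: "'v::euclidean_space set"
  assumes "independent A"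
  obtains e where "dual_basis A e"
proof -
  have "\<exists>m\<in>span A. \<forall>b\<in>A. m \<bullet> b = f b" for f :: "'v \<Rightarrow> real"
  proof -
    obtain g where g: "linear g" "\<forall>x\<in>A. g x = f x"
      using linear_independent_extend[OF assms] by blast
    define m where "m = (\<Sum>i\<in>Basis. g i *\<^sub>R i)"
    have m: "m \<bullet> x = g x" for x
    proof -
      have "g x = g (\<Sum>i\<in>Basis. (x \<bullet> i) *\<^sub>R i)" by (simp add: euclidean_representation)
      also have "\<dots> = (\<Sum>i\<in>Basis. (x \<bullet> i) * g i)"
        using g(1) by (simp add: linear_sum linear_cmul)
      finally show ?thesis
        by (simp add: m_def inner_sum_left inner_commute[of x] mult.commute)
    qed
    obtain y z where "y \<in> span A" "\<And>w. w \<in> span A \<Longrightarrow> orthogonal z w" "m = y + z"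
      using orthogonal_subspace_decomp_exists[of A m] by metis
    note yz = this
    have "y \<bullet> b = f b" if "b \<in> A" for b
      using yz(2)[OF span_base[OF that]] yz(3) m[of b] g(2) that
      by (simp add: inner_add_left orthogonal_def)
    then show ?thesis using yz(1) by (intro bexI[of _ y]) auto
  qed
  then have "\<forall>a. \<exists>m. m \<in> span A \<and> (\<forall>b\<in>A. m \<bullet> b = (if a = b then 1 else 0))"
    unfolding Bex_def by (rule allI)
  then have "\<exists>e. \<forall>a. e a \<in> span A \<and> (\<forall>b\<in>A. e a \<bullet> b = (if a = b then 1 else 0))"
    by (rule choice)
  then show ?thesis
    using that assms by (auto simp: dual_basis_def independent_imp_finite)
qed

lemma dual_basis_expand:
  assumes "dual_basis A e" "x \<in> span A"
  shows "x = (\<Sum>a\<in>A. (e a \<bullet> x) *\<^sub>R a)"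
proof -
  have A: "finite A" "\<And>a b. a \<in> A \<Longrightarrow> b \<in> A \<Longrightarrow> e a \<bullet> b = (if a = b then 1 else 0)"
    using assms(1) by (auto simp: dual_basis_def)
  obtain c where c: "x = (\<Sum>a\<in>A. c a *\<^sub>R a)"
    using assms(2) A(1) by (auto simp: span_finite)
  have "e a \<bullet> x = c a" if "a \<in> A" for a
    using that A by (simp add: c inner_sum_right sum.delta if_distrib[of "(*) _"] cong: if_cong)
  then show ?thesis unfolding c by simp
qed

lemma dual_basis_inner_expand:
  assumes "dual_basis A e" "x \<in> span A"
  shows "m \<bullet> x = (\<Sum>a\<in>A. (e a \<bullet> x) * (m \<bullet> a))"
  by (subst dual_basis_expand[OF assms]) (simp add: inner_sum_right)

lemma cone_dual_basis:
  assumes e: "dual_basis A e" and B: "B \<subseteq> A"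
  shows "convex_cone hull B = {x \<in> span A. \<forall>a\<in>A. e a \<bullet> x \<ge> 0 \<and> (a \<notin> B \<longrightarrow> e a \<bullet> x = 0)}"
    (is "_ = ?R")
proof
  have fin: "finite A" "finite B" using e B by (auto simp: dual_basis_def intro: finite_subset)
  show "convex_cone hull B \<subseteq> ?R"
  proof (rule hull_minimal)
    show "B \<subseteq> ?R"
    proof
      fix x assume "x \<in> B"
      then have "x \<in> A" using B by blast
      then show "x \<in> ?R"
        using e \<open>x \<in> B\<close> by (auto simp: dual_basis_def span_base)
    qed
    show "convex_cone ?R"
      unfolding convex_cone_iff
      by (auto simp: inner_add_right span_add span_scale span_zero)
  qed
  show "?R \<subseteq> convex_cone hull B"
  proof
    fix x assume x: "x \<in> ?R"
    have "x = (\<Sum>a\<in>A. (e a \<bullet> x) *\<^sub>R a)"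
      using x e by (auto intro: dual_basis_expand)
    also have "\<dots> = (\<Sum>a\<in>B. (e a \<bullet> x) *\<^sub>R a)"
      using x B fin by (intro sum.mono_neutral_right) auto
    also have "\<dots> \<in> convex_cone hull B"
      using x B fin by (intro convex_cone_hull_sum) auto
    finally show "x \<in> convex_cone hull B" .
  qed
qed

text \<open>A coordinate that is nonnegative at both ends of a segment and zero at an inner point is
  zero at both ends.\<close>

lemma cone_face_of:
  assumes e: "dual_basis A e" and B: "B \<subseteq> A"
  shows "(convex_cone hull B) face_of (convex_cone hull A)"
  unfolding face_of_def
proof (intro conjI ballI impI)
  show "convex_cone hull B \<subseteq> convex_cone hull A" using B by (rule hull_mono)
  show "convex (convex_cone hull B)" by (rule convex_convex_cone_hull)
  fix x y z assume xy: "x \<in> convex_cone hull A" "y \<in> convex_cone hull A"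
    and z: "z \<in> convex_cone hull B" "z \<in> open_segment x y"
  obtain t where t: "0 < t" "t < 1" "z = (1 - t) *\<^sub>R x + t *\<^sub>R y"
    using z(2) by (auto simp: in_segment)
  have "e a \<bullet> x = 0 \<and> e a \<bullet> y = 0" if "a \<in> A" "a \<notin> B" for a
  proof -
    have "(1 - t) * (e a \<bullet> x) + t * (e a \<bullet> y) = 0"
      using z(1) that by (auto simp: cone_dual_basis[OF e B] t(3) inner_add_right)
    moreover have "e a \<bullet> x \<ge> 0" "e a \<bullet> y \<ge> 0"
      using xy that by (auto simp: cone_dual_basis[OF e order_refl])
    ultimately show ?thesis
      using t(1,2) by (smt (verit) mult_nonneg_nonneg mult_pos_pos)
  qed
  then show "x \<in> convex_cone hull B" "y \<in> convex_cone hull B"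
    using xy by (auto simp: cone_dual_basis[OF e B] cone_dual_basis[OF e order_refl])
qed

lemma lattice_basis_dual:
  assumes "lattice_basis N A"
  obtains e where "dual_basis A e" "span N = span A" "A \<subseteq> N" "independent A"
    "\<And>x. x \<in> N \<longleftrightarrow> x \<in> span A \<and> (\<forall>a\<in>A. e a \<bullet> x \<in> \<int>)"
proof -
  have A: "independent A" "N = range (\<lambda>c. \<Sum>a\<in>A. of_int (c a) *\<^sub>R a)"
    using assms by (auto simp: lattice_basis_def)
  have fin: "finite A" using A(1) by (rule independent_imp_finite)
  obtain e where e: "dual_basis A e" using dual_basis_exists[OF A(1)] .
  have sub: "N \<subseteq> span A"
    unfolding A(2) by (auto intro!: span_sum span_scale intro: span_base)
  have N: "x \<in> N \<longleftrightarrow> x \<in> span A \<and> (\<forall>a\<in>A. e a \<bullet> x \<in> \<int>)" for x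
  proof
    assume x: "x \<in> N"
    then obtain c :: "'a \<Rightarrow> int" where c: "x = (\<Sum>a\<in>A. of_int (c a) *\<^sub>R a)" using A(2) by auto
    have "e a \<bullet> x = of_int (c a)" if "a \<in> A" for a
      using that e fin by (simp add: c dual_basis_def inner_sum_right if_distrib[of "(*) _"] cong: if_cong)
    then show "x \<in> span A \<and> (\<forall>a\<in>A. e a \<bullet> x \<in> \<int>)" using sub x by auto
  next
    assume x: "x \<in> span A \<and> (\<forall>a\<in>A. e a \<bullet> x \<in> \<int>)"
    then have "x = (\<Sum>a\<in>A. of_int \<lfloor>e a \<bullet> x\<rfloor> *\<^sub>R a)"
      using dual_basis_expand[OF e, of x] by (auto intro!: sum.cong elim: Ints_cases)
    then show "x \<in> N" unfolding A(2) by (rule range_eqI[of _ _ "\<lambda>a. \<lfloor>e a \<bullet> x\<rfloor>"])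
  qed
  have "A \<subseteq> N" using e N by (auto simp: dual_basis_def span_base)
  moreover from this sub have "span N = span A"
    by (metis span_mono span_span subset_antisym)
  ultimately show ?thesis using that e A(1) N by blast
qed

lemma ray_lattice_points:
  assumes "lattice_basis N A" "a \<in> A"
  shows "(ray a) \<inter> N = range (\<lambda>k::nat. of_nat k *\<^sub>R a)"
proof -
  obtain e where e: "dual_basis A e" "span N = span A" "A \<subseteq> N" "independent A"
    and N: "\<And>x. x \<in> N \<longleftrightarrow> x \<in> span A \<and> (\<forall>a\<in>A. e a \<bullet> x \<in> \<int>)"
    using lattice_basis_dual[OF assms(1)] by metis
  have "x \<in> range (\<lambda>k::nat. of_nat k *\<^sub>R a)" if x: "x \<in> ray a" "x \<in> N" for x
  proof -
    have xs: "x \<in> span A" "e a \<bullet> x \<ge> 0" "\<And>b. b \<in> A \<Longrightarrow> b \<noteq> a \<Longrightarrow> e b \<bullet> x = 0"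
      using x(1) assms(2) by (auto simp: cone_dual_basis[OF e(1), of "{a}"])
    have "(\<Sum>b\<in>A - {a}. (e b \<bullet> x) *\<^sub>R b) = 0"
      using xs(3) by (intro sum.neutral) auto
    then have "x = (e a \<bullet> x) *\<^sub>R a"
      using dual_basis_expand[OF e(1) xs(1)] e(1) assms(2)
        sum.remove[of A a "\<lambda>b. (e b \<bullet> x) *\<^sub>R b"]
      by (auto simp: dual_basis_def)
    also obtain i where i: "e a \<bullet> x = of_int i"
      using N[of x] x(2) assms(2) by (auto elim: Ints_cases)
    then have "e a \<bullet> x = of_nat (nat i)"
      using xs(2) by simp
    finally show ?thesis by (rule range_eqI)
  qed
  moreover have "of_nat k *\<^sub>R a \<in> ray a \<inter> N" for k :: nat
  proof -
    have "a \<in> N" using e(3) assms(2) by blast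
    then have "of_nat k *\<^sub>R a \<in> N"
      unfolding N by (auto intro: span_scale)
    moreover have "of_nat k *\<^sub>R a \<in> ray a"
      by (intro convex_cone_hull_mul) (auto intro: hull_inc)
    ultimately show ?thesis by blast
  qed
  ultimately show ?thesis by blast
qed

lemma ray_gen_eq:
  assumes "lattice_basis (lat X) A" "a \<in> A"
  shows "ray_gen X (ray a) = a"
  unfolding ray_gen_def
proof (rule the_equality)
  show "(ray a) \<inter> lat X = range (\<lambda>k::nat. of_nat k *\<^sub>R a)"
    using ray_lattice_points[OF assms] .
  fix u assume "(ray a) \<inter> lat X = range (\<lambda>k::nat. of_nat k *\<^sub>R u)"
  then have eq: "range (\<lambda>k::nat. of_nat k *\<^sub>R u) = range (\<lambda>k::nat. of_nat k *\<^sub>R a)"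
    using ray_lattice_points[OF assms] by simp
  have "u \<in> range (\<lambda>k::nat. of_nat k *\<^sub>R u)" "a \<in> range (\<lambda>k::nat. of_nat k *\<^sub>R a)"
    by (auto intro: range_eqI[of _ _ 1])
  then obtain k l :: nat where kl: "u = of_nat k *\<^sub>R a" "a = of_nat l *\<^sub>R u"
    using eq by blast
  have "a \<noteq> 0"
    using assms by (metis dependent_zero lattice_basis_def)
  moreover have "a = of_nat (l * k) *\<^sub>R a" by (metis kl of_nat_mult scaleR_scaleR)
  ultimately have "real (l * k) = 1"
    by (metis scaleR_cancel_right scaleR_one)
  then have "l * k = 1" by linarith
  then show "u = a" using kl by simp
qed

text \<open>Finitely many strict inequalities survive a small perturbation. This shows that a normal
  cone extends a little beyond x in the direction -y.\<close>

lemma finite_perturbation: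
  fixes p x y :: "'v::euclidean_space"
  assumes "finite V" "\<And>q. q \<in> V \<Longrightarrow> q \<noteq> p \<Longrightarrow> p \<bullet> x < q \<bullet> x"
  obtains \<epsilon> where "\<epsilon> > 0" "\<And>q. q \<in> V \<Longrightarrow> p \<bullet> (x - \<epsilon> *\<^sub>R y) \<le> q \<bullet> (x - \<epsilon> *\<^sub>R y)"
proof -
  have "eventually (\<lambda>\<epsilon>. p \<bullet> (x - \<epsilon> *\<^sub>R y) \<le> q \<bullet> (x - \<epsilon> *\<^sub>R y)) (at_right 0)" if "q \<in> V" for q
  proof (cases "q = p")
    case False
    have "((\<lambda>\<epsilon>. q \<bullet> (x - \<epsilon> *\<^sub>R y) - p \<bullet> (x - \<epsilon> *\<^sub>R y)) \<longlongrightarrow> q \<bullet> (x - 0 *\<^sub>R y) - p \<bullet> (x - 0 *\<^sub>R y)) (at_right 0)"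
      by (intro tendsto_intros)
    then have "eventually (\<lambda>\<epsilon>. 0 < q \<bullet> (x - \<epsilon> *\<^sub>R y) - p \<bullet> (x - \<epsilon> *\<^sub>R y)) (at_right 0)"
      using assms(2)[OF that False] by (intro order_tendstoD(1)) auto
    then show ?thesis by (rule eventually_mono) simp
  qed simp
  then have "eventually (\<lambda>\<epsilon>. \<forall>q\<in>V. p \<bullet> (x - \<epsilon> *\<^sub>R y) \<le> q \<bullet> (x - \<epsilon> *\<^sub>R y)) (at_right 0)"
    using assms(1) by (simp add: eventually_ball_finite)
  moreover have "eventually (\<lambda>\<epsilon>::real. \<epsilon> > 0) (at_right 0)"
    by (rule eventually_at_right_less)
  ultimately have "eventually (\<lambda>\<epsilon>. \<epsilon> > 0 \<and> (\<forall>q\<in>V. p \<bullet> (x - \<epsilon> *\<^sub>R y) \<le> q \<bullet> (x - \<epsilon> *\<^sub>R y))) (at_right 0)"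
    by (rule eventually_conj[rotated])
  then obtain \<epsilon> where "\<epsilon> > 0 \<and> (\<forall>q\<in>V. p \<bullet> (x - \<epsilon> *\<^sub>R y) \<le> q \<bullet> (x - \<epsilon> *\<^sub>R y))"
    using eventually_happens'[OF trivial_limit_at_right_real] by blast
  then show ?thesis using that by blast
qed

section \<open>The vertices of the polytope and their normal cones\<close>

locale smooth_projective_fan =
  fixes X :: "'v::euclidean_space toric" and V :: "'v set"
  assumes fan: "is_fan X" and smooth: "smooth_fan X"
    and V: "finite V" "V \<noteq> {}" "V \<subseteq> dual_lattice X"
    and cones_eq: "cones X = normal_fan (lat X) (convex hull V)"
begin

text \<open>For a vertex p this is the maximal cone of the normal fan at p. The finite set V stands
  in for its convex hull.\<close>

definition nc :: "'v \<Rightarrow> 'v set" where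
  "nc p = {v \<in> span (lat X). \<forall>q\<in>V. p \<bullet> v \<le> q \<bullet> v}"

definition verts :: "'v set" where
  "verts = {p. p extreme_point_of (convex hull V)}"

abbreviation u :: "'v set \<Rightarrow> 'v" where
  "u \<equiv> ray_gen X"

lemma verts_V: "verts \<subseteq> V"
  using extreme_point_of_convex_hull by (auto simp: verts_def)

lemma verts_span: "p \<in> verts \<Longrightarrow> p \<in> span (lat X)"
  using verts_V V by (auto simp: dual_lattice_def)

lemma nc_hull: "v \<in> nc p \<longleftrightarrow> v \<in> span (lat X) \<and> (\<forall>q\<in>convex hull V. p \<bullet> v \<le> q \<bullet> v)"
proof -
  have "convex hull V \<subseteq> {q. q \<bullet> v \<ge> p \<bullet> v}" if "\<forall>q\<in>V. p \<bullet> v \<le> q \<bullet> v"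
    using that convex_halfspace_ge[of "p \<bullet> v" v]
    by (intro hull_minimal) (auto simp: inner_commute)
  then show ?thesis
    using hull_subset[of V convex] by (auto simp: nc_def)
qed

lemma nc_in_cones:
  assumes "p \<in> verts"
  shows "nc p \<in> cones X"
proof -
  have "{p} face_of (convex hull V)"
    using assms by (simp add: verts_def face_of_singleton)
  then show ?thesis
    unfolding cones_eq normal_fan_def using nc_hull
    by (intro CollectI exI[of _ "{p}"]) auto
qed

lemma polytope_V: "polytope (convex hull V)"
  using V(1) by (rule polytope_convex_hull)

lemma face_has_vertex:
  assumes "F face_of (convex hull V)" "F \<noteq> {}"
  obtains p where "p \<in> verts" "p \<in> F"
proof -
  have "compact F" "convex F"
    using assms face_of_imp_compact[of "convex hull V" F] V(1) face_of_imp_convex[OF assms(1)]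
    by (auto simp: finite_imp_compact_convex_hull)
  then obtain p where p: "p extreme_point_of F"
    using extreme_point_exists_convex assms(2) by blast
  then have "p \<in> verts" "p \<in> F"
    using extreme_point_of_face[OF assms(1), of p] by (auto simp: verts_def)
  then show ?thesis by (rule that)
qed

text \<open>A nonempty face contains a vertex, and a functional that is minimal along the face is
  minimal there.\<close>

lemma cone_subset_nc:
  assumes "\<sigma> \<in> cones X"
  obtains p where "p \<in> verts" "\<sigma> \<subseteq> nc p"
proof -
  obtain F where F: "F face_of (convex hull V)" "F \<noteq> {}"
      "\<sigma> = {v \<in> span (lat X). \<forall>p\<in>F. \<forall>q\<in>convex hull V. p \<bullet> v \<le> q \<bullet> v}"
    using assms unfolding cones_eq normal_fan_def by auto
  obtain p where p: "p \<in> verts" "p \<in> F" using face_has_vertex[OF F(1,2)] .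
  have "\<sigma> \<subseteq> nc p" using p(2) F(3) nc_hull by blast
  then show ?thesis using p(1) by (rule that[rotated])
qed

text \<open>Faces of a polytope are exposed. The exposing functional is negated, because the normal
  fan is the inner one, and projected to the span of the lattice; this leaves its values up to sign,
  as V lies in that span.\<close>

lemma vertex_exposed:
  assumes "p \<in> verts"
  obtains x where "x \<in> span (lat X)" "\<And>q. q \<in> V \<Longrightarrow> q \<noteq> p \<Longrightarrow> p \<bullet> x < q \<bullet> x"
proof -
  have face: "{p} face_of (convex hull V)"
    using assms by (simp add: verts_def face_of_singleton)
  have "{p} exposed_face_of (convex hull V)"
    using face exposed_face_of_polyhedron[OF polytope_imp_polyhedron[OF polytope_V]] by simp
  then obtain a b where ab: "convex hull V \<subseteq> {x. a \<bullet> x \<le> b}" "{p} = convex hull V \<inter> {x. a \<bullet> x = b}"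
    by (auto simp: exposed_face_of_def)
  obtain y z where yz: "y \<in> span (lat X)" "\<And>w. w \<in> span (lat X) \<Longrightarrow> orthogonal z w" "- a = y + z"
    using orthogonal_subspace_decomp_exists[of "lat X" "- a"] by metis
  have "p \<bullet> y < q \<bullet> y" if q: "q \<in> V" "q \<noteq> p" for q
  proof -
    have "q \<in> convex hull V" using q hull_subset[of V convex] by blast
    then have "a \<bullet> q < b" "a \<bullet> p = b" using ab q(2) by force+
    moreover have "q \<in> span (lat X)" "p \<in> span (lat X)"
      using q V(3) verts_span[OF assms] by (auto simp: dual_lattice_def)
    then have "y \<bullet> q = - (a \<bullet> q)" "y \<bullet> p = - (a \<bullet> p)"
      using yz(2) yz(3) by (metis (no_types, lifting) add.right_neutral inner_add_left inner_minus_left orthogonal_def)+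
    ultimately show ?thesis by (simp add: inner_commute)
  qed
  then show ?thesis using that yz(1) by blast
qed

text \<open>Smoothness gives only a part A' of a lattice basis A. A functional exposing p stays in
  \<open>nc p\<close> after a small move along any vector of A, so A' spans all of A and equals
  it.\<close>

lemma vertex_basis:
  assumes "p \<in> verts"
  obtains A where "lattice_basis (lat X) A" "nc p = convex_cone hull A"
proof -
  obtain A A' where A: "lattice_basis (lat X) A" "A' \<subseteq> A" "nc p = convex_cone hull A'"
    using smooth nc_in_cones[OF assms] by (auto simp: smooth_fan_def)
  obtain x where x: "x \<in> span (lat X)" "\<And>q. q \<in> V \<Longrightarrow> q \<noteq> p \<Longrightarrow> p \<bullet> x < q \<bullet> x"
    using vertex_exposed[OF assms] by metis
  have xn: "x \<in> nc p" using x by (auto simp: nc_def) (metis order_less_imp_le order_refl)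
  have "a \<in> A'" if a: "a \<in> A" for a
  proof (rule ccontr)
    assume a': "a \<notin> A'"
    obtain \<epsilon> where \<epsilon>: "\<epsilon> > 0" "\<And>q. q \<in> V \<Longrightarrow> p \<bullet> (x - \<epsilon> *\<^sub>R a) \<le> q \<bullet> (x - \<epsilon> *\<^sub>R a)"
      using finite_perturbation[OF V(1) x(2)] by metis
    have "a \<in> span (lat X)"
      using a lattice_basis_dual[OF A(1)] by (metis span_base)
    then have "x - \<epsilon> *\<^sub>R a \<in> nc p"
      using \<epsilon>(2) x(1) by (auto simp: nc_def span_diff span_scale)
    then have "x - (x - \<epsilon> *\<^sub>R a) \<in> span A'"
      using xn A(3) span_convex_cone_hull[of A'] by (metis span_base span_diff)
    then have "a \<in> span A'"
      using \<epsilon>(1) span_scale[of "\<epsilon> *\<^sub>R a" A' "1 / \<epsilon>"] by simp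
    moreover have "independent A" using A(1) by (simp add: lattice_basis_def)
    ultimately show False
    proof -
      have "a \<in> span (A - {a})"
        using \<open>a \<in> span A'\<close> a' A(2) span_mono[of A' "A - {a}"] by blast
      then show False
        using \<open>independent A\<close> a by (auto simp: dependent_def)
    qed
  qed
  then have "A' = A" using A(2) by blast
  then show ?thesis using that A by blast
qed

lemma rays_basis:
  assumes "\<rho> \<in> rays X"
  obtains A where "lattice_basis (lat X) A" "u \<rho> \<in> A" "\<rho> = ray (u \<rho>)"
proof -
  have "\<rho> \<in> cones X" "dim \<rho> = 1" using assms by (auto simp: rays_def)
  then obtain A A' where A: "lattice_basis (lat X) A" "A' \<subseteq> A" "\<rho> = convex_cone hull A'"
    using smooth by (auto simp: smooth_fan_def)
  have "independent A'" using A independent_mono[of A A'] by (metis lattice_basis_def)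
  then have "card A' = 1"
    using \<open>dim \<rho> = 1\<close> A(3) span_convex_cone_hull[of A'] by (metis dim_span dim_eq_card_independent)
  then obtain a where a: "A' = {a}" by (auto simp: card_1_singleton_iff)
  have "u \<rho> = a" using ray_gen_eq[OF A(1), of a] A a by simp
  then show ?thesis using that[OF A(1)] A a by simp
qed

lemma cone_of_basis_vector:
  assumes "p \<in> verts" "lattice_basis (lat X) A" "nc p = convex_cone hull A" "B \<subseteq> A"
  shows "convex_cone hull B \<in> cones X"
proof -
  obtain e where e: "dual_basis A e" using lattice_basis_dual[OF assms(2)] by metis
  have "(convex_cone hull B) face_of nc p"
    unfolding assms(3) by (rule cone_face_of[OF e assms(4)])
  then show ?thesis
    using fan nc_in_cones[OF assms(1)] convex_cone_hull_nonempty[of B] unfolding is_fan_def by blast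
qed

lemma dim_cone:
  assumes "independent B"
  shows "dim (convex_cone hull B) = card B"
  using span_convex_cone_hull[of B] dim_span assms by (metis dim_eq_card_independent)

lemma basis_vector_ray:
  assumes "p \<in> verts" "lattice_basis (lat X) A" "nc p = convex_cone hull A" "a \<in> A"
  shows "ray a \<in> rays X" "u (ray a) = a"
proof -
  have "independent {a}"
    using assms(2,4) independent_mono[of A "{a}"] by (metis lattice_basis_def empty_subsetI insert_subset)
  then have "dim (ray a) = 1" by (simp add: dim_cone)
  then show "ray a \<in> rays X"
    using cone_of_basis_vector[OF assms(1-3), of "{a}"] assms(4) by (simp add: rays_def)
  show "u (ray a) = a" using ray_gen_eq[OF assms(2,4)] .
qed

text \<open>Let s > 0 be the coordinate of u \<rho> at some a in B. Then u \<rho> is the midpoint of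
  2 s a and 2 (u \<rho> - s a), both in the cone. As \<rho> is a face, it contains a, so a = k u
  \<rho> with k s = 1 in integers, and a = u \<rho>.\<close>

lemma ray_in_smooth_cone:
  assumes \<rho>: "\<rho> \<in> rays X" and A: "lattice_basis (lat X) A" "B \<subseteq> A" "convex_cone hull B \<in> cones X"
    and sub: "\<rho> \<subseteq> convex_cone hull B"
  shows "u \<rho> \<in> B"
proof -
  obtain e where e: "dual_basis A e" "A \<subseteq> lat X"
    and N: "\<And>x. x \<in> lat X \<longleftrightarrow> x \<in> span A \<and> (\<forall>a\<in>A. e a \<bullet> x \<in> \<int>)"
    using lattice_basis_dual[OF A(1)] by metis
  obtain A2 where A2: "lattice_basis (lat X) A2" "u \<rho> \<in> A2" and r: "\<rho> = ray (u \<rho>)"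
    using rays_basis[OF \<rho>] .
  have uL: "u \<rho> \<in> lat X"
    using lattice_basis_dual[OF A2(1)] A2(2) by blast
  let ?u = "u \<rho>"
  have "(\<rho> \<inter> convex_cone hull B) face_of (convex_cone hull B)"
    using fan \<rho> A(3) by (auto simp: is_fan_def rays_def)
  then have face: "\<rho> face_of (convex_cone hull B)"
    using sub by (simp add: Int_absorb2)
  have ur: "?u \<in> \<rho>" by (subst r) (simp add: hull_inc)
  have u0: "?u \<noteq> 0"
    using A2 by (metis dependent_zero lattice_basis_def)
  have uB: "?u \<in> span A" "\<And>a. a \<in> A \<Longrightarrow> e a \<bullet> ?u \<ge> 0" "\<And>a. a \<in> A \<Longrightarrow> a \<notin> B \<Longrightarrow> e a \<bullet> ?u = 0"
    using ur sub cone_dual_basis[OF e(1) A(2)] by auto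
  obtain a where a: "a \<in> A" "e a \<bullet> ?u \<noteq> 0"
    using dual_basis_expand[OF e(1) uB(1)] u0 by (metis (no_types, lifting) scale_eq_0_iff sum.neutral)
  define s where "s = e a \<bullet> ?u"
  have s: "s > 0" using uB(2)[OF a(1)] a(2) by (simp add: s_def)
  have aB: "a \<in> B" using a uB(3) by blast
  define y where "y = (2 * s) *\<^sub>R a"
  define z where "z = 2 *\<^sub>R (?u - s *\<^sub>R a)"
  have ee: "e b \<bullet> a = (if b = a then 1 else 0)" if "b \<in> A" for b
    using e(1) that a(1) by (simp add: dual_basis_def)
  have yB: "y \<in> convex_cone hull B"
    unfolding y_def using s aB by (intro convex_cone_hull_mul hull_inc) auto
  have "z \<in> span A"
    unfolding z_def using uB(1) span_base[OF a(1)] by (intro span_scale span_diff)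
  moreover have "e b \<bullet> z \<ge> 0 \<and> (b \<notin> B \<longrightarrow> e b \<bullet> z = 0)" if "b \<in> A" for b
    using uB(2,3)[OF that] ee[OF that] aB by (auto simp: z_def inner_diff_right s_def)
  ultimately have zB: "z \<in> convex_cone hull B"
    unfolding cone_dual_basis[OF e(1) A(2)] by simp
  have "y \<in> \<rho>"
  proof (cases "y = z")
    case True
    have "z + y = 2 *\<^sub>R ?u" by (simp add: y_def z_def scaleR_diff_right)
    then have "2 *\<^sub>R ?u = 2 *\<^sub>R y" using True by (simp add: scaleR_2)
    then have "?u = y" by simp
    then show ?thesis using ur by simp
  next
    case False
    have "?u = midpoint y z" by (simp add: midpoint_def y_def z_def algebra_simps)
    then have "?u \<in> open_segment y z" using False by simp
    then show ?thesis using face_ofD[OF face _ yB zB ur] by simp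
  qed
  then have "(1 / (2 * s)) *\<^sub>R y \<in> \<rho>"
    using s by (subst r, subst (asm) r) (intro convex_cone_hull_mul, auto)
  then have "a \<in> \<rho>" using s by (simp add: y_def)
  then have "a \<in> \<rho> \<inter> lat X" using e(2) a(1) by blast
  then obtain k :: nat where k: "a = of_nat k *\<^sub>R ?u"
    using ray_lattice_points[OF A2] r by auto
  have "1 = of_nat k * s"
    using ee[OF a(1)] unfolding s_def by (metis inner_scaleR_right k)
  moreover have "s \<in> \<int>"
    using N[of ?u] uL a(1) by (auto simp: s_def)
  ultimately have "k = 1"
  proof -
    obtain i where i: "s = of_int i" using \<open>s \<in> \<int>\<close> by (auto elim: Ints_cases)
    then have "(1::int) = int k * i" using \<open>1 = of_nat k * s\<close> by (metis of_int_1 of_int_eq_iff of_int_mult of_int_of_nat_eq)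
    then have "int k dvd 1" by (metis dvd_triv_left)
    then show ?thesis by simp
  qed
  then show ?thesis using k aB by simp
qed

lemma basis_span: "lattice_basis (lat X) A \<Longrightarrow> span A = span (lat X)"
  using lattice_basis_dual by metis

lemma basis_card: "lattice_basis (lat X) A \<Longrightarrow> card A = dim (lat X) \<and> finite A \<and> independent A"
  using basis_span[of A] unfolding lattice_basis_def
  by (metis dim_eq_card_independent dim_span independent_imp_finite)

lemma nc_convex_cone: "convex_cone (nc p)"
proof -
  have "nc p = span (lat X) \<inter> (\<Inter>q\<in>V. {v. (q - p) \<bullet> v \<ge> 0})"
    by (auto simp: nc_def inner_diff_left)
  then show ?thesis
    unfolding convex_cone_iff by (auto simp: inner_add_right span_add span_scale span_zero)
qed

lemma u_in_lat: "\<rho> \<in> rays X \<Longrightarrow> u \<rho> \<in> lat X"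
  using rays_basis lattice_basis_dual by (metis subsetD)

lemma ray_subset_nc_iff:
  assumes "p \<in> verts" "lattice_basis (lat X) A" "nc p = convex_cone hull A" "\<rho> \<in> rays X"
  shows "\<rho> \<subseteq> nc p \<longleftrightarrow> u \<rho> \<in> A"
proof
  show "u \<rho> \<in> A" if "\<rho> \<subseteq> nc p"
    using ray_in_smooth_cone[OF assms(4,2) order_refl] nc_in_cones[OF assms(1)] assms(3) that by simp
  show "\<rho> \<subseteq> nc p" if "u \<rho> \<in> A"
    using rays_basis[OF assms(4)] that assms(3) hull_mono[of "{u \<rho>}" A convex_cone] by auto
qed

lemma ray_subset_nc_iff':
  assumes "p \<in> verts" "\<rho> \<in> rays X"
  shows "\<rho> \<subseteq> nc p \<longleftrightarrow> u \<rho> \<in> nc p"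
proof
  have "\<rho> = ray (u \<rho>)" using rays_basis[OF assms(2)] by metis
  then show "u \<rho> \<in> nc p \<Longrightarrow> \<rho> \<subseteq> nc p" "\<rho> \<subseteq> nc p \<Longrightarrow> u \<rho> \<in> nc p"
    using hull_minimal[of "{u \<rho>}" "nc p" convex_cone] nc_convex_cone[of p] hull_inc[of "u \<rho>" "{u \<rho>}" convex_cone]
    by auto
qed

text \<open>\<open>r - p\<close> is nonnegative on \<open>A\<close> and vanishes on \<open>y\<close>, whose coordinates are positive.\<close>

lemma vertex_unique:
  assumes p: "p \<in> verts" and A: "lattice_basis (lat X) A" "nc p = convex_cone hull A" "dual_basis A e"
    and r: "r \<in> verts" "y \<in> nc r" "\<And>b. b \<in> A \<Longrightarrow> e b \<bullet> y > 0"
  shows "r = p"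
proof -
  have yA: "y \<in> span A" using r(2) basis_span[OF A(1)] by (auto simp: nc_def)
  then have "y \<in> nc p"
    using r(3) by (simp add: A(2) cone_dual_basis[OF A(3) order_refl] less_imp_le)
  then have "p \<bullet> y = r \<bullet> y"
    using r(1,2) p verts_V by (auto simp: nc_def intro!: antisym)
  then have 0: "(\<Sum>b\<in>A. (e b \<bullet> y) * ((r - p) \<bullet> b)) = 0"
    using dual_basis_inner_expand[OF A(3) yA, of "r - p"] by (simp add: inner_diff_left)
  have nonneg: "(r - p) \<bullet> b \<ge> 0" if "b \<in> A" for b
  proof -
    have "b \<in> nc p" unfolding A(2) using that by (rule hull_inc)
    then show ?thesis using r(1) verts_V by (auto simp: nc_def inner_diff_left)
  qed
  have "(r - p) \<bullet> b = 0" if "b \<in> A" for b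
  proof -
    have "(e b \<bullet> y) * ((r - p) \<bullet> b) = 0"
      using 0 that nonneg r(3) basis_card[OF A(1)]
      by (subst (asm) sum_nonneg_eq_0_iff) (auto simp: less_imp_le)
    then show ?thesis using r(3)[OF that] by simp
  qed
  moreover have "r - p \<in> span A"
    using verts_span r(1) p basis_span[OF A(1)] by (simp add: span_diff)
  ultimately have "(r - p) \<bullet> (r - p) = 0"
    using dual_basis_inner_expand[OF A(3), of "r - p" "r - p"] by simp
  then show ?thesis by simp
qed

text \<open>The two lattice bases share A - {a}, so they differ in one vector. Expanding a in the
  basis B gives (e' c . a)(e a . c) = 1 with integer factors, hence the sign. The sign +1 puts c on
  the same side of the wall as a; then \<open>nc r\<close> contains an interior point of
  \<open>nc p\<close>, and \<open>vertex_unique\<close> applies.\<close>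

lemma adjacent_cone:
  assumes p: "p \<in> verts" and A: "lattice_basis (lat X) A" "nc p = convex_cone hull A" "dual_basis A e"
    and a: "a \<in> A" and int: "\<And>x. x \<in> lat X \<Longrightarrow> e a \<bullet> x \<in> \<int>"
    and r: "r \<in> verts" "lattice_basis (lat X) B" "nc r = convex_cone hull B"
    and sub: "convex_cone hull (A - {a}) \<subseteq> nc r"
  obtains c where "c \<notin> A - {a}" "B = insert c (A - {a})" "e a \<bullet> c = 1 \<or> e a \<bullet> c = - 1"
    "e a \<bullet> c = 1 \<Longrightarrow> r = p \<and> c = a"
proof -
  have fin: "finite A" "finite B" "card A = card B" using basis_card[OF A(1)] basis_card[OF r(2)] by auto
  have "b \<in> B" if b: "b \<in> A - {a}" for b
  proof -
    note br = basis_vector_ray[OF p A(1,2), of b]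
    have "ray b \<subseteq> nc r"
      using b sub hull_mono[of "{b}" "A - {a}" convex_cone] by blast
    then show ?thesis
      using ray_subset_nc_iff[OF r, of "ray b"] br b by auto
  qed
  then have sub': "A - {a} \<subseteq> B" by blast
  have "card (B - (A - {a})) = card B - card (A - {a})"
    by (rule card_Diff_subset) (use fin sub' in auto)
  moreover have "card (A - {a}) = card A - 1" "card A > 0"
    using fin a by (auto simp: card_gt_0_iff)
  ultimately have "card (B - (A - {a})) = 1" using fin(3) by simp
  then obtain c where c: "B - (A - {a}) = {c}" by (rule card_1_singletonE)
  then have B: "B = insert c (A - {a})" "c \<notin> A - {a}" using sub' by blast+
  obtain e' where e': "dual_basis B e'"
      "\<And>x. x \<in> lat X \<longleftrightarrow> x \<in> span B \<and> (\<forall>b\<in>B. e' b \<bullet> x \<in> \<int>)" "B \<subseteq> lat X"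
    using lattice_basis_dual[OF r(2)] by metis
  have spans: "span A = span B" using basis_span A(1) r(2) by auto
  have int_c: "e a \<bullet> c \<in> \<int>"
    using int e'(3) B(1) by blast
  have int': "e' c \<bullet> a \<in> \<int>"
    using e'(2)[of a] a B(1) lattice_basis_dual[OF A(1)] by (metis insertI1 subsetD)
  have "1 = e a \<bullet> a" using A(3) a by (simp add: dual_basis_def)
  also have "\<dots> = (\<Sum>y\<in>B. (e' y \<bullet> a) * (e a \<bullet> y))"
    using a spans by (intro dual_basis_inner_expand[OF e'(1)]) (metis span_base)
  also have "\<dots> = (e' c \<bullet> a) * (e a \<bullet> c) + (\<Sum>y\<in>A - {a}. (e' y \<bullet> a) * (e a \<bullet> y))"
    using B fin by simp
  also have "(\<Sum>y\<in>A - {a}. (e' y \<bullet> a) * (e a \<bullet> y)) = 0"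
    using A(3) a by (intro sum.neutral) (auto simp: dual_basis_def)
  finally have prod: "(e' c \<bullet> a) * (e a \<bullet> c) = 1" by simp
  obtain i j where ij: "e' c \<bullet> a = of_int i" "e a \<bullet> c = of_int j"
    using int_c int' by (auto elim!: Ints_cases)
  then have "i * j = 1"
    using prod by (metis of_int_1 of_int_eq_iff of_int_mult)
  then have s: "e a \<bullet> c = 1 \<or> e a \<bullet> c = - 1"
    using ij(2) by (auto simp: zmult_eq_1_iff)
  moreover have "r = p \<and> c = a" if c1: "e a \<bullet> c = 1"
  proof -
    \<comment> \<open>The coefficients exceed |e b . c|, so every coordinate of x0 + c is positive;
      the one at a is e a . c = 1.\<close>
    define x0 where "x0 = (\<Sum>b\<in>A - {a}. (\<bar>e b \<bullet> c\<bar> + 1) *\<^sub>R b)"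
    have "x0 \<in> convex_cone hull (A - {a})"
      unfolding x0_def using fin by (intro convex_cone_hull_sum) auto
    then have x0: "x0 \<in> nc r" using sub by blast
    have "c \<in> nc r" unfolding r(3) using B(1) by (intro hull_inc) auto
    then have y: "x0 + c \<in> nc r"
      using x0 nc_convex_cone[of r] by (simp add: convex_cone_add)
    have ex0: "e b \<bullet> x0 = (if b = a then 0 else \<bar>e b \<bullet> c\<bar> + 1)" if "b \<in> A" for b
    proof -
      have "e b \<bullet> x0 = (\<Sum>y\<in>A - {a}. if b = y then \<bar>e b \<bullet> c\<bar> + 1 else 0)"
        unfolding x0_def inner_sum_right using A(3) that
        by (intro sum.cong) (auto simp: dual_basis_def)
      then show ?thesis using that fin by (simp add: sum.delta')
    qed
    have "r = p"
    proof (rule vertex_unique[OF p A r(1) y])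
      show "0 < e b \<bullet> (x0 + c)" if "b \<in> A" for b
        using ex0[OF that] c1 by (auto simp: inner_add_right)
    qed
    moreover have "c \<in> A"
    proof -
      have "c \<in> B" using B(1) by blast
      note cr = basis_vector_ray[OF r(1) r(2,3) this]
      have "ray c \<subseteq> nc p"
        using \<open>r = p\<close> r(3) \<open>c \<in> B\<close> hull_mono[of "{c}" B convex_cone] by simp
      then show ?thesis
        using ray_subset_nc_iff[OF p A(1,2) cr(1)] cr(2) by simp
    qed
    ultimately show ?thesis using B(2) by blast
  qed
  ultimately show ?thesis using that B by blast
qed

text \<open>The pivot of the simplex algorithm: q is the other end of the edge of the polytope that
  is dual to the wall A - {a}.\<close>

lemma neighbour:
  assumes p: "p \<in> verts" and A: "lattice_basis (lat X) A" "nc p = convex_cone hull A" "dual_basis A e"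
    and a: "a \<in> A" and int: "\<And>x. x \<in> lat X \<Longrightarrow> e a \<bullet> x \<in> \<int>"
  obtains q a' where "q \<in> verts" "lattice_basis (lat X) (insert a' (A - {a}))"
    "nc q = convex_cone hull (insert a' (A - {a}))" "a' \<notin> A" "e a \<bullet> a' = - 1"
    "p \<bullet> a < q \<bullet> a" "\<And>b. b \<in> A - {a} \<Longrightarrow> q \<bullet> b = p \<bullet> b"
    "\<And>r B. r \<in> verts \<Longrightarrow> lattice_basis (lat X) B \<Longrightarrow> nc r = convex_cone hull B \<Longrightarrow>
       convex_cone hull (A - {a}) \<subseteq> nc r \<Longrightarrow> B = A \<or> B = insert a' (A - {a})"
proof -
  have fin: "finite A" using basis_card[OF A(1)] by simp
  let ?P = "convex hull V"
  \<comment> \<open>A point in the relative interior of the wall; the face F on which it is minimal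
    is the edge dual to the wall.\<close>
  define x0 where "x0 = (\<Sum>b\<in>A - {a}. 1 *\<^sub>R b)"
  have x0A: "x0 \<in> convex_cone hull (A - {a})"
    unfolding x0_def using fin by (intro convex_cone_hull_sum) auto
  then have x0: "x0 \<in> nc p"
    unfolding A(2) using hull_mono[of "A - {a}" A convex_cone] by blast
  define F where "F = ?P \<inter> {y. x0 \<bullet> y = x0 \<bullet> p}"
  have F: "F face_of ?P"
    unfolding F_def using x0 nc_hull[of x0 p]
    by (intro face_of_Int_supporting_hyperplane_ge) (auto simp: inner_commute)
  have "compact F" "convex F"
    using face_of_imp_compact[OF _ _ F] V(1) face_of_imp_convex[OF F]
    by (auto simp: finite_imp_compact_convex_hull)
  have pP: "p \<in> ?P" using p verts_V hull_subset[of V convex] by blast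
  have pF: "p \<in> F" using pP by (simp add: F_def)
  \<comment> \<open>If p were the only vertex of F, then x0 could be moved slightly across the wall
    without leaving \<open>nc p\<close>, although its coordinate at a would become negative.\<close>
  have "\<exists>q. q extreme_point_of F \<and> q \<noteq> p"
  proof (rule ccontr)
    assume "\<not> ?thesis"
    then have "{q. q extreme_point_of F} \<subseteq> {p}" by blast
    then have "F \<subseteq> convex hull {p}"
      using Krein_Milman_Minkowski[OF \<open>compact F\<close> \<open>convex F\<close>] hull_mono by metis
    then have Fp: "F \<subseteq> {p}" by simp
    have "p \<bullet> x0 < q \<bullet> x0" if "q \<in> V" "q \<noteq> p" for q
    proof -
      have "q \<in> ?P" "q \<notin> F" using that Fp hull_subset[of V convex] by blast+
      then have "q \<bullet> x0 \<noteq> p \<bullet> x0" by (simp add: F_def inner_commute)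
      moreover have "p \<bullet> x0 \<le> q \<bullet> x0" using x0 that by (simp add: nc_def)
      ultimately show ?thesis by simp
    qed
    then obtain \<epsilon> where \<epsilon>: "\<epsilon> > 0" "\<And>q. q \<in> V \<Longrightarrow> p \<bullet> (x0 - \<epsilon> *\<^sub>R a) \<le> q \<bullet> (x0 - \<epsilon> *\<^sub>R a)"
      using finite_perturbation[OF V(1)] by metis
    have "x0 - \<epsilon> *\<^sub>R a \<in> nc p"
      using \<epsilon>(2) x0 a basis_span[OF A(1)] by (auto simp: nc_def intro!: span_diff span_scale) (metis span_base)
    then have "e a \<bullet> (x0 - \<epsilon> *\<^sub>R a) \<ge> 0"
      using a by (simp add: A(2) cone_dual_basis[OF A(3) order_refl])
    moreover have "e a \<bullet> x0 = 0"
      using x0A a by (simp add: cone_dual_basis[OF A(3) Diff_subset])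
    moreover have "e a \<bullet> a = 1" using A(3) a by (simp add: dual_basis_def)
    ultimately show False using \<epsilon>(1) by (simp add: inner_diff_right)
  qed
  then obtain q where q: "q extreme_point_of F" "q \<noteq> p" by blast
  then have qF: "q \<in> F" and qv: "q \<in> verts"
    using extreme_point_of_face[OF F, of q] by (auto simp: verts_def)
  have nonneg: "(q - p) \<bullet> b \<ge> 0" if "b \<in> A" for b
  proof -
    have "b \<in> nc p" unfolding A(2) using that by (rule hull_inc)
    then show ?thesis using qv verts_V by (auto simp: nc_def inner_diff_left)
  qed
  have "(q - p) \<bullet> x0 = 0" using qF by (simp add: F_def inner_diff_left inner_commute[of x0])
  then have "(\<Sum>b\<in>A - {a}. (q - p) \<bullet> b) = 0" by (simp add: x0_def inner_sum_right)
  then have eq: "q \<bullet> b = p \<bullet> b" if "b \<in> A - {a}" for b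
    using that nonneg fin by (subst (asm) sum_nonneg_eq_0_iff) (auto simp: inner_diff_left)
  have sub: "convex_cone hull (A - {a}) \<subseteq> nc q"
  proof (rule hull_minimal)
    show "A - {a} \<subseteq> nc q"
    proof
      fix b assume b: "b \<in> A - {a}"
      have "b \<in> nc p" unfolding A(2) using b by (intro hull_inc) auto
      then show "b \<in> nc q" using eq[OF b] by (simp add: nc_def)
    qed
  qed (rule nc_convex_cone)
  have gt: "p \<bullet> a < q \<bullet> a"
  proof (rule ccontr)
    assume "\<not> ?thesis"
    then have "(q - p) \<bullet> a = 0" using nonneg[OF a] by (simp add: inner_diff_left)
    then have "(q - p) \<bullet> b = 0" if "b \<in> A" for b
      using eq[of b] that by (cases "b = a") (auto simp: inner_diff_left)
    moreover have "q - p \<in> span A"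
      using verts_span qv p basis_span[OF A(1)] by (simp add: span_diff)
    ultimately have "(q - p) \<bullet> (q - p) = 0"
      using dual_basis_inner_expand[OF A(3), of "q - p" "q - p"] by simp
    then show False using q(2) by simp
  qed
  obtain B where B: "lattice_basis (lat X) B" "nc q = convex_cone hull B"
    using vertex_basis[OF qv] .
  obtain a' where a': "a' \<notin> A - {a}" "B = insert a' (A - {a})" "e a \<bullet> a' = 1 \<or> e a \<bullet> a' = - 1"
    "e a \<bullet> a' = 1 \<Longrightarrow> q = p \<and> a' = a"
    using adjacent_cone[OF p A a int qv B sub] by blast
  then have s: "e a \<bullet> a' = - 1" using q(2) by blast
  have "e a \<bullet> a = 1" using A(3) a by (simp add: dual_basis_def)
  then have "a' \<noteq> a" using s by auto
  then have na: "a' \<notin> A" using a'(1) by blast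
  obtain e' where e': "dual_basis B e'" and int': "\<And>x. x \<in> lat X \<Longrightarrow> \<forall>b\<in>B. e' b \<bullet> x \<in> \<int>"
    using lattice_basis_dual[OF B(1)] by metis
  have a'B: "a' \<in> B" "B - {a'} = A - {a}" using a'(1,2) by auto
  \<comment> \<open>Seen from q, the coordinate across the wall changes sign: e a vanishes on A -
    {a} and is -1 at a'.\<close>
  have inner_a': "e' a' \<bullet> x = - (e a \<bullet> x)" if "x \<in> span A" for x
  proof -
    have "e a \<bullet> x = (\<Sum>y\<in>B. (e' y \<bullet> x) * (e a \<bullet> y))"
      using that basis_span[OF A(1)] basis_span[OF B(1)] by (intro dual_basis_inner_expand[OF e']) simp
    also have "\<dots> = (e' a' \<bullet> x) * (e a \<bullet> a') + (\<Sum>y\<in>A - {a}. (e' y \<bullet> x) * (e a \<bullet> y))"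
      using a'(1,2) fin by simp
    also have "(\<Sum>y\<in>A - {a}. (e' y \<bullet> x) * (e a \<bullet> y)) = 0"
      using A(3) a by (intro sum.neutral) (auto simp: dual_basis_def)
    finally show ?thesis using s by simp
  qed
  \<comment> \<open>A cone through the wall is on the side of p, where \<open>adjacent_cone\<close>
    identifies its basis with A, or on the other side, where the same criterion applied from q
    identifies it with that of q.\<close>
  have uniq: "B' = A \<or> B' = insert a' (A - {a})"
    if r: "r \<in> verts" "lattice_basis (lat X) B'" "nc r = convex_cone hull B'"
      "convex_cone hull (A - {a}) \<subseteq> nc r" for r B'
  proof -
    obtain c where c: "B' = insert c (A - {a})" "e a \<bullet> c = 1 \<or> e a \<bullet> c = - 1"
      "e a \<bullet> c = 1 \<Longrightarrow> r = p \<and> c = a"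
      using adjacent_cone[OF p A a int r] by blast
    show ?thesis
    proof (cases "e a \<bullet> c = 1")
      case True
      then show ?thesis using c a by auto
    next
      case False
      obtain c' where c': "c' \<notin> B - {a'}" "B' = insert c' (B - {a'})"
          "e' a' \<bullet> c' = 1 \<Longrightarrow> r = q \<and> c' = a'"
        using adjacent_cone[OF qv B e' a'B(1) _ r(1-3)] r(4) a'B int' by metis
      have "e a \<bullet> b = (if a = b then 1 else 0)" if "b \<in> A" for b
        using A(3) a that by (simp add: dual_basis_def)
      from this[of c] have "c \<in> A \<Longrightarrow> c = a"
        using c(2) by (auto split: if_splits)
      then have "c \<notin> A - {a}" by blast
      then have "c' = c" using c(1) c'(1,2) a'B(2) by auto
      moreover have "c \<in> span A" using c(1) basis_span[OF A(1)] basis_span[OF r(2)] by (metis insertI1 span_base)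
      ultimately have "c = a'" using c'(3) inner_a' c(2) False by simp
      then show ?thesis using c(1) by blast
    qed
  qed
  show ?thesis
    using that[OF qv B(1)[unfolded a'(2)] B(2)[unfolded a'(2)] na s gt eq] uniq by blast
qed

end

section \<open>Divisor classes\<close>

context smooth_projective_fan
begin

abbreviation FR :: "'v divisor monoid" where
  "FR \<equiv> free_Abelian_group (rays X)"

abbreviation K :: "'v divisor set" where
  "K \<equiv> principal_divisor X ` dual_lattice X"

lemma finite_rays: "finite (rays X)"
  using fan by (auto simp: is_fan_def rays_def)

lemma dual_int: "m \<in> dual_lattice X \<Longrightarrow> \<rho> \<in> rays X \<Longrightarrow> m \<bullet> u \<rho> \<in> \<int>"
  using u_in_lat by (auto simp: dual_lattice_def)

lemma lookup_principal:
  "lookup (principal_divisor X m) \<rho> = (if \<rho> \<in> rays X then \<lfloor>m \<bullet> u \<rho>\<rfloor> else 0)"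
  using finite_rays by (simp add: principal_divisor_def lookup_sum lookup_single when_def)

lemma of_int_lookup_principal:
  "m \<in> dual_lattice X \<Longrightarrow> \<rho> \<in> rays X \<Longrightarrow>
    real_of_int (lookup (principal_divisor X m) \<rho>) = m \<bullet> u \<rho>"
  using dual_int by (auto simp: lookup_principal)

lemma keys_principal: "keys (principal_divisor X m) \<subseteq> rays X"
  by (auto simp: in_keys_iff lookup_principal split: if_splits)

lemma dual_lattice_closed:
  "0 \<in> dual_lattice X" "m \<in> dual_lattice X \<Longrightarrow> - m \<in> dual_lattice X"
  "m \<in> dual_lattice X \<Longrightarrow> n \<in> dual_lattice X \<Longrightarrow> m + n \<in> dual_lattice X"
  by (auto simp: dual_lattice_def span_zero span_neg span_add inner_add_left)

lemma principal_add:
  assumes "m \<in> dual_lattice X" "n \<in> dual_lattice X"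
  shows "principal_divisor X (m + n) = principal_divisor X m + principal_divisor X n"
proof (rule poly_mapping_eqI)
  fix \<rho>
  show "lookup (principal_divisor X (m + n)) \<rho> =
      lookup (principal_divisor X m + principal_divisor X n) \<rho>"
  proof (cases "\<rho> \<in> rays X")
    case True
    then have "real_of_int (lookup (principal_divisor X (m + n)) \<rho>) =
      real_of_int (lookup (principal_divisor X m + principal_divisor X n) \<rho>)"
      using assms by (simp add: lookup_add of_int_lookup_principal dual_lattice_closed inner_add_left)
    then show ?thesis by linarith
  qed (simp add: lookup_add lookup_principal)
qed

lemma principal_zero: "principal_divisor X 0 = 0"
  using principal_add[of 0 0] by (simp add: dual_lattice_closed)

lemma principal_uminus:
  "m \<in> dual_lattice X \<Longrightarrow> principal_divisor X (- m) = - principal_divisor X m"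
  using principal_add[of m "- m"] principal_zero
  by (simp add: dual_lattice_closed eq_neg_iff_add_eq_0 add.commute)

lemma subgroup_principal: "subgroup K FR"
proof -
  interpret FR: comm_group FR by (rule abelian_free_Abelian_group)
  show ?thesis
  proof (rule FR.subgroupI)
    show "K \<subseteq> carrier FR" using keys_principal by auto
    show "K \<noteq> {}" using dual_lattice_closed(1) by blast
    show "inv\<^bsub>FR\<^esub> a \<in> K" if "a \<in> K" for a
      using that keys_principal dual_lattice_closed(2) by (auto simp: principal_uminus[symmetric])
    show "a \<otimes>\<^bsub>FR\<^esub> b \<in> K" if "a \<in> K" "b \<in> K" for a b
      using that dual_lattice_closed(3) by (auto simp: principal_add[symmetric])
  qed
qed

lemma normal_principal: "K \<lhd> FR"
  using comm_group.subgroup_imp_normal[OF abelian_free_Abelian_group subgroup_principal] .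

lemma comm_group_Pic: "comm_group (Pic X)"
  unfolding Pic_def using comm_group.abelian_FactGroup[OF abelian_free_Abelian_group subgroup_principal] .

lemma carrier_Pic: "carrier (Pic X) = div_class X ` {D. keys D \<subseteq> rays X}"
proof -
  have "carrier FR = {D. keys D \<subseteq> rays X}" by auto
  then show ?thesis by (simp add: Pic_def carrier_FactGroup div_class_def[abs_def])
qed

lemma div_class_closed: "keys D \<subseteq> rays X \<Longrightarrow> div_class X D \<in> carrier (Pic X)"
  by (auto simp: carrier_Pic)

lemma div_class_add:
  "keys D \<subseteq> rays X \<Longrightarrow> keys E \<subseteq> rays X \<Longrightarrow>
    div_class X (D + E) = div_class X D \<otimes>\<^bsub>Pic X\<^esub> div_class X E"
  using normal.rcos_sum[OF normal_principal, of D E] by (simp add: Pic_def div_class_def)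

lemma div_class_add_principal:
  assumes "keys D \<subseteq> rays X" "m \<in> dual_lattice X"
  shows "div_class X (D + principal_divisor X m) = div_class X D"
proof -
  have "div_class X (principal_divisor X m) = \<one>\<^bsub>Pic X\<^esub>"
    using group.coset_join2[OF _ _ subgroup_principal, of "principal_divisor X m"] assms(2) keys_principal
    by (simp add: div_class_def Pic_def)
  then show ?thesis
    using assms keys_principal comm_group_Pic
    by (simp add: div_class_add div_class_closed comm_group.axioms(2) group.is_monoid)
qed

lemma lookup_map_int: "lookup (Poly_Mapping.map int t) \<rho> = int (lookup t \<rho>)"
  by (simp add: Poly_Mapping.map.rep_eq when_def)

lemma keys_map_int: "keys (Poly_Mapping.map int t) = keys t"
  by (auto simp: in_keys_iff lookup_map_int)

lemma mdeg_closed: "keys t \<subseteq> rays X \<Longrightarrow> mdeg X t \<in> carrier (Pic X)"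
  by (simp add: mdeg_def div_class_closed keys_map_int)

lemma mdeg_add:
  assumes "keys s \<subseteq> rays X" "keys t \<subseteq> rays X"
  shows "mdeg X (s + t) = mdeg X s \<otimes>\<^bsub>Pic X\<^esub> mdeg X t"
proof -
  have "Poly_Mapping.map int (s + t) = Poly_Mapping.map int s + Poly_Mapping.map int t"
    by (rule poly_mapping_eqI) (simp add: lookup_map_int lookup_add)
  then show ?thesis
    using assms by (simp add: mdeg_def div_class_add keys_map_int)
qed

section \<open>Monomial sections of nef and ample classes\<close>

lemma effective_monomial:
  assumes "keys D \<subseteq> S" "\<And>\<rho>. lookup D \<rho> \<ge> 0"
  obtains t where "keys t \<subseteq> S" "mdeg X t = div_class X D"
proof -
  define t where "t = Poly_Mapping.map nat D"
  have t: "lookup t \<rho> = nat (lookup D \<rho>)" for \<rho>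
    by (simp add: t_def Poly_Mapping.map.rep_eq when_def)
  have "Poly_Mapping.map int t = D"
    using assms(2) by (intro poly_mapping_eqI) (simp add: lookup_map_int t)
  moreover have "keys t \<subseteq> S"
    using assms(1) by (auto simp: in_keys_iff t)
  ultimately show ?thesis using that by (simp add: mdeg_def)
qed

text \<open>The ray generators of \<open>nc p\<close> form a lattice basis, so a character with any
  prescribed integer values on them exists. This is the Cartier data of D: adding the divisor of m
  removes from D all rays of the cone.\<close>

lemma local_equation:
  assumes p: "p \<in> verts"
  shows "\<exists>m\<in>dual_lattice X. \<forall>\<rho>\<in>rays X. \<rho> \<subseteq> nc p \<longrightarrow> m \<bullet> u \<rho> = - real_of_int (lookup D \<rho>)"
proof -
  obtain A where A: "lattice_basis (lat X) A" "nc p = convex_cone hull A"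
    using vertex_basis[OF p] .
  obtain e where e: "dual_basis A e" "span (lat X) = span A"
    and N: "\<And>x. x \<in> lat X \<longleftrightarrow> x \<in> span A \<and> (\<forall>a\<in>A. e a \<bullet> x \<in> \<int>)"
    using lattice_basis_dual[OF A(1)] by metis
  define f where "f a = lookup D (ray a)" for a
  define m where "m = (\<Sum>a\<in>A. (- of_int (f a)) *\<^sub>R e a)"
  have "m \<in> span (lat X)"
    unfolding m_def e(2) using e(1) by (intro span_sum span_scale) (auto simp: dual_basis_def)
  moreover have "m \<bullet> v \<in> \<int>" if "v \<in> lat X" for v
    unfolding m_def inner_sum_left using N[of v] that by (intro Ints_sum) auto
  ultimately have "m \<in> dual_lattice X" by (simp add: dual_lattice_def)
  moreover have "m \<bullet> u \<rho> = - real_of_int (lookup D \<rho>)" if \<rho>: "\<rho> \<in> rays X" "\<rho> \<subseteq> nc p" for \<rho>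
  proof -
    have uA: "u \<rho> \<in> A" using ray_subset_nc_iff[OF p A \<rho>(1)] \<rho>(2) by simp
    have r: "\<rho> = ray (u \<rho>)" using rays_basis[OF \<rho>(1)] by metis
    have "m \<bullet> u \<rho> = (\<Sum>a\<in>A. if a = u \<rho> then - of_int (f a) else 0)"
      unfolding m_def inner_sum_left using e(1) uA by (intro sum.cong) (auto simp: dual_basis_def)
    also have "\<dots> = - of_int (f (u \<rho>))" using uA e(1) by (simp add: dual_basis_def)
    finally show ?thesis unfolding f_def using r by simp
  qed
  ultimately show ?thesis by blast
qed

text \<open>
  The left-hand side of the conclusion is the intersection number of \<open>D\<close> with the curve of the wall
  spanned by \<open>A - {a}\<close>, which separates the cones of \<open>p\<close> and \<open>q\<close>.
\<close>

lemma nef_adjacent: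
  assumes nef: "nef_divisor X D" and p: "p \<in> verts"
    and A: "lattice_basis (lat X) A" "nc p = convex_cone hull A" "dual_basis A e"
    and int: "\<And>x. x \<in> lat X \<Longrightarrow> \<forall>b\<in>A. e b \<bullet> x \<in> \<int>"
    and a: "a \<in> A" and q: "q \<in> verts" "lattice_basis (lat X) (insert a' (A - {a}))"
    "nc q = convex_cone hull (insert a' (A - {a}))" "a' \<notin> A" "e a \<bullet> a' = - 1"
    and uniq: "\<And>r B. r \<in> verts \<Longrightarrow> lattice_basis (lat X) B \<Longrightarrow> nc r = convex_cone hull B \<Longrightarrow>
       convex_cone hull (A - {a}) \<subseteq> nc r \<Longrightarrow> B = A \<or> B = insert a' (A - {a})"
    and m: "\<And>\<rho>. \<rho> \<in> rays X \<Longrightarrow> \<rho> \<subseteq> nc p \<Longrightarrow> m \<bullet> u \<rho> = - real_of_int (lookup D \<rho>)"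
  shows "m \<bullet> a' + real_of_int (lookup D (ray a')) \<ge> 0"
proof -
  have fin: "finite A" and ind: "independent A" using basis_card[OF A(1)] by auto
  let ?\<tau> = "convex_cone hull (A - {a})"
  have a'lat: "a' \<in> lat X" using lattice_basis_dual[OF q(2)] by (metis insertI1 subsetD)
  have a'A: "a' \<in> span A" using a'lat basis_span[OF A(1)] by (simp add: span_base)
  have rA: "ray b \<in> rays X" "u (ray b) = b" if "b \<in> insert a' A" for b
    using basis_vector_ray[OF p A(1,2), of b] basis_vector_ray[OF q(1-3), of b] that by auto
  have ru: "\<rho> = ray (u \<rho>)" if "\<rho> \<in> rays X" for \<rho> using rays_basis[OF that] by metis
  have rne: "a' \<noteq> a" using a q(4) by blast
  \<comment> \<open>The coefficients of the wall relation, which expresses a + a' through A - {a},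
    moved to one side. The coordinates e b . a' are integers, so the floor only changes the
    type.\<close>
  define \<beta> where "\<beta> \<rho> = (if u \<rho> = a \<or> u \<rho> = a' then 1 else if u \<rho> \<in> A then - \<lfloor>e (u \<rho>) \<bullet> a'\<rfloor> else 0)" for \<rho>
  \<comment> \<open>Stated for an arbitrary h because it is used twice: the identity gives the wall
    relation, and the coefficients of D give the intersection number.\<close>
  have total: "(\<Sum>\<rho>\<in>rays X. of_int (\<beta> \<rho>) *\<^sub>R h (u \<rho>)) =
      h a' + h a - (\<Sum>b\<in>A - {a}. (e b \<bullet> a') *\<^sub>R h b)" for h :: "'v \<Rightarrow> 'w::real_vector"
  proof -
    let ?R = "(\<lambda>b. ray b) ` insert a' A"
    have inj: "inj_on (\<lambda>b. ray b) (insert a' A)"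
      by (rule inj_on_inverseI[where g = u]) (rule rA(2))
    have "(\<Sum>\<rho>\<in>rays X. of_int (\<beta> \<rho>) *\<^sub>R h (u \<rho>)) = (\<Sum>\<rho>\<in>?R. of_int (\<beta> \<rho>) *\<^sub>R h (u \<rho>))"
    proof (rule sum.mono_neutral_right[OF finite_rays])
      show "?R \<subseteq> rays X" using rA(1) by auto
      show "\<forall>\<rho>\<in>rays X - ?R. of_int (\<beta> \<rho>) *\<^sub>R h (u \<rho>) = 0"
      proof
        fix \<rho> assume "\<rho> \<in> rays X - ?R"
        then have "u \<rho> \<notin> insert a' A" using ru[of \<rho>] by blast
        then show "of_int (\<beta> \<rho>) *\<^sub>R h (u \<rho>) = 0" using a by (auto simp: \<beta>_def)
      qed
    qed
    also have "\<dots> = (\<Sum>b\<in>insert a' A. of_int (\<beta> (ray b)) *\<^sub>R h b)"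
      unfolding sum.reindex[OF inj] using rA(2) by (intro sum.cong) auto
    also have "\<dots> = h a' + (\<Sum>b\<in>A. of_int (\<beta> (ray b)) *\<^sub>R h b)"
      using fin q(4) rA(2)[of a'] by (simp add: \<beta>_def)
    also have "(\<Sum>b\<in>A. of_int (\<beta> (ray b)) *\<^sub>R h b) =
        h a + (\<Sum>b\<in>A - {a}. of_int (\<beta> (ray b)) *\<^sub>R h b)"
      using fin a rA(2)[of a] by (subst sum.remove[of A a]) (auto simp: \<beta>_def)
    also have "(\<Sum>b\<in>A - {a}. of_int (\<beta> (ray b)) *\<^sub>R h b) =
        - (\<Sum>b\<in>A - {a}. (e b \<bullet> a') *\<^sub>R h b)"
      unfolding sum_negf[symmetric]
    proof (rule sum.cong[OF refl])
      fix b assume b: "b \<in> A - {a}"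
      have "e b \<bullet> a' \<in> \<int>" using int[OF a'lat] b by blast
      then have "of_int (\<beta> (ray b)) = - (e b \<bullet> a')"
        using b rA(2)[of b] q(4) by (auto simp: \<beta>_def)
      then show "of_int (\<beta> (ray b)) *\<^sub>R h b = - ((e b \<bullet> a') *\<^sub>R h b)" by simp
    qed
    finally show ?thesis by simp
  qed
  have "a' = (\<Sum>b\<in>A. (e b \<bullet> a') *\<^sub>R b)"
    using dual_basis_expand[OF A(3) a'A] .
  also have "\<dots> = - a + (\<Sum>b\<in>A - {a}. (e b \<bullet> a') *\<^sub>R b)"
    using fin a q(5) by (simp add: sum.remove)
  finally have wall: "a' + a = (\<Sum>b\<in>A - {a}. (e b \<bullet> a') *\<^sub>R b)" by (simp add: algebra_simps)
  have \<tau>_cone: "?\<tau> \<in> cones X"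
    using cone_of_basis_vector[OF p A(1,2), of "A - {a}"] by blast
  have "dim ?\<tau> = card A - 1"
    using dim_cone[of "A - {a}"] independent_mono[OF ind, of "A - {a}"] fin a by simp
  moreover have "card A > 0" using fin a by (auto simp: card_gt_0_iff)
  ultimately have "dim ?\<tau> + 1 = dim (lat X)" using basis_card[OF A(1)] by simp
  then have "?\<tau> \<in> walls X"
    using \<tau>_cone by (simp add: walls_def)
  moreover have "intersection_numbers X ?\<tau> \<beta>"
    unfolding intersection_numbers_def
  proof (intro conjI ballI impI)
    show "(\<Sum>\<rho>\<in>rays X. real_of_int (\<beta> \<rho>) *\<^sub>R u \<rho>) = 0"
      using total[of "\<lambda>x. x"] wall by (simp add: algebra_simps)
    fix \<rho> assume \<rho>: "\<rho> \<in> rays X" "\<not> \<rho> \<subseteq> ?\<tau>"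
    have not: "u \<rho> \<notin> A - {a}"
      using \<rho> ru[OF \<rho>(1)] hull_mono[of "{u \<rho>}" "A - {a}" convex_cone] by auto
    have sub_p: "?\<tau> \<subseteq> nc p" and sub_q: "?\<tau> \<subseteq> nc q"
      unfolding A(2) q(3) by (intro hull_mono; blast)+
    show "\<beta> \<rho> = (if \<exists>\<sigma>\<in>cones X. \<rho> \<subseteq> \<sigma> \<and> ?\<tau> \<subseteq> \<sigma> then 1 else 0)"
    proof (cases "u \<rho> = a \<or> u \<rho> = a'")
      case True
      then have "\<rho> \<subseteq> nc p \<or> \<rho> \<subseteq> nc q"
        using ray_subset_nc_iff[OF p A(1,2) \<rho>(1)] ray_subset_nc_iff[OF q(1-3) \<rho>(1)] a by auto
      then have "\<exists>\<sigma>\<in>cones X. \<rho> \<subseteq> \<sigma> \<and> ?\<tau> \<subseteq> \<sigma>"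
        using sub_p sub_q nc_in_cones p q(1) by blast
      then show ?thesis using True by (simp add: \<beta>_def)
    next
      case False
      \<comment> \<open>A cone containing \<rho> and the wall lies in a maximal cone through the
        wall. By \<open>uniq\<close> that is generated by one of the two known bases, neither of
        which contains u \<rho>.\<close>
      have "\<not> (\<exists>\<sigma>\<in>cones X. \<rho> \<subseteq> \<sigma> \<and> ?\<tau> \<subseteq> \<sigma>)"
      proof
        assume "\<exists>\<sigma>\<in>cones X. \<rho> \<subseteq> \<sigma> \<and> ?\<tau> \<subseteq> \<sigma>"
        then obtain \<sigma> where \<sigma>: "\<sigma> \<in> cones X" "\<rho> \<subseteq> \<sigma>" "?\<tau> \<subseteq> \<sigma>" by blast
        obtain r where r: "r \<in> verts" "\<sigma> \<subseteq> nc r" using cone_subset_nc[OF \<sigma>(1)] .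
        obtain B where B: "lattice_basis (lat X) B" "nc r = convex_cone hull B" using vertex_basis[OF r(1)] .
        have "u \<rho> \<in> B" using ray_subset_nc_iff[OF r(1) B \<rho>(1)] \<sigma> r(2) by blast
        moreover have "B = A \<or> B = insert a' (A - {a})"
          using uniq[OF r(1) B] \<sigma>(3) r(2) by blast
        ultimately show False using False not by auto
      qed
      then show ?thesis using False not by (auto simp: \<beta>_def)
    qed
  qed
  ultimately have "(\<Sum>\<rho>\<in>rays X. lookup D \<rho> * \<beta> \<rho>) \<ge> 0"
    using nef by (simp add: nef_divisor_def)
  then have "0 \<le> real_of_int (\<Sum>\<rho>\<in>rays X. lookup D \<rho> * \<beta> \<rho>)" by (simp only: of_int_0_le_iff)
  also have "\<dots> = (\<Sum>\<rho>\<in>rays X. of_int (\<beta> \<rho>) *\<^sub>R real_of_int (lookup D (ray (u \<rho>))))"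
    using ru by (simp add: mult.commute cong: sum.cong)
  also have "\<dots> = real_of_int (lookup D (ray a')) +
      real_of_int (lookup D (ray a)) -
      (\<Sum>b\<in>A - {a}. (e b \<bullet> a') * real_of_int (lookup D (ray b)))"
    using total[of "\<lambda>b. real_of_int (lookup D (ray b))"] by simp
  \<comment> \<open>On the rays of \<open>nc p\<close> the coefficients of D are the values of -m,
    so the wall relation collapses the intersection number to the coefficient of D at a' plus m .
    a'.\<close>
  also have "(\<Sum>b\<in>A - {a}. (e b \<bullet> a') * real_of_int (lookup D (ray b))) =
      (\<Sum>b\<in>A - {a}. (e b \<bullet> a') * - (m \<bullet> b))"
  proof (rule sum.cong[OF refl])
    fix b assume b: "b \<in> A - {a}"
    have "ray b \<subseteq> nc p" unfolding A(2) using b by (intro hull_mono) auto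
    then show "(e b \<bullet> a') * real_of_int (lookup D (ray b)) = (e b \<bullet> a') * - (m \<bullet> b)"
      using m[of "ray b"] rA[of b] b by simp
  qed
  also have "\<dots> = - (m \<bullet> (a' + a))"
    unfolding wall by (simp add: inner_sum_right sum_negf)
  also have "real_of_int (lookup D (ray a)) = - (m \<bullet> a)"
  proof -
    have "ray a \<subseteq> nc p" unfolding A(2) using a by (intro hull_mono) auto
    then show ?thesis using m[of "ray a"] rA[of a] a by simp
  qed
  finally show ?thesis by (simp add: inner_add_right)
qed

text \<open>
  The simplex algorithm: unless \<open>\<rho>\<close> lies in the cone of \<open>p\<close>, there is a neighbouring vertex at which
  the linear functional \<open>u \<rho>\<close> is smaller, and the local equation of \<open>D\<close> does not increase
  along this step.
\<close>

lemma nef_local_equation: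
  assumes nef: "nef_divisor X D" and \<rho>: "\<rho> \<in> rays X" and p: "p \<in> verts"
    and m: "\<And>\<rho>. \<rho> \<in> rays X \<Longrightarrow> \<rho> \<subseteq> nc p \<Longrightarrow> m \<bullet> u \<rho> = - real_of_int (lookup D \<rho>)"
  shows "m \<bullet> u \<rho> + real_of_int (lookup D \<rho>) \<ge> 0"
  using p m
proof (induction "card {q \<in> verts. q \<bullet> u \<rho> < p \<bullet> u \<rho>}" arbitrary: p m rule: less_induct)
  case less
  note p = less.prems(1) and m = less.prems(2)
  obtain A where A: "lattice_basis (lat X) A" "nc p = convex_cone hull A"
    using vertex_basis[OF p] .
  obtain e where e: "dual_basis A e" "span (lat X) = span A"
    and N: "\<And>x. x \<in> lat X \<longleftrightarrow> x \<in> span A \<and> (\<forall>a\<in>A. e a \<bullet> x \<in> \<int>)"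
    using lattice_basis_dual[OF A(1)] by metis
  have uA: "u \<rho> \<in> span A" using u_in_lat[OF \<rho>] N by blast
  show ?case
  proof (cases "\<rho> \<subseteq> nc p")
    case True
    then show ?thesis using m[OF \<rho>] by simp
  next
    case False
    then have "u \<rho> \<notin> nc p" using ray_subset_nc_iff'[OF p \<rho>] by simp
    \<comment> \<open>The choice of the pivot: q - p is positive at a and zero on the rest of A, so
      a negative coordinate of u \<rho> at a makes u \<rho> smaller at q than at p.\<close>
    then obtain a where a: "a \<in> A" "e a \<bullet> u \<rho> < 0"
      using uA by (auto simp: A(2) cone_dual_basis[OF e(1) order_refl] not_le)
    obtain q a' where q: "q \<in> verts" "lattice_basis (lat X) (insert a' (A - {a}))"
      "nc q = convex_cone hull (insert a' (A - {a}))" "a' \<notin> A" "e a \<bullet> a' = - 1"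
      and pq: "p \<bullet> a < q \<bullet> a" "\<And>b. b \<in> A - {a} \<Longrightarrow> q \<bullet> b = p \<bullet> b"
      and uniq: "\<And>r B. r \<in> verts \<Longrightarrow> lattice_basis (lat X) B \<Longrightarrow> nc r = convex_cone hull B \<Longrightarrow>
        convex_cone hull (A - {a}) \<subseteq> nc r \<Longrightarrow> B = A \<or> B = insert a' (A - {a})"
      using neighbour[OF p A e(1) a(1)] N a(1) by blast
    have fin: "finite A" using e(1) by (simp add: dual_basis_def)
    have expand: "w \<bullet> x = (e a \<bullet> x) * (w \<bullet> a)"
      if "\<And>b. b \<in> A - {a} \<Longrightarrow> w \<bullet> b = 0" "x \<in> span A" for w x
      using dual_basis_inner_expand[OF e(1) that(2), of w] fin a(1) that(1)
        sum.neutral[of "A - {a}" "\<lambda>b. (e b \<bullet> x) * (w \<bullet> b)"]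
      by (simp add: sum.remove[of A a])
    have "(q - p) \<bullet> u \<rho> = (e a \<bullet> u \<rho>) * ((q - p) \<bullet> a)"
      using pq(2) uA by (intro expand) (auto simp: inner_diff_left)
    moreover have "(e a \<bullet> u \<rho>) * ((q - p) \<bullet> a) < 0"
      using a(2) pq(1) by (simp add: mult_neg_pos inner_diff_left)
    ultimately have lt: "q \<bullet> u \<rho> < p \<bullet> u \<rho>" by (simp add: inner_diff_left)
    have finv: "finite verts" using verts_V V(1) finite_subset by blast
    have "{r \<in> verts. r \<bullet> u \<rho> < q \<bullet> u \<rho>} \<subset> {r \<in> verts. r \<bullet> u \<rho> < p \<bullet> u \<rho>}"
      using lt q(1) by auto
    then have card: "card {r \<in> verts. r \<bullet> u \<rho> < q \<bullet> u \<rho>} < card {r \<in> verts. r \<bullet> u \<rho> < p \<bullet> u \<rho>}"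
      using finv by (intro psubset_card_mono) auto
    obtain m' where m': "\<And>\<rho>. \<rho> \<in> rays X \<Longrightarrow> \<rho> \<subseteq> nc q \<Longrightarrow>
        m' \<bullet> u \<rho> = - real_of_int (lookup D \<rho>)"
      using local_equation[OF q(1)] by blast
    have IH: "m' \<bullet> u \<rho> + real_of_int (lookup D \<rho>) \<ge> 0"
      using less.hyps[OF card q(1) m'] .
    have vals: "m \<bullet> b = - real_of_int (lookup D (ray b))" if "b \<in> A" for b
      using m[of "ray b"] basis_vector_ray[OF p A that] hull_mono[of "{b}" A convex_cone] that A(2)
      by auto
    have vals': "m' \<bullet> b = - real_of_int (lookup D (ray b))"
      if "b \<in> insert a' (A - {a})" for b
      using m'[of "ray b"] basis_vector_ray[OF q(1-3) that] that q(3)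
        hull_mono[of "{b}" "insert a' (A - {a})" convex_cone]
      by auto
    \<comment> \<open>m and m' agree on the wall, so m - m' is determined by its value at a.
      \<open>nef_adjacent\<close> makes it nonnegative at a', hence nonpositive at a, hence
      nonnegative at u \<rho>, whose coordinate at a is negative.\<close>
    have zero: "(m - m') \<bullet> b = 0" if "b \<in> A - {a}" for b
      using vals[of b] vals'[of b] that by (simp add: inner_diff_left)
    have "m \<bullet> a' + real_of_int (lookup D (ray a')) \<ge> 0"
      by (rule nef_adjacent[OF nef p A e(1) _ a(1) q uniq m]) (use N in blast)+
    then have "(m - m') \<bullet> a' \<ge> 0"
      using vals'[of a'] by (simp add: inner_diff_left)
    moreover have "a' \<in> span A"
      using basis_span[OF q(2)] basis_span[OF A(1)] by (metis insertI1 span_base)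
    then have "(m - m') \<bullet> a' = - ((m - m') \<bullet> a)"
      using expand[of "m - m'" a'] zero q(5) by simp
    ultimately have "(e a \<bullet> u \<rho>) * ((m - m') \<bullet> a) \<ge> 0"
      using a(2) by (simp add: mult_nonpos_nonpos)
    moreover have "(m - m') \<bullet> u \<rho> = (e a \<bullet> u \<rho>) * ((m - m') \<bullet> a)"
      using zero uA by (intro expand) auto
    ultimately show ?thesis using IH by (simp add: inner_diff_left)
  qed
qed

text \<open>Nef classes have no base points: at a vertex whose cone contains \<sigma>, the local
  equation makes the divisor effective by \<open>nef_local_equation\<close> and removes the rays of
  \<sigma>. The monomial obtained is invertible on the chart of \<sigma>.\<close>

lemma nef_section:
  assumes "c \<in> Nef X" "\<sigma> \<in> cones X"
  obtains t where "keys t \<subseteq> {\<rho> \<in> rays X. \<not> \<rho> \<subseteq> \<sigma>}" "mdeg X t = c"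
proof -
  obtain D where D: "keys D \<subseteq> rays X" "nef_divisor X D" "c = div_class X D"
    using assms(1) by (auto simp: Nef_def)
  obtain p where p: "p \<in> verts" "\<sigma> \<subseteq> nc p" using cone_subset_nc[OF assms(2)] .
  obtain m where m: "m \<in> dual_lattice X" "\<And>\<rho>. \<rho> \<in> rays X \<Longrightarrow> \<rho> \<subseteq> nc p \<Longrightarrow>
        m \<bullet> u \<rho> = - real_of_int (lookup D \<rho>)"
    using local_equation[OF p(1)] by blast
  let ?E = "D + principal_divisor X m"
  have E: "real_of_int (lookup ?E \<rho>) = m \<bullet> u \<rho> + real_of_int (lookup D \<rho>)"
    if "\<rho> \<in> rays X" for \<rho>
    using that m(1) by (simp add: lookup_add of_int_lookup_principal)
  have keys: "keys ?E \<subseteq> rays X"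
    using D(1) keys_principal[of m] Poly_Mapping.keys_add[of D "principal_divisor X m"] by blast
  have "lookup ?E \<rho> \<ge> 0" for \<rho>
  proof (cases "\<rho> \<in> rays X")
    case True
    then show ?thesis
      using E[OF True] nef_local_equation[OF D(2) True p(1) m(2)] by linarith
  next
    case False
    then have "\<rho> \<notin> keys ?E" using keys by blast
    then show ?thesis by (simp add: in_keys_iff)
  qed
  moreover have "keys ?E \<subseteq> {\<rho> \<in> rays X. \<not> \<rho> \<subseteq> \<sigma>}"
  proof
    fix \<rho> assume \<rho>: "\<rho> \<in> keys ?E"
    then have r: "\<rho> \<in> rays X" using keys by blast
    then have "\<not> \<rho> \<subseteq> nc p"
      using E[OF r] m(2)[OF r] \<rho> by (auto simp: in_keys_iff)
    then show "\<rho> \<in> {\<rho> \<in> rays X. \<not> \<rho> \<subseteq> \<sigma>}" using r p(2) by blast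
  qed
  ultimately show ?thesis
    using effective_monomial[of ?E] that D(1,3) m(1) div_class_add_principal by metis
qed

text \<open>\<open>n\<close> is a multiple of the ample class of the polytope.\<close>

lemma ample_section:
  assumes p: "p \<in> verts" and a: "a \<in> carrier (Pic X)"
  obtains n t where "n \<in> Nef X" "keys t \<subseteq> {\<rho> \<in> rays X. \<not> \<rho> \<subseteq> nc p}"
    "mdeg X t = a \<otimes>\<^bsub>Pic X\<^esub> n"
proof -
  \<comment> \<open>The divisor whose polytope of sections is the hull of V. The minima are integers
    because V lies in the dual lattice, so the floor only changes the type.\<close>
  define H :: "'v divisor" where
    "H = (\<Sum>\<rho>\<in>rays X. single \<rho> (- \<lfloor>Min ((\<lambda>q. q \<bullet> u \<rho>) ` V)\<rfloor>))"
  have H: "lookup H \<rho> = (if \<rho> \<in> rays X then - \<lfloor>Min ((\<lambda>q. q \<bullet> u \<rho>) ` V)\<rfloor> else 0)" for \<rho>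
    using finite_rays by (simp add: H_def lookup_sum lookup_single when_def)
  have Hmin: "real_of_int (lookup H \<rho>) = - Min ((\<lambda>q. q \<bullet> u \<rho>) ` V)" if "\<rho> \<in> rays X" for \<rho>
  proof -
    have "Min ((\<lambda>q. q \<bullet> u \<rho>) ` V) \<in> (\<lambda>q. q \<bullet> u \<rho>) ` V" using V by (intro Min_in) auto
    then have "Min ((\<lambda>q. q \<bullet> u \<rho>) ` V) \<in> \<int>" using V(3) dual_int[OF _ that] by auto
    then show ?thesis using that by (simp add: H)
  qed
  have keysH: "keys H \<subseteq> rays X"
    by (auto simp: in_keys_iff H split: if_splits)
  have rdual: "r \<in> dual_lattice X" if "r \<in> verts" for r using that verts_V V(3) by blast
  have ge: "r \<bullet> u \<rho> + real_of_int (lookup H \<rho>) \<ge> 0"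
    if "r \<in> verts" "\<rho> \<in> rays X" for r \<rho>
  proof -
    have "Min ((\<lambda>q. q \<bullet> u \<rho>) ` V) \<le> r \<bullet> u \<rho>"
      using that verts_V V(1) by (intro Min_le) auto
    then show ?thesis using Hmin[OF that(2)] by simp
  qed
  have eq0: "r \<bullet> u \<rho> + real_of_int (lookup H \<rho>) = 0 \<longleftrightarrow> \<rho> \<subseteq> nc r"
    if "r \<in> verts" "\<rho> \<in> rays X" for r \<rho>
  proof -
    have "r \<bullet> u \<rho> = Min ((\<lambda>q. q \<bullet> u \<rho>) ` V) \<longleftrightarrow> (\<forall>q\<in>V. r \<bullet> u \<rho> \<le> q \<bullet> u \<rho>)"
      using that verts_V V by (subst eq_commute, subst Min_eq_iff) auto
    then show ?thesis
      using ray_subset_nc_iff'[OF that] that u_in_lat by (auto simp: Hmin nc_def span_base)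
  qed
  \<comment> \<open>For a vertex r whose cone contains \<tau>, adding the divisor of r changes no
    intersection number and makes H effective with coefficient 0 on the rays of \<tau>. The
    remaining rays meet the curve of \<tau> nonnegatively.\<close>
  have nefH: "nef_divisor X (frag_cmul (int k) H)" for k
    unfolding nef_divisor_def
  proof (intro ballI allI impI)
    fix \<tau> \<beta> assume \<tau>: "\<tau> \<in> walls X" and \<beta>: "intersection_numbers X \<tau> \<beta>"
    obtain r where r: "r \<in> verts" "\<tau> \<subseteq> nc r"
      using cone_subset_nc[of \<tau>] \<tau> by (auto simp: walls_def)
    have "(\<Sum>\<rho>\<in>rays X. (r \<bullet> u \<rho>) * \<beta> \<rho>) = r \<bullet> (\<Sum>\<rho>\<in>rays X. of_int (\<beta> \<rho>) *\<^sub>R u \<rho>)"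
      by (simp add: inner_sum_right mult.commute)
    then have 0: "(\<Sum>\<rho>\<in>rays X. (r \<bullet> u \<rho>) * \<beta> \<rho>) = 0"
      using \<beta> by (simp add: intersection_numbers_def)
    have "(\<Sum>\<rho>\<in>rays X. (r \<bullet> u \<rho> + real_of_int (lookup H \<rho>)) * \<beta> \<rho>) \<ge> 0"
    proof (rule sum_nonneg)
      fix \<rho> assume \<rho>: "\<rho> \<in> rays X"
      show "(r \<bullet> u \<rho> + real_of_int (lookup H \<rho>)) * \<beta> \<rho> \<ge> 0"
      proof (cases "\<rho> \<subseteq> \<tau>")
        case True
        then have "\<rho> \<subseteq> nc r" using r(2) by blast
        then show ?thesis using eq0[OF r(1) \<rho>] by simp
      next
        case False
        then have "\<beta> \<rho> \<ge> 0" using \<beta> \<rho> by (simp add: intersection_numbers_def)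
        then show ?thesis using ge[OF r(1) \<rho>] by simp
      qed
    qed
    then have "0 \<le> real_of_int (\<Sum>\<rho>\<in>rays X. lookup H \<rho> * \<beta> \<rho>)"
      using 0 by (simp add: distrib_right sum.distrib)
    then have "0 \<le> (\<Sum>\<rho>\<in>rays X. lookup H \<rho> * \<beta> \<rho>)" by linarith
    then show "0 \<le> (\<Sum>\<rho>\<in>rays X. lookup (frag_cmul (int k) H) \<rho> * \<beta> \<rho>)"
      by (simp add: mult.assoc flip: sum_distrib_left)
  qed
  obtain D where D: "keys D \<subseteq> rays X" "a = div_class X D"
    using a by (auto simp: carrier_Pic)
  obtain m where m: "m \<in> dual_lattice X" "\<And>\<rho>. \<rho> \<in> rays X \<Longrightarrow> \<rho> \<subseteq> nc p \<Longrightarrow>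
        m \<bullet> u \<rho> = - real_of_int (lookup D \<rho>)"
    using local_equation[OF p] by blast
  define D' where "D' = D + principal_divisor X m"
  \<comment> \<open>Moved by the vertex p, the divisor H becomes effective with support exactly the
    rays outside \<open>nc p\<close>, so a large multiple absorbs the negative coefficients of
    D'.\<close>
  define G where "G = H + principal_divisor X p"
  have D': "keys D' \<subseteq> rays X" "div_class X D' = a"
    using D m(1) div_class_add_principal keys_principal[of m]
      Poly_Mapping.keys_add[of D "principal_divisor X m"] unfolding D'_def by blast+
  have D'0: "lookup D' \<rho> = 0" if "\<rho> \<in> rays X" "\<rho> \<subseteq> nc p" for \<rho>
  proof -
    have "real_of_int (lookup D' \<rho>) = 0"
      using m that by (simp add: D'_def lookup_add of_int_lookup_principal)
    then show ?thesis by simp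
  qed
  have G: "real_of_int (lookup G \<rho>) = p \<bullet> u \<rho> + real_of_int (lookup H \<rho>)"
    if "\<rho> \<in> rays X" for \<rho>
    using that rdual[OF p] by (simp add: G_def lookup_add of_int_lookup_principal)
  have keysG: "keys G \<subseteq> rays X"
    using keysH keys_principal[of p] Poly_Mapping.keys_add[of H "principal_divisor X p"] unfolding G_def by blast
  \<comment> \<open>The sum bounds each coefficient of D' in absolute value, and G is at least 1 on
    the rays outside \<open>nc p\<close>.\<close>
  define k where "k = nat (\<Sum>\<rho>\<in>rays X. \<bar>lookup D' \<rho>\<bar>)"
  have keyskH: "keys (frag_cmul (int k) H) \<subseteq> rays X"
    using keysH keys_cmul[of "int k" H] by blast
  define E where "E = D' + frag_cmul (int k) G"
  have E: "lookup E \<rho> = lookup D' \<rho> + int k * lookup G \<rho>" for \<rho>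
    by (simp add: E_def lookup_add)
  have keysE: "keys E \<subseteq> rays X"
    using D'(1) keysG keys_cmul[of "int k" G] Poly_Mapping.keys_add[of D' "frag_cmul (int k) G"]
    unfolding E_def by blast
  have E0: "lookup E \<rho> = 0" if "\<rho> \<in> rays X" "\<rho> \<subseteq> nc p" for \<rho>
    using D'0[OF that] G[OF that(1)] eq0[OF p that(1)] that(2) by (simp add: E)
  have "lookup E \<rho> \<ge> 0" for \<rho>
  proof (cases "\<rho> \<in> rays X \<and> \<not> \<rho> \<subseteq> nc p")
    case True
    then have \<rho>: "\<rho> \<in> rays X" by simp
    have "real_of_int (lookup G \<rho>) > 0"
      using True G[OF \<rho>] ge[OF p \<rho>] eq0[OF p \<rho>] by linarith
    then have "lookup G \<rho> \<ge> 1" by linarith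
    then have "int k * lookup G \<rho> \<ge> int k"
      using mult_left_mono[of 1 "lookup G \<rho>" "int k"] by simp
    moreover have "\<bar>lookup D' \<rho>\<bar> \<le> (\<Sum>\<rho>\<in>rays X. \<bar>lookup D' \<rho>\<bar>)"
      using \<rho> finite_rays by (intro member_le_sum) auto
    then have "\<bar>lookup D' \<rho>\<bar> \<le> int k" by (simp add: k_def)
    ultimately show ?thesis by (simp add: E)
  next
    case False
    then have "\<rho> \<notin> keys E" using E0[of \<rho>] keysE by (auto simp: in_keys_iff)
    then show ?thesis by (simp add: in_keys_iff)
  qed
  moreover have "keys E \<subseteq> {\<rho> \<in> rays X. \<not> \<rho> \<subseteq> nc p}"
    using E0 keysE by (auto simp: in_keys_iff)
  ultimately obtain t where t: "keys t \<subseteq> {\<rho> \<in> rays X. \<not> \<rho> \<subseteq> nc p}" "mdeg X t = div_class X E"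
    using effective_monomial[of E "{\<rho> \<in> rays X. \<not> \<rho> \<subseteq> nc p}"] by blast
  have pk: "real k *\<^sub>R p \<in> dual_lattice X \<and> principal_divisor X (real k *\<^sub>R p) = frag_cmul (int k) (principal_divisor X p)" for k
  proof (induction k)
    case 0
    then show ?case by (simp add: dual_lattice_closed principal_zero)
  next
    case (Suc k)
    then show ?case
      using rdual[OF p] principal_add[of p "real k *\<^sub>R p"] dual_lattice_closed(3)[of p "real k *\<^sub>R p"]
      by (simp add: algebra_simps frag_cmul_distrib)
  qed
  have "E = (D' + frag_cmul (int k) H) + principal_divisor X (real k *\<^sub>R p)"
    using pk[of k] by (simp add: E_def G_def frag_cmul_distrib2 add.assoc)
  then have "div_class X E = div_class X (D' + frag_cmul (int k) H)"
    using pk[of k] D'(1) keyskH Poly_Mapping.keys_add[of D' "frag_cmul (int k) H"]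
    by (metis (no_types, lifting) div_class_add_principal le_sup_iff order_trans)
  also have "\<dots> = a \<otimes>\<^bsub>Pic X\<^esub> div_class X (frag_cmul (int k) H)"
    using D' keyskH by (simp add: div_class_add)
  finally have "mdeg X t = a \<otimes>\<^bsub>Pic X\<^esub> div_class X (frag_cmul (int k) H)" using t(2) by simp
  moreover have "div_class X (frag_cmul (int k) H) \<in> Nef X"
    using nefH keyskH unfolding Nef_def by auto
  ultimately show ?thesis using that t(1) by blast
qed

lemma Nef_closed: "n \<in> Nef X \<Longrightarrow> n \<in> carrier (Pic X)"
  by (auto simp: Nef_def div_class_closed)

lemma lookup_xhat:
  "lookup (xhat X \<sigma>) \<rho> = (if \<rho> \<in> rays X \<and> \<not> \<rho> \<subseteq> \<sigma> then 1 else 0)"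
  using finite_rays by (simp add: xhat_def lookup_sum lookup_single when_def)

lemma keys_xhat: "keys (xhat X \<sigma>) = {\<rho> \<in> rays X. \<not> \<rho> \<subseteq> \<sigma>}"
  by (auto simp: in_keys_iff lookup_xhat split: if_splits)

end

lemma smooth_projective_toric_variety_fan:
  assumes "smooth_projective_toric_variety X"
  obtains V where "smooth_projective_fan X V"
  using assms
  by (auto simp: smooth_projective_toric_variety_def projective_fan_def smooth_projective_fan_def)

section \<open>Regularity\<close>

text \<open>A nontrivial group contains a fraction different from \<one>, and such a fraction has a
  numerator that no power of x^t kills.\<close>

lemma (in graded_cox) nonzero_section:
  assumes t: "on_rays t" and nontriv: "\<not> trivial_group (localization_part X M gr t \<one>\<^bsub>Pic X\<^esub>)"
  obtains b m where "b \<in> carrier (Pic X)" "m \<in> gr b" "\<And>j. xmon t ^ j \<odot> m \<noteq> \<zero>"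
proof -
  let ?L = "localization M (xmon t)"
  have R: "(xmon t :: ('v, 'k) cox) \<in> carrier (cox_ring X)" using t by (rule xmon_closed)
  have sub: "subgroup (loc_part t \<one>\<^bsub>Pic X\<^esub>) ?L" using t by (intro subgroup_loc_part) auto
  have eq: "localization_part X M gr t \<one>\<^bsub>Pic X\<^esub> = ?L\<lparr>carrier := loc_part t \<one>\<^bsub>Pic X\<^esub>\<rparr>"
    by (simp add: localization_part_def loc_part_def)
  have "Group.group (localization_part X M gr t \<one>\<^bsub>Pic X\<^esub>)"
    unfolding eq using subgroup.subgroup_is_group[OF sub] comm_group.axioms(2)[OF comm_group_localization[OF R]] .
  then have "loc_part t \<one>\<^bsub>Pic X\<^esub> \<noteq> {\<one>\<^bsub>?L\<^esub>}"
    using nontriv by (simp add: trivial_group_def eq)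
  then obtain x where x: "x \<in> loc_part t \<one>\<^bsub>Pic X\<^esub>" "x \<noteq> \<one>\<^bsub>?L\<^esub>"
    using subgroup.one_closed[OF sub] by blast
  then obtain m k where m: "x = fraction M (xmon t) m k" "m \<in> gr (\<one>\<^bsub>Pic X\<^esub> \<otimes>\<^bsub>Pic X\<^esub> mdeg X t [^]\<^bsub>Pic X\<^esub> (k::nat))"
    by (auto simp: loc_part_def)
  have b: "\<one>\<^bsub>Pic X\<^esub> \<otimes>\<^bsub>Pic X\<^esub> mdeg X t [^]\<^bsub>Pic X\<^esub> k \<in> carrier (Pic X)"
    using mdeg_closed[OF t] by simp
  have "xmon t ^ j \<odot> m \<noteq> \<zero>" for j
    using x(2) m(1) fraction_eq_one_iff[OF R gr_closed[OF b m(2)], of k] by blast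
  then show ?thesis using that b m(2) by blast
qed

lemma set_irrelevant_generators:
  assumes "finite (cones X)"
  shows "set (irrelevant_generators X) = xhat X ` cones X"
proof -
  have "distinct (SOME \<sigma>s. distinct \<sigma>s \<and> set \<sigma>s = cones X) \<and> set (SOME \<sigma>s. distinct \<sigma>s \<and> set \<sigma>s = cones X) = cones X"
    by (rule someI_ex) (use finite_distinct_list[OF assms] in blast)
  then show ?thesis by (simp add: irrelevant_generators_def)
qed

lemma (in graded_cox) smult_zero_of_divides:
  fixes f g :: "('v, 'k) cox"
  assumes "f \<in> carrier (cox_ring X)" "g \<in> carrier (cox_ring X)" "m \<in> carrier M" "f \<odot> m = \<zero>"
  shows "(g * f) \<odot> m = \<zero>"
  using assms smult_smult[of g f m] by simp

theorem proposition4p1: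
  fixes X :: "'v::euclidean_space toric"
    and M :: "(('v, 'k::field) cox, 'm) module"
    and gr :: "'v pic \<Rightarrow> 'm set"
    and C :: "'v pic set"
  assumes "smooth_projective_toric_variety X"
    and "minimal_monoid_generators (Pic X) (Nef X) C"
    and "graded_module X M gr"
    and "finitely_generated (cox_ring X) M"
    and "sheaf_nonzero X M gr"
    and "minimal_generator_degrees X M gr \<subseteq> Eff X"
  shows "reg X C M gr \<subseteq> Eff X"
proof
  obtain V where "smooth_projective_fan X V"
    using smooth_projective_toric_variety_fan[OF assms(1)] .
  then interpret fan: smooth_projective_fan X V .
  define ts where "ts = irrelevant_generators X"
  have cones: "finite (cones X)" "cones X \<noteq> {}"
    using fan.fan by (auto simp: is_fan_def)
  have set_ts: "set ts = xhat X ` cones X"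
    unfolding ts_def using set_irrelevant_generators[OF cones(1)] .
  interpret cech X M gr ts
  proof (intro cech.intro graded_cox.intro cech_axioms.intro)
    show "graded_module X M gr" by fact
    show "comm_group (Pic X)" by (rule fan.comm_group_Pic)
    show "keys t \<subseteq> rays X" if "t \<in> set ts" for t
      using that fan.keys_xhat by (auto simp: set_ts)
  qed (fact fan.mdeg_closed fan.mdeg_add)+
  note NefC = fan.Nef_closed
  have C: "finite C" "monoid_span (Pic X) C = Nef X"
    using assms(2) by (auto simp: minimal_monoid_generators_def)
  have C_Nef: "c \<in> Nef X" if "c \<in> C" for c
    using that monoid_span.incl[of c C "Pic X"] C(2) by simp
  have C_closed: "c \<in> \<P>" if "c \<in> C" for c
    using that C_Nef NefC by blast
  have Nef_one: "\<one>\<^sub>P \<in> Nef X"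
    using monoid_span.one[of "Pic X" C] C(2) by simp
  have Nef_mult: "a \<cdot> b \<in> Nef X" if "a \<in> Nef X" "b \<in> Nef X" for a b
    using that monoid_span.mult[of a "Pic X" C b] C(2) by simp
  fix d assume dreg: "d \<in> reg X C M gr"
  then have d: "d \<in> \<P>" by (simp add: reg_def)
  \<comment> \<open>The regularity condition in cohomological degree i = p + 1, so that |\<lambda>|
    = p.\<close>
  have van: "trivial_group (local_cohomology X M gr ts (Suc p) (d \<cdot> inv\<^sub>P (comb X C l) \<cdot> n))"
    if "sum l C = p" "n \<in> Nef X" for p l n
    using dreg that by (auto simp: reg_def regular_def H_B_def ts_def)
  show "d \<in> Eff X"
  proof (rule ccontr)
    assume "d \<notin> Eff X"
    then have zero: "gr d \<subseteq> {\<zero>\<^bsub>M\<^esub>}"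
      using graded_part_zero[OF assms(4,6) d] by blast
    \<comment> \<open>\<open>P n\<close> means that the sheaf has no nonzero global section in
      degree d + n.\<close>
    define P where "P n \<longleftrightarrow> (\<forall>z\<in>cochains_of (d \<cdot> n) 1.
      cech_diff M ts 1 z = \<one>\<^bsub>cochains 2\<^esub> \<longrightarrow> z = \<one>\<^bsub>cochains 1\<^esub>)" for n
    have P_one: "P \<one>\<^sub>P"
    proof -
      have "comb X C (\<lambda>_. 0) = \<one>\<^sub>P"
        by (simp add: comb_def Pic.finprod_one_eqI)
      then have "trivial_group (local_cohomology X M gr ts 1 d)"
        using van[of "\<lambda>_. 0" 0 "\<one>\<^sub>P"] Nef_one d by simp
      then show ?thesis
        using cocycle_trivial_of_zero[OF d _ zero] d by (simp add: P_def)
    qed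
    have P_step: "P (n \<cdot> c)" if c: "c \<in> C" and n: "n \<in> Nef X" "P n" for c n
    proof -
      note cP = C_closed[OF c] and nP = NefC[OF n(1)]
      define e where "e = d \<cdot> (n \<cdot> c)"
      have e: "e \<in> \<P>" using d cP nP by (simp add: e_def)
      have ec: "e \<cdot> inv\<^sub>P c = d \<cdot> n"
        using d cP nP by (simp add: e_def Pic.m_assoc)
      have "\<exists>r. on_rays r \<and> mdeg X r = c \<and> keys r \<subseteq> keys t" if t: "t \<in> set ts" for t
      proof -
        obtain \<sigma> where \<sigma>: "\<sigma> \<in> cones X" "t = xhat X \<sigma>" using t set_ts by blast
        obtain r where "keys r \<subseteq> {\<rho> \<in> rays X. \<not> \<rho> \<subseteq> \<sigma>}" "mdeg X r = c"
          using fan.nef_section[OF C_Nef[OF c] \<sigma>(1)] .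
        then show ?thesis using \<sigma>(2) fan.keys_xhat by blast
      qed
      then obtain r where r: "\<And>t. t \<in> set ts \<Longrightarrow> on_rays (r t)" "\<And>t. t \<in> set ts \<Longrightarrow> mdeg X (r t) = c"
        "\<And>t. t \<in> set ts \<Longrightarrow> keys (r t) \<subseteq> keys t" by metis
      \<comment> \<open>One section of degree c for each generator of B, invertible on its chart.
        \<open>koszul_step\<close> expects a section for every natural number, so the list is
        repeated cyclically.\<close>
      define \<tau> where "\<tau> i = r (ts ! (i mod length ts))" for i
      have ne: "length ts > 0" using set_ts cones(2) by auto
      have in_ts: "ts ! (i mod length ts) \<in> set ts" for i using ne by simp
      have "z = \<one>\<^bsub>cochains 1\<^esub>" if z: "z \<in> cochains_of e 1" "cech_diff M ts 1 z = \<one>\<^bsub>cochains 2\<^esub>" for z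
      proof (rule koszul_step[OF e cP, where \<tau> = \<tau> and K = "length ts"])
        show "on_rays (\<tau> i)" "mdeg X (\<tau> i) = c" for i
          unfolding \<tau>_def using r in_ts by blast+
        show "\<exists>i<length ts. keys (\<tau> i) \<subseteq> keys t" if t: "t \<in> set ts" for t
        proof -
          obtain i where "i < length ts" "ts ! i = t" using t by (auto simp: in_set_conv_nth)
          then show ?thesis using r(3)[OF t] by (auto simp: \<tau>_def intro!: exI[of _ i])
        qed
        show "x = \<one>\<^bsub>cochains 1\<^esub>"
          if "x \<in> cochains_of (e \<cdot> inv\<^sub>P c) 1" "cech_diff M ts 1 x = \<one>\<^bsub>cochains 2\<^esub>" for x
          using that n(2) unfolding ec P_def by blast
        fix p x assume p: "p > 0" and x: "x \<in> cochains_of (e \<cdot> inv\<^sub>P c \<up> Suc p) (Suc p)"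
          "cech_diff M ts (Suc p) x = \<one>\<^bsub>cochains (Suc (Suc p))\<^esub>"
        \<comment> \<open>With \<lambda> equal to p at c and 0 elsewhere, the degree d - p c + n is
          e - (p+1) c.\<close>
        let ?l = "\<lambda>c'. if c' = c then p else 0"
        have "comb X C ?l = finprod (Pic X) (\<lambda>c'. if c = c' then c' \<up> p else \<one>\<^sub>P) C"
          unfolding comb_def using C_closed by (intro Pic.finprod_cong') auto
        also have "\<dots> = c \<up> p"
          using C_closed c C(1) by (intro Pic.finprod_singleton) auto
        finally have "d \<cdot> inv\<^sub>P (comb X C ?l) \<cdot> n =
            (e \<cdot> inv\<^sub>P c) \<cdot> inv\<^sub>P c \<up> p"
          unfolding ec using d cP nP by (simp add: Pic.m_ac Pic.nat_pow_inv)
        also have "\<dots> = e \<cdot> inv\<^sub>P c \<up> Suc p"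
          using e cP by (simp add: Pic.m_ac)
        finally have b: "d \<cdot> inv\<^sub>P (comb X C ?l) \<cdot> n =
            e \<cdot> inv\<^sub>P c \<up> Suc p" .
        have "sum ?l C = p" using C(1) c by simp
        then have "trivial_group (local_cohomology X M gr ts (Suc p) (e \<cdot> inv\<^sub>P c \<up> Suc p))"
          using van[OF _ n(1), of ?l p] unfolding b by blast
        then show "\<exists>w\<in>cochains_of (e \<cdot> inv\<^sub>P c \<up> Suc p) p. cech_diff M ts p w = x"
          using e cP x by (intro vanishing_imp_lift) auto
      qed (fact z)+
      then show ?thesis by (simp add: P_def e_def)
    qed
    \<comment> \<open>A single step is available only along a generator. Quantifying over all n
      makes the claim closed under products of classes, as the induction over
      \<open>monoid_span\<close> requires.\<close>
    have "a \<in> Nef X \<and> (\<forall>n\<in>Nef X. P n \<longrightarrow> P (n \<cdot> a))" if "a \<in> monoid_span (Pic X) C" for a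
      using that
    proof induction
      case one
      then show ?case using Nef_one NefC by simp
    next
      case (incl a)
      then show ?case using C_Nef P_step by blast
    next
      case (mult a b)
      have "P (n \<cdot> (a \<cdot> b))" if "n \<in> Nef X" "P n" for n
        using mult.IH that Nef_mult[of n a] NefC by (metis Pic.m_assoc)
      then show ?case using mult.IH Nef_mult by blast
    qed
    then have P_Nef: "P n" if "n \<in> Nef X" for n
      using that Nef_one P_one NefC[OF that] unfolding C(2) by (metis Pic.l_one)
    obtain \<sigma> where \<sigma>: "\<sigma> \<in> cones X" "\<not> trivial_group (localization_part X M gr (xhat X \<sigma>) \<one>\<^sub>P)"
      using assms(5) by (auto simp: sheaf_nonzero_def sheaf_sections_def)
    obtain b m where b: "b \<in> \<P>" and m: "m \<in> gr b" "\<And>j. xmon (xhat X \<sigma>) ^ j \<odot>\<^bsub>M\<^esub> m \<noteq> \<zero>\<^bsub>M\<^esub>"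
      using nonzero_section[OF _ \<sigma>(2)] fan.keys_xhat by blast
    \<comment> \<open>\<open>ample_section\<close> works on maximal charts. Since \<sigma> lies in
      the cone of v, the monomial of that cone divides the one of \<sigma>, so torsion on the chart
      of v implies torsion on that of \<sigma>.\<close>
    obtain v where v: "v \<in> fan.verts" "\<sigma> \<subseteq> fan.nc v" using fan.cone_subset_nc[OF \<sigma>(1)] .
    let ?f = "xhat X (fan.nc v)"
    obtain n t where n: "n \<in> Nef X" and t: "keys t \<subseteq> {\<rho> \<in> rays X. \<not> \<rho> \<subseteq> fan.nc v}"
      "mdeg X t = d \<cdot> inv\<^sub>P b \<cdot> n"
      using fan.ample_section[OF v(1), of "d \<cdot> inv\<^sub>P b"] d b by auto
    note nP = NefC[OF n]
    have on: "on_rays t" "on_rays ?f" using t(1) fan.keys_xhat by blast+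
    have mM: "m \<in> carrier M" using gr_closed[OF b m(1)] .
    have R: "(xmon t :: ('v, 'k) cox) \<in> \<S>" "(xmon ?f :: ('v, 'k) cox) \<in> \<S>"
      using on by (auto intro: xmon_closed)
    have "mdeg X t \<cdot> b = b \<cdot> (d \<cdot> n \<cdot> inv\<^sub>P b)"
      unfolding t(2) using d b nP by (simp add: Pic.m_ac)
    also have "\<dots> = d \<cdot> n" using d b nP by (intro Pic.mult_left_inv_cancel)
    finally have deg: "mdeg X t \<cdot> b = d \<cdot> n" .
    have tm: "xmon t \<odot>\<^bsub>M\<^esub> m \<in> gr (d \<cdot> n)"
      unfolding deg[symmetric] using on(1) b m(1) by (intro gr_smult mdeg_closed xmon_cox_part)
    have fts: "?f \<in> set ts" using fan.nc_in_cones[OF v(1)] set_ts by blast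
    obtain j where j: "xmon ?f ^ j \<odot>\<^bsub>M\<^esub> (xmon t \<odot>\<^bsub>M\<^esub> m) = \<zero>\<^bsub>M\<^esub>"
      using torsion_of_cocycle_trivial[OF _ _ tm fts] P_Nef[OF n] d nP unfolding P_def by blast
    \<comment> \<open>As x^t divides the q-th power of the monomial of \<open>?f\<close>, the power
      j that kills x^t m yields the power j + q that kills m.\<close>
    obtain s q where s: "keys s \<subseteq> keys ?f" "t + s = ((+) ?f ^^ q) 0"
      using monomial_inverse[of t ?f] t(1) fan.keys_xhat by blast
    obtain w where w: "on_rays w" "xhat X \<sigma> = w + ?f"
    proof
      have le: "lookup ?f \<rho> \<le> lookup (xhat X \<sigma>) \<rho>" for \<rho>
        using v(2) fan.lookup_xhat by auto
      show "xhat X \<sigma> = (xhat X \<sigma> - ?f) + ?f"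
        using le by (intro poly_mapping_eqI) (simp add: lookup_add lookup_minus)
      show "on_rays (xhat X \<sigma> - ?f)" using fan.keys_xhat by (intro on_rays_diff) blast
    qed
    define N where "N = j + q"
    have "(xmon (xhat X \<sigma>) :: ('v, 'k) cox) ^ N = xmon w ^ N * (xmon ?f ^ q * xmon ?f ^ j)"
      unfolding w(2) N_def by (simp add: xmon_add power_mult_distrib power_add mult.commute)
    also have "xmon ?f ^ q = xmon s * (xmon t :: ('v, 'k) cox)"
      unfolding xmon_power s(2)[symmetric] by (simp add: xmon_add mult.commute)
    also have "xmon w ^ N * (xmon s * xmon t * xmon ?f ^ j) =
        (xmon w ^ N * xmon s) * (xmon ?f ^ j * (xmon t :: ('v, 'k) cox))"
      by (simp add: ac_simps)
    finally have eq: "(xmon (xhat X \<sigma>) :: ('v, 'k) cox) ^ N = (xmon w ^ N * xmon s) * (xmon ?f ^ j * xmon t)" .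
    have "on_rays s" using s(1) fan.keys_xhat by blast
    then have "(xmon w ^ N * xmon s :: ('v, 'k) cox) \<in> \<S>"
      using w(1) by (intro ring_simps power_closed xmon_closed)
    moreover have z: "(xmon ?f ^ j * xmon t) \<odot>\<^bsub>M\<^esub> m = \<zero>\<^bsub>M\<^esub>"
      using j R mM by (simp add: smult_smult power_closed)
    moreover have "(xmon ?f ^ j * xmon t :: ('v, 'k) cox) \<in> \<S>"
      using R by (intro ring_simps power_closed)
    ultimately have "xmon (xhat X \<sigma>) ^ N \<odot>\<^bsub>M\<^esub> m = \<zero>\<^bsub>M\<^esub>"
      unfolding eq using smult_zero_of_divides[OF _ _ mM z] by blast
    then show False using m(2) by blast
  qed
qed

end
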